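(* There is an algorithm which, given a homogeneous relation $H$ on a finite set $X$, computes in $O(|X|^4\log|X|)$ time the inclusion tree of the strong umodules of $H$ (that is, the set of all strong umodules of $H$, ordered by inclusion into a tree).
   Context: Let $X$ be a finite set. A reflectless triple is $(x|yz)$ with $x,y,z\in X$, $x\neq y$, $x\neq z$. A homogeneous relation $H$ on $X$ is a boolean relation on reflectless triples such that for every $x\in X$ the binary relation $H_x$ on $X\setminus\{x\}$ given by $H_x(y,z)\Leftrightarrow H(x|yz)$ is an equivalence relation. The input $H$ is given by listing, for each $x\in X$, the partition of $X\setminus\{x\}$ into the equivalence classes of $H_x$. A subset $U\subseteq X$ is a umodule of $H$ if for all $u,u'\in U$ and all $x,x'\in X\setminus U$: $H(u|xx')\Leftrightarrow H(u'|xx')$. Two subsets $A,B$ overlap if $A\cap B$, $A\setminus B$ and $B\setminus A$ are all nonempty. A umodule is strong if it overlaps no other umodule of $H$. Any two strong umodules are disjoint or nested, so (the nonempty) strong umodules form a tree under inclusion. *)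

theory Defs
  imports Complex_Main "HOL-Library.Landau_Symbols"
begin

section \<open>Homogeneous relations and umodules\<close>

definition reflectless_triples :: "'a set \<Rightarrow> ('a \<times> 'a \<times> 'a) set" where
  "reflectless_triples X = {(x, y, z). x \<in> X \<and> y \<in> X \<and> z \<in> X \<and> x \<noteq> y \<and> x \<noteq> z}"

definition slice :: "('a \<times> 'a \<times> 'a) set \<Rightarrow> 'a \<Rightarrow> 'a rel" where
  "slice H x = {(y, z). (x, y, z) \<in> H}"

definition homogeneous :: "'a set \<Rightarrow> ('a \<times> 'a \<times> 'a) set \<Rightarrow> bool" where
  "homogeneous X H \<longleftrightarrow>
     H \<subseteq> reflectless_triples X \<and> (\<forall>x\<in>X. equiv (X - {x}) (slice H x))"

definition umodule :: "'a set \<Rightarrow> ('a \<times> 'a \<times> 'a) set \<Rightarrow> 'a set \<Rightarrow> bool" where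
  "umodule X H U \<longleftrightarrow> U \<subseteq> X \<and>
     (\<forall>u\<in>U. \<forall>u'\<in>U. \<forall>x\<in>X - U. \<forall>x'\<in>X - U. (u, x, x') \<in> H \<longleftrightarrow> (u', x, x') \<in> H)"

definition overlap :: "'a set \<Rightarrow> 'a set \<Rightarrow> bool" where
  "overlap A B \<longleftrightarrow> A \<inter> B \<noteq> {} \<and> A - B \<noteq> {} \<and> B - A \<noteq> {}"

definition strong_umodule :: "'a set \<Rightarrow> ('a \<times> 'a \<times> 'a) set \<Rightarrow> 'a set \<Rightarrow> bool" where
  "strong_umodule X H U \<longleftrightarrow> umodule X H U \<and> (\<forall>V. umodule X H V \<longrightarrow> \<not> overlap U V)"

text \<open>The empty set is vacuously a strong umodule, but it is not a node of the tree.\<close>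

definition tree_nodes :: "'a set \<Rightarrow> ('a \<times> 'a \<times> 'a) set \<Rightarrow> 'a set set" where
  "tree_nodes X H = {U. strong_umodule X H U \<and> U \<noteq> {}}"

definition covered_by :: "'a set set \<Rightarrow> 'a set \<Rightarrow> 'a set \<Rightarrow> bool" where
  "covered_by S A B \<longleftrightarrow>
     A \<in> S \<and> B \<in> S \<and> A \<subset> B \<and> \<not> (\<exists>C\<in>S. A \<subset> C \<and> C \<subset> B)"


section \<open>A word RAM with structured control\<close>

text \<open>
  A state consists of registers and a random access memory.  A program mentions only finitely
  many registers; memory is addressed by computed values.  Words range over the numbers below
  a bound \<open>W\<close>; an execution in which a computed value reaches \<open>W\<close> is stuck, so
  that long bit vectors cannot be packed into single words.  Every operator, memory access
  and control step costs one unit.  Subtraction is truncated at zero.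
\<close>

type_synonym state = "(nat \<Rightarrow> nat) \<times> (nat \<Rightarrow> nat)"

datatype aexp =
    Const nat
  | Reg nat
  | Load aexp
  | Plus aexp aexp
  | Minus aexp aexp
  | Times aexp aexp

datatype bexp =
    Less aexp aexp
  | Equal aexp aexp
  | Not bexp
  | And bexp bexp

datatype com =
    Skip
  | Assign nat aexp
  | Store aexp aexp
  | Seq com com
  | If bexp com com
  | While bexp com

fun aval :: "aexp \<Rightarrow> state \<Rightarrow> nat" where
  "aval (Const c) s = c"
| "aval (Reg r) s = fst s r"
| "aval (Load a) s = snd s (aval a s)"
| "aval (Plus a b) s = aval a s + aval b s"
| "aval (Minus a b) s = aval a s - aval b s"
| "aval (Times a b) s = aval a s * aval b s"

fun bval :: "bexp \<Rightarrow> state \<Rightarrow> bool" where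
  "bval (Less a b) s \<longleftrightarrow> aval a s < aval b s"
| "bval (Equal a b) s \<longleftrightarrow> aval a s = aval b s"
| "bval (Not b) s \<longleftrightarrow> \<not> bval b s"
| "bval (And a b) s \<longleftrightarrow> bval a s \<and> bval b s"

fun acost :: "aexp \<Rightarrow> nat" where
  "acost (Const c) = 1"
| "acost (Reg r) = 1"
| "acost (Load a) = acost a + 1"
| "acost (Plus a b) = acost a + acost b + 1"
| "acost (Minus a b) = acost a + acost b + 1"
| "acost (Times a b) = acost a + acost b + 1"

fun bcost :: "bexp \<Rightarrow> nat" where
  "bcost (Less a b) = acost a + acost b + 1"
| "bcost (Equal a b) = acost a + acost b + 1"
| "bcost (Not b) = bcost b + 1"
| "bcost (And a b) = bcost a + bcost b + 1"

text \<open>All values arising in the evaluation of an expression are words.\<close>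

fun afits :: "nat \<Rightarrow> aexp \<Rightarrow> state \<Rightarrow> bool" where
  "afits W (Const c) s \<longleftrightarrow> c < W"
| "afits W (Reg r) s \<longleftrightarrow> fst s r < W"
| "afits W (Load a) s \<longleftrightarrow> afits W a s \<and> snd s (aval a s) < W"
| "afits W (Plus a b) s \<longleftrightarrow> afits W a s \<and> afits W b s \<and> aval a s + aval b s < W"
| "afits W (Minus a b) s \<longleftrightarrow> afits W a s \<and> afits W b s"
| "afits W (Times a b) s \<longleftrightarrow> afits W a s \<and> afits W b s \<and> aval a s * aval b s < W"

fun bfits :: "nat \<Rightarrow> bexp \<Rightarrow> state \<Rightarrow> bool" where
  "bfits W (Less a b) s \<longleftrightarrow> afits W a s \<and> afits W b s"
| "bfits W (Equal a b) s \<longleftrightarrow> afits W a s \<and> afits W b s"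
| "bfits W (Not b) s \<longleftrightarrow> bfits W b s"
| "bfits W (And a b) s \<longleftrightarrow> bfits W a s \<and> bfits W b s"

text \<open>\<open>exec W c s t s'\<close>: with word bound \<open>W\<close>, the program \<open>c\<close> started in
  \<open>s\<close> halts in \<open>s'\<close> after \<open>t\<close> time units.\<close>

inductive exec :: "nat \<Rightarrow> com \<Rightarrow> state \<Rightarrow> nat \<Rightarrow> state \<Rightarrow> bool" for W :: nat where
  Skip: "exec W Skip s 1 s"
| Assign: "afits W a s \<Longrightarrow>
    exec W (Assign r a) s (acost a + 1) ((fst s)(r := aval a s), snd s)"
| Store: "afits W a s \<Longrightarrow> afits W b s \<Longrightarrow>
    exec W (Store a b) s (acost a + acost b + 1) (fst s, (snd s)(aval a s := aval b s))"
| Seq: "exec W c s t s' \<Longrightarrow> exec W d s' t' s'' \<Longrightarrow> exec W (Seq c d) s (t + t') s''"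
| IfTrue: "bfits W b s \<Longrightarrow> bval b s \<Longrightarrow> exec W c s t s' \<Longrightarrow>
    exec W (If b c d) s (bcost b + 1 + t) s'"
| IfFalse: "bfits W b s \<Longrightarrow> \<not> bval b s \<Longrightarrow> exec W d s t s' \<Longrightarrow>
    exec W (If b c d) s (bcost b + 1 + t) s'"
| WhileFalse: "bfits W b s \<Longrightarrow> \<not> bval b s \<Longrightarrow> exec W (While b c) s (bcost b + 1) s"
| WhileTrue: "bfits W b s \<Longrightarrow> bval b s \<Longrightarrow> exec W c s t s' \<Longrightarrow>
    exec W (While b c) s' t' s'' \<Longrightarrow> exec W (While b c) s (bcost b + 1 + t + t') s''"

definition initial_state :: "nat list \<Rightarrow> state" where
  "initial_state ws = ((\<lambda>_. 0), (\<lambda>a. if a < length ws then ws ! a else 0))"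

text \<open>The output starts at the memory address found in register 0.\<close>

definition has_output :: "state \<Rightarrow> nat list \<Rightarrow> bool" where
  "has_output s ws \<longleftrightarrow> (\<forall>i < length ws. snd s (fst s 0 + i) = ws ! i)"


section \<open>Input and output encodings\<close>

text \<open>
  The elements of an \<open>n\<close>-element set are named \<open>0, \<dots>, n - 1\<close> by a bijection
  \<open>e\<close>.  \<open>lists_family e n cs S\<close>: the set family \<open>S\<close> is listed by \<open>cs\<close>,
  each set once, and each set is given as a list of the names of its elements without
  repetition; both orders are arbitrary.
\<close>

definition lists_family :: "(nat \<Rightarrow> 'a) \<Rightarrow> nat \<Rightarrow> nat list list \<Rightarrow> 'a set set \<Rightarrow> bool" where
  "lists_family e n cs S \<longleftrightarrow>
     (\<forall>c\<in>set cs. distinct c \<and> set c \<subseteq> {..<n}) \<and>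
     distinct (map (\<lambda>c. e ` set c) cs) \<and>
     set (map (\<lambda>c. e ` set c) cs) = S"

definition encode_family :: "nat list list \<Rightarrow> nat list" where
  "encode_family cs = length cs # concat (map (\<lambda>c. length c # c) cs)"

definition lists_relation ::
  "(nat \<Rightarrow> 'a) \<Rightarrow> 'a set \<Rightarrow> ('a \<times> 'a \<times> 'a) set \<Rightarrow> nat list list list \<Rightarrow> bool" where
  "lists_relation e X H ps \<longleftrightarrow>
     length ps = card X \<and>
     (\<forall>i < card X. lists_family e (card X) (ps ! i) ((X - {e i}) // slice H (e i)))"

definition encode_relation :: "nat list list list \<Rightarrow> nat list" where
  "encode_relation ps = length ps # concat (map encode_family ps)"

text \<open>The tree is given by the list of its nodes and an array of parent indices, in which
  a root points to itself.\<close>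

definition lists_tree ::
  "(nat \<Rightarrow> 'a) \<Rightarrow> nat \<Rightarrow> 'a set set \<Rightarrow> nat list list \<Rightarrow> nat list \<Rightarrow> bool" where
  "lists_tree e n S cs par \<longleftrightarrow>
     lists_family e n cs S \<and> length par = length cs \<and>
     (\<forall>i < length cs. par ! i < length cs \<and>
        (if \<exists>B\<in>S. e ` set (cs ! i) \<subset> B
         then covered_by S (e ` set (cs ! i)) (e ` set (cs ! (par ! i)))
         else par ! i = i))"

definition encode_tree :: "nat list list \<Rightarrow> nat list \<Rightarrow> nat list" where
  "encode_tree cs par = encode_family cs @ par"


section \<open>Computing the tree of strong umodules\<close>

text \<open>
  A single program must handle all inputs of all sizes.  For \<open>n\<close> elements it runs on words
  of \<open>k * log 2 (n + 2)\<close> bits, for some constant \<open>k\<close>.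
\<close>

definition computes_tree_in_time ::
  "'a itself \<Rightarrow> com \<Rightarrow> nat \<Rightarrow> (nat \<Rightarrow> nat) \<Rightarrow> bool" where
  "computes_tree_in_time TYPE('a) prog k T \<longleftrightarrow>
     (\<forall>(X :: 'a set) H e ps.
        finite X \<longrightarrow> homogeneous X H \<longrightarrow> bij_betw e {..<card X} X \<longrightarrow>
        lists_relation e X H ps \<longrightarrow>
        (\<exists>t s cs par.
           exec ((card X + 2) ^ k) prog (initial_state (encode_relation ps)) t s \<and>
           t \<le> T (card X) \<and>
           lists_tree e (card X) (tree_nodes X H) cs par \<and>
           has_output s (encode_tree cs par)))"

end

theory Submission imports Defs begin

text \<open>
  Umodules are closed under unions of intersecting members, so for each \<open>x\<close> the maximal umodules
  avoiding \<open>x\<close> partition \<open>X - {x}\<close>.  This partition is found by refinement: start with one class,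
  and while some \<open>u\<close> disagrees with the representative of its class \<open>C\<close> on the complement of
  \<open>C\<close>, split \<open>C\<close>.  There are at most \<open>n\<close> splits of cost \<open>O(n\<^sup>2)\<close> for each \<open>x\<close>.

  Call \<open>A\<close> closed if, whenever \<open>x\<close> separates \<open>a\<close> and \<open>y\<close> in \<open>A\<close> (they lie in different
  classes of the partition for \<open>x\<close>, where \<open>{x}\<close> counts as a class), \<open>A\<close> contains \<open>x\<close> and the
  classes of \<open>a\<close> and \<open>y\<close>.  The strong umodules are the closed umodules, and closed sets do not
  overlap; hence those containing \<open>y\<close> form a chain, and every closed set containing \<open>y\<close> is the
  least one containing \<open>y\<close> and some \<open>z\<close>.  For fixed \<open>y\<close> the closure of \<open>{y, z}\<close> is \<open>y\<close>
  together with all that is reachable from \<open>z\<close> in a digraph on \<open>n\<close> vertices.  One transitive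
  closure per \<open>y\<close>, and a quadratic umodule test for each of the \<open>n\<^sup>2\<close> candidates, take
  \<open>O(n\<^sup>4)\<close> in total.
\<close>

section \<open>Bounded loops on the word RAM\<close>

text \<open>Strength quantifies over all umodules, possibly exponentially many. The partitions
  compress this: for \<open>w\<close> and \<open>b\<close> distinct from \<open>x\<close>, some
  umodule contains both and avoids \<open>x\<close> exactly if they share a class for
  \<open>x\<close>, the class itself being such a umodule. So an overlap of \<open>U\<close> with a
  umodule shows up on three points: \<open>x\<close> in \<open>U\<close>, and \<open>w\<close> in
  \<open>U\<close> sharing its class for \<open>x\<close> with some \<open>b\<close> outside
  \<open>U\<close>. Closedness forbids exactly this. Many pairs generate the same closed set.
  Instead of comparing sets, each strong umodule gets a canonical pair: \<open>y\<close> is its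
  least element, and \<open>z\<close> the least vertex of its strong component in the digraph of
  \<open>y\<close>. On the machine, one fixed program must meet both a time bound and a word bound.
  Giving every loop the same number \<open>B = 2 * n\<close> of rounds makes the time a function of
  the program text, with the nesting depth, 4, as exponent. The factor 2 is there because the search
  for parents loops over nodes, and a laminar family of nonempty subsets of an
  \<open>n\<close>-element set has at most \<open>2 * n\<close> members.\<close>

datatype loc = G nat | Tp nat | M nat nat nat

type_synonym store = "loc \<Rightarrow> nat"

datatype ex = N nat | V nat | At nat ex ex | Tape ex

datatype bx = Lt ex ex | Eq ex ex | Neg bx | Conj bx bx

datatype cmd =
    Nop
  | Set nat ex
  | Inc nat
  | Put nat ex ex ex
  | Write ex ex
  | Sq cmd cmd (infixr ";;" 60)
  | Cond bx cmd cmd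
  | For nat cmd

fun ev :: "ex \<Rightarrow> store \<Rightarrow> nat" where
  "ev (N k) s = k"
| "ev (V r) s = s (G r)"
| "ev (At a i j) s = s (M a (ev i s) (ev j s))"
| "ev (Tape p) s = s (Tp (ev p s))"

fun bv :: "bx \<Rightarrow> store \<Rightarrow> bool" where
  "bv (Lt a b) s \<longleftrightarrow> ev a s < ev b s"
| "bv (Eq a b) s \<longleftrightarrow> ev a s = ev b s"
| "bv (Neg b) s \<longleftrightarrow> \<not> bv b s"
| "bv (Conj a b) s \<longleftrightarrow> bv a s \<and> bv b s"

text \<open>Every loop makes exactly \<open>B\<close> rounds, so the running time depends on the program text and
  on \<open>B\<close> only.  A shorter loop is obtained by guarding its body.\<close>

fun run :: "nat \<Rightarrow> cmd \<Rightarrow> store \<Rightarrow> store" where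
  "run B Nop s = s"
| "run B (Set r e) s = s(G r := ev e s)"
| "run B (Inc r) s = s(G r := Suc (s (G r)))"
| "run B (Put a i j e) s = s(M a (ev i s) (ev j s) := ev e s)"
| "run B (Write p e) s = s(Tp (ev p s) := ev e s)"
| "run B (Sq c d) s = run B d (run B c s)"
| "run B (Cond b c d) s = (if bv b s then run B c s else run B d s)"
| "run B (For r c) s = (fold (\<lambda>i s. run B c (s(G r := i))) [0..<B] s)(G r := B)"

text \<open>Indices are computed, so a write counts for its whole array. \<open>run_frame\<close>
  therefore says nothing inside a written array, and loop invariants must state which of its cells
  keep their values.\<close>

fun wr :: "cmd \<Rightarrow> loc \<Rightarrow> bool" where
  "wr Nop l \<longleftrightarrow> False"
| "wr (Set r e) l \<longleftrightarrow> l = G r"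
| "wr (Inc r) l \<longleftrightarrow> l = G r"
| "wr (Put a i j e) l \<longleftrightarrow> (\<exists>x y. l = M a x y)"
| "wr (Write p e) l \<longleftrightarrow> (\<exists>x. l = Tp x)"
| "wr (Sq c d) l \<longleftrightarrow> wr c l \<or> wr d l"
| "wr (Cond b c d) l \<longleftrightarrow> wr c l \<or> wr d l"
| "wr (For r c) l \<longleftrightarrow> l = G r \<or> wr c l"

lemma fold_frame:
  assumes "\<And>i s. f i s l = (s l :: nat)"
  shows "fold f xs s l = s l"
  by (induction xs arbitrary: s) (auto simp: assms)

lemma run_frame [simp]: "\<not> wr c l \<Longrightarrow> run B c s l = s l"
proof (induction c arbitrary: s)
  case (For r c)
  then show ?case by (auto intro!: fold_frame)
qed auto

fun wfe :: "ex \<Rightarrow> bool" where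
  "wfe (N k) \<longleftrightarrow> k \<le> 1"
| "wfe (V r) \<longleftrightarrow> True"
| "wfe (At a i j) \<longleftrightarrow> a < 16 \<and> wfe i \<and> wfe j"
| "wfe (Tape p) \<longleftrightarrow> wfe p"

fun wfb :: "bx \<Rightarrow> bool" where
  "wfb (Lt a b) \<longleftrightarrow> wfe a \<and> wfe b"
| "wfb (Eq a b) \<longleftrightarrow> wfe a \<and> wfe b"
| "wfb (Neg b) \<longleftrightarrow> wfb b"
| "wfb (Conj a b) \<longleftrightarrow> wfb a \<and> wfb b"

text \<open>The last condition for \<open>For\<close> keeps the body from touching the counter,
  which the compiled \<open>While\<close> increments in place; this is what makes the number of
  rounds exactly \<open>B\<close>.\<close>

fun wfc :: "cmd \<Rightarrow> bool" where
  "wfc Nop \<longleftrightarrow> True"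
| "wfc (Set r e) \<longleftrightarrow> wfe e"
| "wfc (Inc r) \<longleftrightarrow> True"
| "wfc (Put a i j e) \<longleftrightarrow> a < 16 \<and> wfe i \<and> wfe j \<and> wfe e"
| "wfc (Write p e) \<longleftrightarrow> wfe p \<and> wfe e"
| "wfc (Sq c d) \<longleftrightarrow> wfc c \<and> wfc d"
| "wfc (Cond b c d) \<longleftrightarrow> wfb b \<and> wfc c \<and> wfc d"
| "wfc (For r c) \<longleftrightarrow> wfc c \<and> \<not> wr c (G r)"

text \<open>Machine registers 0, 1, 2 hold the output address, the base address \<open>D\<close> of the arrays
  and the loop bound \<open>B\<close>.  Cell \<open>(i, j)\<close> of array \<open>a < 16\<close> is kept at
  \<open>D + 16 * ((i + j)\<^sup>2 + i) + a\<close>, which is injective in \<open>(a, i, j)\<close>; the addresses below \<open>D\<close>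
  form the tape, which holds first the input and later the output.

  Constants are at most 1 and arithmetic only increments, so the values stored grow by at most one
  per time unit; with \<open>D\<close> above the running time, tape addresses stay below \<open>D\<close> and words
  below \<open>word_bound D\<close> without any reasoning about particular programs.\<close>

definition addr :: "nat \<Rightarrow> aexp \<Rightarrow> aexp \<Rightarrow> aexp" where
  "addr a x y = Plus (Reg 1) (Plus (Const a)
     (Times (Const 16) (Plus (Times (Plus x y) (Plus x y)) x)))"

definition cell :: "nat \<Rightarrow> nat \<Rightarrow> nat \<Rightarrow> nat" where
  "cell a i j = a + 16 * ((i + j) * (i + j) + i)"

fun cex :: "ex \<Rightarrow> aexp" where
  "cex (N k) = Const k"
| "cex (V r) = Reg (r + 3)"
| "cex (At a i j) = Load (addr a (cex i) (cex j))"
| "cex (Tape p) = Load (cex p)"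

fun cbx :: "bx \<Rightarrow> bexp" where
  "cbx (Lt a b) = Less (cex a) (cex b)"
| "cbx (Eq a b) = Equal (cex a) (cex b)"
| "cbx (Neg b) = Not (cbx b)"
| "cbx (Conj a b) = And (cbx a) (cbx b)"

fun compile :: "cmd \<Rightarrow> com" where
  "compile Nop = Skip"
| "compile (Set r e) = Assign (r + 3) (cex e)"
| "compile (Inc r) = Assign (r + 3) (Plus (Reg (r + 3)) (Const 1))"
| "compile (Put a i j e) = Store (addr a (cex i) (cex j)) (cex e)"
| "compile (Write p e) = Store (cex p) (cex e)"
| "compile (Sq c d) = Seq (compile c) (compile d)"
| "compile (Cond b c d) = If (cbx b) (compile c) (compile d)"
| "compile (For r c) = Seq (Assign (r + 3) (Const 0))
     (While (Less (Reg (r + 3)) (Reg 2))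
        (Seq (compile c) (Assign (r + 3) (Plus (Reg (r + 3)) (Const 1)))))"

text \<open>In \<open>For\<close>, 6 is the initialisation (2) and the final failing test (4); each
  round adds 4 for the test and 4 for the increment. \<open>Cond\<close> pays for both branches, so
  that the bound does not depend on the store.\<close>

fun tm :: "nat \<Rightarrow> cmd \<Rightarrow> nat" where
  "tm B Nop = 1"
| "tm B (Set r e) = acost (cex e) + 1"
| "tm B (Inc r) = 4"
| "tm B (Put a i j e) = acost (addr a (cex i) (cex j)) + acost (cex e) + 1"
| "tm B (Write p e) = acost (cex p) + acost (cex e) + 1"
| "tm B (Sq c d) = tm B c + tm B d"
| "tm B (Cond b c d) = bcost (cbx b) + 1 + tm B c + tm B d"
| "tm B (For r c) = 6 + B * (8 + tm B c)"

section \<open>Polynomial running time from the loop nesting depth\<close>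

fun depth :: "cmd \<Rightarrow> nat" where
  "depth (Sq c d) = max (depth c) (depth d)"
| "depth (Cond b c d) = max (depth c) (depth d)"
| "depth (For r c) = Suc (depth c)"
| "depth _ = 0"

text \<open>Reduces the cost analysis to syntax: once \<open>depth main_prog = 4\<close> is computed
  by simplification, the quartic bound follows.\<close>

lemma tm_poly: "\<exists>K. \<forall>B. tm B c \<le> K * (B + 1) ^ depth c"
proof (induction c)
  case (Set r e) show ?case by (rule exI[of _ "tm 0 (Set r e)"]) auto
next
  case (Put a i j e) show ?case by (rule exI[of _ "tm 0 (Put a i j e)"]) auto
next
  case (Write p e) show ?case by (rule exI[of _ "tm 0 (Write p e)"]) auto
next
  case (Sq c d)
  then obtain K L where K: "\<And>B. tm B c \<le> K * (B + 1) ^ depth c"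
    and L: "\<And>B. tm B d \<le> L * (B + 1) ^ depth d" by blast
  have "tm B (Sq c d) \<le> (K + L) * (B + 1) ^ depth (Sq c d)" for B
  proof -
    have *: "(B + 1) ^ depth c \<le> (B + 1) ^ max (depth c) (depth d)"
      "(B + 1) ^ depth d \<le> (B + 1) ^ max (depth c) (depth d)"
      by (intro power_increasing; simp)+
    have "tm B c \<le> K * (B + 1) ^ max (depth c) (depth d)"
      "tm B d \<le> L * (B + 1) ^ max (depth c) (depth d)"
      using K[of B] L[of B] mult_le_mono2[OF *(1), of K] mult_le_mono2[OF *(2), of L] by linarith+
    then show ?thesis by (simp add: add_mult_distrib)
  qed
  then show ?case by blast
next
  case (Cond b c d)
  then obtain K L where K: "\<And>B. tm B c \<le> K * (B + 1) ^ depth c"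
    and L: "\<And>B. tm B d \<le> L * (B + 1) ^ depth d" by blast
  have "tm B (Cond b c d) \<le> (bcost (cbx b) + 1 + K + L) * (B + 1) ^ depth (Cond b c d)" for B
  proof -
    have *: "(B + 1) ^ depth c \<le> (B + 1) ^ max (depth c) (depth d)"
      "(B + 1) ^ depth d \<le> (B + 1) ^ max (depth c) (depth d)"
      by (intro power_increasing; simp)+
    have "tm B c \<le> K * (B + 1) ^ max (depth c) (depth d)"
      "tm B d \<le> L * (B + 1) ^ max (depth c) (depth d)"
      using K[of B] L[of B] mult_le_mono2[OF *(1), of K] mult_le_mono2[OF *(2), of L] by linarith+
    moreover have "bcost (cbx b) + 1 \<le> (bcost (cbx b) + 1) * (B + 1) ^ max (depth c) (depth d)"
      using mult_le_mono2[of 1 "(B + 1) ^ max (depth c) (depth d)" "bcost (cbx b) + 1"]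
      by simp
    ultimately show ?thesis by (simp add: add_mult_distrib)
  qed
  then show ?case by blast
next
  case (For r c)
  then obtain K where K: "\<And>B. tm B c \<le> K * (B + 1) ^ depth c" by blast
  have "tm B (For r c) \<le> (14 + K) * (B + 1) ^ depth (For r c)" for B
  proof -
    have "6 + B * (8 + tm B c) \<le> (B + 1) * (14 + tm B c)" by (simp add: algebra_simps)
    also have "\<dots> \<le> (B + 1) * ((14 + K) * (B + 1) ^ depth c)"
    proof (rule mult_le_mono2)
      have "14 \<le> 14 * (B + 1) ^ depth c" by simp
      then show "14 + tm B c \<le> (14 + K) * (B + 1) ^ depth c"
        using K[of B] by (simp only: add_mult_distrib)
    qed
    finally show ?thesis by (simp add: algebra_simps)
  qed
  then show ?case by blast
next
  case Nop show ?case by (rule exI[of _ 1]) auto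
next
  case (Inc r) show ?case by (rule exI[of _ 4]) auto
qed

text \<open>Since \<open>i\<close> is at most \<open>i + j\<close>, the value lies between
  \<open>(i + j)\<^sup>2\<close> and the next square, so its integer square root recovers the sum
  and the remainder recovers \<open>i\<close>. This pairing suits the machine: it uses no division
  and no row length.\<close>

lemma square_plus_inj:
  fixes i j k l :: nat
  assumes "(i + j) * (i + j) + i = (k + l) * (k + l) + k"
  shows "i = k \<and> j = l"
proof -
  have lt: False if "a < b" "i \<le> a" "a * a + i = b * b + k" for a b i k :: nat
  proof -
    have "Suc a * Suc a \<le> b * b" using that by (intro mult_le_mono) auto
    then show False using that by simp
  qed
  have "i + j = k + l"
    using lt[of "i + j" "k + l" i k] lt[of "k + l" "i + j" k i] assms
    by (metis le_add1 linorder_neqE_nat)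
  then show ?thesis using assms by simp
qed

lemma cell_inj:
  assumes "cell a i j = cell b k l" "a < 16" "b < 16"
  shows "a = b \<and> i = k \<and> j = l"
proof -
  have "a = b" using assms unfolding cell_def by presburger
  then show ?thesis using assms square_plus_inj[of i j k l] unfolding cell_def by simp
qed

lemma cell_eq_iff [simp]:
  "a < 16 \<Longrightarrow> b < 16 \<Longrightarrow> cell a i j = cell b k l \<longleftrightarrow> a = b \<and> i = k \<and> j = l"
  using cell_inj by blast

section \<open>Simulation of the loop language by the machine\<close>

definition represents :: "nat \<Rightarrow> nat \<Rightarrow> store \<Rightarrow> state \<Rightarrow> bool" where
  "represents D B \<sigma> s \<longleftrightarrow> fst s 0 = 0 \<and> fst s 1 = D \<and> fst s 2 = B \<and>
     (\<forall>r. fst s (r + 3) = \<sigma> (G r)) \<and> (\<forall>p<D. snd s p = \<sigma> (Tp p)) \<and>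
     (\<forall>a<16. \<forall>i j. snd s (D + cell a i j) = \<sigma> (M a i j))"

definition word_bound :: "nat \<Rightarrow> nat" where
  "word_bound D = D + 16 + 16 * ((D + D) * (D + D) + D)"

lemma cell_less:
  assumes "a < 16" "i < D" "j < D"
  shows "D + cell a i j < word_bound D"
proof -
  have "(i + j) * (i + j) \<le> (D + D) * (D + D)" using assms by (intro mult_le_mono) auto
  then show ?thesis using assms by (simp add: word_bound_def cell_def)
qed

lemma cex_correct:
  assumes "represents D B \<sigma> s" "\<And>l. \<sigma> l < D" "1 < D" "word_bound D < W"
  shows "wfe e \<Longrightarrow> aval (cex e) s = ev e \<sigma> \<and> ev e \<sigma> < D \<and> afits W (cex e) s"
proof (induction e)
  case (N k)
  then show ?case using assms by (simp add: word_bound_def)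
next
  case (V r)
  have "\<sigma> (G r) < D" by (rule assms)
  then show ?case using assms(1,4) by (simp add: represents_def word_bound_def)
next
  case (At a i j)
  have D: "ev i \<sigma> < D" "ev j \<sigma> < D" "\<sigma> (M a (ev i \<sigma>) (ev j \<sigma>)) < D"
    using At assms by auto
  have c: "D + cell a (ev i \<sigma>) (ev j \<sigma>) < W"
    using cell_less[of a "ev i \<sigma>" D "ev j \<sigma>"] At D assms by simp
  have "snd s (D + cell a (ev i \<sigma>) (ev j \<sigma>)) = \<sigma> (M a (ev i \<sigma>) (ev j \<sigma>))"
    using assms(1) At by (simp add: represents_def)
  then show ?case using At c D assms(1,4)
    by (auto simp: addr_def cell_def represents_def word_bound_def ac_simps)
next
  case (Tape p)
  have "\<sigma> (Tp (ev p \<sigma>)) < D" by (rule assms)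
  then show ?case using Tape assms(1,4) by (auto simp: represents_def word_bound_def)
qed

lemma addr_correct:
  assumes "represents D B \<sigma> s" "\<And>l. \<sigma> l < D" "1 < D" "word_bound D < W"
    and "wfe i" "wfe j" "a < 16"
  shows "aval (addr a (cex i) (cex j)) s = D + cell a (ev i \<sigma>) (ev j \<sigma>) \<and>
    afits W (addr a (cex i) (cex j)) s"
proof -
  note i = cex_correct[OF assms(1-4), of i] and j = cex_correct[OF assms(1-4), of j]
  have "D + cell a (ev i \<sigma>) (ev j \<sigma>) < W"
    using cell_less[of a "ev i \<sigma>" D "ev j \<sigma>"] i j assms by simp
  then show ?thesis using i j assms
    by (auto simp: addr_def cell_def represents_def word_bound_def ac_simps)
qed

lemma cbx_correct:
  assumes "represents D B \<sigma> s" "\<And>l. \<sigma> l < D" "1 < D" "word_bound D < W"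
  shows "wfb b \<Longrightarrow> bval (cbx b) s = bv b \<sigma> \<and> bfits W (cbx b) s"
  by (induction b) (auto simp: cex_correct[OF assms])

text \<open>\<open>v\<close> bounds all values at the start and is generalised because the second
  half of a \<open>Sq\<close> starts from \<open>v + tm B c\<close>. The premises
  \<open>1 \<le> v\<close> and \<open>B \<le> v\<close> make it dominate the constants of the
  program and the loop counters as well.\<close>

lemma compile_correct:
  assumes "wfc c" "represents D B \<sigma> s" "\<And>l. \<sigma> l \<le> v" "1 \<le> v" "B \<le> v" "v + tm B c < D"
    and W: "word_bound D < W"
  shows "\<exists>t s'. exec W (compile c) s t s' \<and> t \<le> tm B c \<and> represents D B (run B c \<sigma>) s' \<and>
    (\<forall>l. run B c \<sigma> l \<le> v + tm B c)"
  using assms(1-6)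
proof (induction c arbitrary: \<sigma> s v)
  case Nop
  then show ?case
    by (intro exI[of _ 1] exI[of _ s] conjI) (auto intro: exec.Skip[unfolded One_nat_def] le_SucI)
next
  case (Set r e)
  have D: "\<sigma> l < D" for l using Set(3)[of l] Set(6) by simp
  note e = cex_correct[OF Set(2) D _ W, of e]
  have "ev e \<sigma> \<le> v"
    using Set(1,3,4) by (cases e) auto
  then show ?case
    by - (rule exI, rule exI, rule conjI, simp, rule exec.Assign,
      use Set e in \<open>auto simp: represents_def trans_le_add1 le_SucI\<close>)
next
  case (Inc r)
  have v: "\<sigma> (G r) \<le> v" by (rule Inc(3))
  have "D < W" using W by (simp add: word_bound_def)
  with v Inc(6) have "\<sigma> (G r) < W" "Suc (\<sigma> (G r)) < W" "\<sigma> (G r) \<le> 3 + v" by simp_all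
  moreover have "1 < W" using Inc(4) v Inc(6) \<open>D < W\<close> by simp
  ultimately show ?case
    by - (rule exI, rule exI, rule conjI, simp, rule exec.Assign,
      use Inc in \<open>auto simp: represents_def le_SucI trans_le_add1\<close>)
next
  case (Put a i j e)
  have D: "\<sigma> l < D" for l using Put(3)[of l] Put(6) by simp
  have D1: "1 < D" using Put by simp
  note e = cex_correct[OF Put(2) D D1 W, of e] addr_correct[OF Put(2) D D1 W, of i j a]
  have v: "ev e \<sigma> \<le> v"
    using Put(1,3,4) by (cases e) auto
  have r: "represents D B (run B (Put a i j e) \<sigma>)
     (fst s, (snd s)(aval (addr a (cex i) (cex j)) s := aval (cex e) s))"
    using Put e by (auto simp: represents_def)
  show ?case
    by (rule exI, rule exI, rule conjI, simp, rule exec.Store,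
      use e Put v r in \<open>auto simp: trans_le_add1 le_SucI fun_upd_def\<close>)
next
  case (Write p e)
  have D: "\<sigma> l < D" for l using Write(3)[of l] Write(6) by simp
  have D1: "1 < D" using Write by simp
  note e = cex_correct[OF Write(2) D D1 W, of e] cex_correct[OF Write(2) D D1 W, of p]
  have v: "ev e \<sigma> \<le> v"
    using Write(1,3,4) by (cases e) auto
  have r: "represents D B (run B (Write p e) \<sigma>)
     (fst s, (snd s)(aval (cex p) s := aval (cex e) s))"
    using Write e by (auto simp: represents_def)
  show ?case
    by (rule exI, rule exI, rule conjI, simp, rule exec.Store,
      use e Write v r in \<open>auto simp: trans_le_add1 le_SucI fun_upd_def\<close>)
next
  case (Sq c d)
  obtain t s' where c: "exec W (compile c) s t s'" "t \<le> tm B c" "represents D B (run B c \<sigma>) s'"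
    "\<And>l. run B c \<sigma> l \<le> v + tm B c"
    using Sq.IH(1)[of \<sigma> s v] Sq.prems by auto
  obtain t' s'' where d: "exec W (compile d) s' t' s''" "t' \<le> tm B d"
    "represents D B (run B d (run B c \<sigma>)) s''"
    "\<And>l. run B d (run B c \<sigma>) l \<le> v + tm B c + tm B d"
    using Sq.IH(2)[OF _ c(3) c(4)] Sq.prems by auto
  show ?case using exec.Seq[OF c(1) d(1)] c d
    by (intro exI[of _ "t + t'"] exI[of _ s'']) (simp add: add.assoc)
next
  case (Cond b c d)
  have D: "\<sigma> l < D" for l using Cond(5)[of l] Cond(8) by simp
  have b: "bval (cbx b) s = bv b \<sigma>" "bfits W (cbx b) s"
    using cbx_correct[OF Cond(4) D _ W, of b] Cond by auto
  show ?case
  proof (cases "bv b \<sigma>")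
    case True
    obtain t s' where c: "exec W (compile c) s t s'" "t \<le> tm B c" "represents D B (run B c \<sigma>) s'"
      "\<And>l. run B c \<sigma> l \<le> v + tm B c"
      using Cond.IH(1)[of \<sigma> s v] Cond.prems by auto
    have "run B c \<sigma> l \<le> v + tm B (Cond b c d)" for l using c(4)[of l] by simp
    with c b True exec.IfTrue[of W "cbx b" s "compile c" t s' "compile d"] show ?thesis
      by (intro exI[of _ "bcost (cbx b) + 1 + t"] exI[of _ s']) simp
  next
    case False
    obtain t s' where c: "exec W (compile d) s t s'" "t \<le> tm B d" "represents D B (run B d \<sigma>) s'"
      "\<And>l. run B d \<sigma> l \<le> v + tm B d"
      using Cond.IH(2)[of \<sigma> s v] Cond.prems by auto
    have "run B d \<sigma> l \<le> v + tm B (Cond b c d)" for l using c(4)[of l] by simp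
    with c b False exec.IfFalse[of W "cbx b" s "compile d" t s' "compile c"] show ?thesis
      by (intro exI[of _ "bcost (cbx b) + 1 + t"] exI[of _ s']) simp
  qed
next
  case (For r c)
  let ?w = "While (Less (Reg (r + 3)) (Reg 2))
        (Seq (compile c) (Assign (r + 3) (Plus (Reg (r + 3)) (Const 1))))"
  let ?f = "\<lambda>i s. run B c (s(G r := i))"
  have DB: "D < W" using W by (simp add: word_bound_def)
  \<comment> \<open>Induction on the number \<open>m\<close> of rounds left. The represented store
    is \<open>\<sigma>(G r := i)\<close> because \<open>run\<close> sets the counter anew in each
    round, whereas the machine arrives at \<open>i\<close> by incrementing.\<close>
  have loop: "\<exists>t s'. exec W ?w s t s' \<and> t \<le> 4 + m * (8 + tm B c) \<and>
      represents D B ((fold ?f [i..<B] \<sigma>)(G r := B)) s' \<and>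
      (\<forall>l. ((fold ?f [i..<B] \<sigma>)(G r := B)) l \<le> v + m * (8 + tm B c))"
    if "m + i = B" "represents D B (\<sigma>(G r := i)) s" "\<And>l. (\<sigma>(G r := i)) l \<le> v"
      "1 \<le> v" "B \<le> v" "v + m * (8 + tm B c) < D" for i m \<sigma> s v
    using that
  proof (induction m arbitrary: i \<sigma> s v)
    case 0
    have s: "fst s (r + 3) = B" "fst s 2 = B" using 0 by (auto simp: represents_def)
    have "exec W ?w s (bcost (Less (Reg (r + 3)) (Reg 2)) + 1) s"
      using s 0 DB by (intro exec.WhileFalse) auto
    then show ?case using 0
      by (intro exI[of _ "bcost (Less (Reg (r + 3)) (Reg 2)) + 1"] exI[of _ s])
         (simp del: fun_upd_apply)
  next
    case (Suc m)
    have s: "fst s (r + 3) = i" "fst s 2 = B" using Suc by (auto simp: represents_def)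
    have vD: "v + tm B c < D" using Suc.prems(6) by simp
    have wfc: "wfc c" using For.prems(1) by simp
    obtain t s' where c: "exec W (compile c) s t s'" "t \<le> tm B c"
      "represents D B (?f i \<sigma>) s'" "\<And>l. ?f i \<sigma> l \<le> v + tm B c"
      using For.IH[OF wfc Suc.prems(2,3,4,5) vD] by blast
    have i: "(?f i \<sigma>) (G r) = i" using For.prems(1) by simp
    define s2 where "s2 = ((fst s')(r + 3 := Suc i), snd s')"
    have s': "fst s' (r + 3) = i" using c(3) i by (simp add: represents_def)
    have a: "exec W (Assign (r + 3) (Plus (Reg (r + 3)) (Const 1))) s' 4 s2"
      using exec.Assign[of W "Plus (Reg (r + 3)) (Const 1)" s' "r + 3"] s' Suc.prems DB
      by (simp add: s2_def eval_nat_numeral)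
    have r2: "represents D B ((?f i \<sigma>)(G r := Suc i)) s2"
      using c(3) by (auto simp: represents_def s2_def)
    have v2: "((?f i \<sigma>)(G r := Suc i)) l \<le> v + (8 + tm B c)" for l
      using c(4)[of l] Suc.prems(1,5) by auto
    have m: "m + Suc i = B" using Suc.prems(1) by simp
    have le: "1 \<le> v + (8 + tm B c)" "B \<le> v + (8 + tm B c)"
      "v + (8 + tm B c) + m * (8 + tm B c) < D" using Suc.prems(4-6) by auto
    obtain t' s'' where w: "exec W ?w s2 t' s''" "t' \<le> 4 + m * (8 + tm B c)"
      "represents D B ((fold ?f [Suc i..<B] (?f i \<sigma>))(G r := B)) s''"
      "\<And>l. ((fold ?f [Suc i..<B] (?f i \<sigma>))(G r := B)) l \<le> v + (8 + tm B c) + m * (8 + tm B c)"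
      using Suc.IH[OF m r2 v2 le(1,2,3)] by blast
    have "exec W ?w s (bcost (Less (Reg (r + 3)) (Reg 2)) + 1 + (t + 4) + t') s''"
      using s Suc.prems DB by (intro exec.WhileTrue[OF _ _ exec.Seq[OF c(1) a] w(1)]) auto
    moreover have "[i..<B] = i # [Suc i..<B]"
      using Suc.prems(1) by (simp add: upt_conv_Cons)
    ultimately show ?case using w(2-4) c(2)
      by (intro exI[of _ "bcost (Less (Reg (r + 3)) (Reg 2)) + 1 + (t + 4) + t'"] exI[of _ s''])
         (simp add: ac_simps del: fun_upd_apply)
  qed
  define s1 where "s1 = ((fst s)(r + 3 := 0), snd s)"
  have a: "exec W (Assign (r + 3) (Const 0)) s 2 s1"
    using exec.Assign[of W "Const 0" s "r + 3"] DB by (simp add: s1_def numeral_2_eq_2)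
  have r1: "represents D B (\<sigma>(G r := 0)) s1"
    using For.prems(2) by (auto simp: represents_def s1_def)
  have v1: "(\<sigma>(G r := 0)) l \<le> v" for l using For.prems(3) by auto
  obtain t s' where w: "exec W ?w s1 t s'" "t \<le> 4 + B * (8 + tm B c)"
      "represents D B ((fold ?f [0..<B] \<sigma>)(G r := B)) s'"
      "\<And>l. ((fold ?f [0..<B] \<sigma>)(G r := B)) l \<le> v + B * (8 + tm B c)"
    using loop[OF _ r1 v1, of B] For.prems by auto
  have "((fold ?f [0..<B] \<sigma>)(G r := B)) l \<le> v + tm B (For r c)" for l
    using w(4)[of l] by (simp del: fun_upd_apply)
  with w exec.Seq[OF a w(1)] show ?case
    by (intro exI[of _ "2 + t"] exI[of _ s']) (simp del: fun_upd_apply)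
qed

section \<open>Invariant rule for guarded loops\<close>

definition loop :: "nat \<Rightarrow> nat \<Rightarrow> cmd \<Rightarrow> cmd" where
  "loop r b c = For r (Cond (Lt (V r) (V b)) c Nop)"

lemma loop_simps [simp]:
  "wr (loop r b c) l \<longleftrightarrow> l = G r \<or> wr c l"
  "wfc (loop r b c) \<longleftrightarrow> wfc c \<and> \<not> wr c (G r)"
  "depth (loop r b c) = Suc (depth c)"
  by (auto simp: loop_def)

text \<open>After round \<open>k\<close> the guard fails but the counter still moves up to
  \<open>B\<close>. Hence \<open>I\<close> must ignore the counter (\<open>indep\<close>), and the
  proof carries the invariant at \<open>min m k\<close>. The frame premise of \<open>step\<close>
  gives each location not written by the body its value at loop entry, so \<open>I\<close> need only
  speak of what changes. Under \<open>goal_cases\<close> below, case 8 is \<open>step\<close>: its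
  facts are the range of the counter, its value, the frame and the invariant.\<close>

lemma loop_rule:
  assumes b: "s0 (G b) = k" "k \<le> B" "r \<noteq> b" "\<not> wr c (G b)" "\<not> wr c (G r)"
    and init: "I 0 s0"
    and indep: "\<And>i s v. I i s \<Longrightarrow> I i (s(G r := v))"
    and step: "\<And>i s. i < k \<Longrightarrow> s (G r) = i \<Longrightarrow>
      (\<And>l. \<not> wr c l \<Longrightarrow> l \<noteq> G r \<Longrightarrow> s l = s0 l) \<Longrightarrow> I i s \<Longrightarrow> I (Suc i) (run B c s)"
  shows "I k (run B (loop r b c) s0)"
proof -
  define f where "f i s = run B (Cond (Lt (V r) (V b)) c Nop) (s(G r := i))" for i s
  have fr: "fold f [0..<m] s0 l = s0 l" if "\<not> wr c l" "l \<noteq> G r" for m l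
    using that by (intro fold_frame) (auto simp: f_def)
  have inv: "I (min m k) (fold f [0..<m] s0)" for m
  proof (induction m)
    case 0
    then show ?case using init by simp
  next
    case (Suc m)
    let ?s = "fold f [0..<m] s0"
    have k: "?s (G b) = k" using fr b by simp
    have f: "f m ?s = (if m < k then run B c (?s(G r := m)) else ?s(G r := m))"
      using k b by (simp add: f_def[of m ?s])
    show ?case
    proof (cases "m < k")
      case True
      then have I: "I m ?s" using Suc by simp
      have "I (Suc m) (run B c (?s(G r := m)))"
        by (rule step[OF True]) (use fr indep[OF I] in auto)
      then show ?thesis using True f by (simp add: min_def del: fun_upd_apply)
    next
      case False
      then show ?thesis using Suc f indep[of k ?s m] by (simp add: min_def del: fun_upd_apply split: if_splits)
    qed
  qed
  have "run B (loop r b c) s0 = (fold f [0..<B] s0)(G r := B)"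
    by (simp add: loop_def f_def[abs_def])
  then show ?thesis using inv[of B] b(2) indep by (simp add: min_def del: fun_upd_apply split: if_splits)
qed

section \<open>Strong umodules as closed sets\<close>

text \<open>\<open>lab q\<close> names the classes of the equivalence at \<open>q\<close>, and only
  its kernel is compared. In a umodule test \<open>q\<close> and \<open>w\<close> lie in
  \<open>A\<close> while \<open>z\<close> and \<open>z'\<close> do not, so every label consulted
  belongs to a reflectless triple.\<close>

definition agree :: "nat \<Rightarrow> (nat \<Rightarrow> nat \<Rightarrow> nat) \<Rightarrow> nat set \<Rightarrow> nat \<Rightarrow> nat \<Rightarrow> bool" where
  "agree n lab A q w \<longleftrightarrow> (\<forall>z<n. \<forall>z'<n. z \<notin> A \<longrightarrow> z' \<notin> A \<longrightarrow>
     (lab q z = lab q z') = (lab w z = lab w z'))"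

definition um :: "nat \<Rightarrow> (nat \<Rightarrow> nat \<Rightarrow> nat) \<Rightarrow> nat set \<Rightarrow> bool" where
  "um n lab U \<longleftrightarrow> U \<subseteq> {..<n} \<and> (\<forall>u\<in>U. \<forall>u'\<in>U. agree n lab U u u')"

definition strong :: "nat \<Rightarrow> (nat \<Rightarrow> nat \<Rightarrow> nat) \<Rightarrow> nat set \<Rightarrow> bool" where
  "strong n lab U \<longleftrightarrow> um n lab U \<and> (\<forall>V. um n lab V \<longrightarrow> \<not> overlap U V)"

lemma agree_refl [simp]: "agree n lab A q q"
  by (simp add: agree_def)

lemma agree_sym: "agree n lab A q w \<Longrightarrow> agree n lab A w q"
  by (simp add: agree_def)

lemma agree_trans: "agree n lab A p q \<Longrightarrow> agree n lab A q w \<Longrightarrow> agree n lab A p w"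
  by (simp add: agree_def)

lemma agree_mono: "agree n lab A q w \<Longrightarrow> A \<subseteq> A' \<Longrightarrow> agree n lab A' q w"
  unfolding agree_def by blast

text \<open>Agreement is an equivalence, so comparing every member with one pivot covers all pairs.
  Together with the linear agreement test this makes a umodule test quadratic.\<close>

lemma um_pivot:
  assumes "U \<subseteq> {..<n}" "\<And>u. u \<in> U \<Longrightarrow> agree n lab U q u"
  shows "um n lab U"
  unfolding um_def using assms(1) agree_trans[OF agree_sym[OF assms(2)] assms(2)] by blast

text \<open>A class is named by one of its own members, so the name also serves as the pivot of its
  agreement test. The last clause is the invariant that yields maximality in the end.\<close>

definition refined :: "nat \<Rightarrow> (nat \<Rightarrow> nat \<Rightarrow> nat) \<Rightarrow> nat \<Rightarrow> (nat \<Rightarrow> nat) \<Rightarrow> bool" where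
  "refined n lab x cl \<longleftrightarrow> (\<forall>v<n. cl v < n \<and> cl (cl v) = cl v \<and> (cl v = x \<longleftrightarrow> v = x)) \<and>
     (\<forall>U. um n lab U \<longrightarrow> x \<notin> U \<longrightarrow> (\<forall>u\<in>U. \<forall>u'\<in>U. cl u = cl u'))"

definition dis :: "nat \<Rightarrow> (nat \<Rightarrow> nat \<Rightarrow> nat) \<Rightarrow> (nat \<Rightarrow> nat) \<Rightarrow> nat \<Rightarrow> bool" where
  "dis n lab cl u \<longleftrightarrow> \<not> agree n lab {v. cl v = cl u} (cl u) u"

text \<open>All dissenters of one class leave together and are named after one of them, although
  they may still disagree among themselves; later steps separate those. The choice of
  \<open>w\<close> is left open, as the program simply takes the last dissenter it meets.\<close>

definition refine_step ::
  "nat \<Rightarrow> (nat \<Rightarrow> nat \<Rightarrow> nat) \<Rightarrow> (nat \<Rightarrow> nat) \<Rightarrow> (nat \<Rightarrow> nat) \<Rightarrow> bool" where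
  "refine_step n lab cl cl' \<longleftrightarrow>
     (if \<exists>u<n. dis n lab cl u
      then \<exists>w<n. dis n lab cl w \<and>
        (\<forall>v<n. cl' v = (if dis n lab cl v \<and> cl v = cl w then w else cl v))
      else \<forall>v<n. cl' v = cl v)"

lemma refined_cong:
  assumes "\<And>v. v < n \<Longrightarrow> cl' v = cl v" "refined n lab x cl"
  shows "refined n lab x cl'"
proof -
  have "cl u = cl u'" if "um n lab U" "x \<notin> U" "u \<in> U" "u' \<in> U" for U u u'
    using assms(2) that unfolding refined_def by blast
  moreover have "u < n" if "um n lab U" "u \<in> U" for U u
    using that by (auto simp: um_def)
  ultimately show ?thesis using assms unfolding refined_def by (metis (no_types, lifting))
qed

lemma dis_cong:
  assumes "\<And>v. v < n \<Longrightarrow> cl' v = cl v" "u < n"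
  shows "dis n lab cl' u = dis n lab cl u"
  using assms by (simp add: dis_def agree_def)

text \<open>A split separates only elements that disagree on the complement of their class, hence on
  the complement of every umodule within the class; so umodules avoiding \<open>x\<close> stay together.\<close>

lemma refine_step_refined:
  assumes r: "refined n lab x cl" and st: "refine_step n lab cl cl'" and d: "\<exists>u<n. dis n lab cl u"
  shows "refined n lab x cl' \<and> card (cl ` {..<n}) < card (cl' ` {..<n})"
proof -
  from st d obtain w where w: "w < n" "dis n lab cl w"
    and cl': "\<And>v. v < n \<Longrightarrow> cl' v = (if dis n lab cl v \<and> cl v = cl w then w else cl v)"
    unfolding refine_step_def by auto
  have cl: "cl v < n" "cl (cl v) = cl v" "cl v = x \<longleftrightarrow> v = x" if "v < n" for v
    using r that unfolding refined_def by auto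
  have nd: "\<not> dis n lab cl (cl v)" if "v < n" for v
    using cl that by (simp add: dis_def)
  have wne: "cl w \<noteq> w" using w nd by metis
  have wx: "w \<noteq> x" using wne cl w by metis
  have "cl' v < n \<and> cl' (cl' v) = cl' v \<and> (cl' v = x \<longleftrightarrow> v = x)" if "v < n" for v
  proof (cases "dis n lab cl v \<and> cl v = cl w")
    case True
    then have "v \<noteq> x" using cl[OF \<open>v < n\<close>] cl[OF w(1)] wx by metis
    then show ?thesis using True w wx cl' that by simp
  next
    case False
    then show ?thesis using cl[OF that] nd[OF that] cl'[OF that] cl'[of "cl v"] by auto
  qed
  moreover have "cl' u = cl' u'" if U: "um n lab U" "x \<notin> U" "u \<in> U" "u' \<in> U" for U u u'
  proof -
    have same: "cl v = cl u" if "v \<in> U" for v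
      using r U that unfolding refined_def by blast
    have n: "u < n" "u' < n" using U by (auto simp: um_def)
    have "agree n lab U u u'" using U by (auto simp: um_def)
    then have "agree n lab {v. cl v = cl u} u u'"
      by (rule agree_mono) (use same in blast)
    then have "dis n lab cl u = dis n lab cl u'"
      unfolding dis_def using same[OF U(4)] by (metis agree_sym agree_trans)
    then show ?thesis using cl' n same[OF U(4)] by simp
  qed
  \<comment> \<open>A name agrees with itself and so never leaves its class: all old names survive,
    and \<open>w\<close>, a dissenter, is a new one. The number of names is the progress measure of
    the loop.\<close>
  moreover have "card (cl ` {..<n}) < card (cl' ` {..<n})"
  proof (rule psubset_card_mono)
    have "cl v \<in> cl' ` {..<n}" if "v < n" for v
      using that nd[OF that] cl[OF that] cl'[of "cl v"] by (intro image_eqI[of _ _ "cl v"]) auto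
    moreover have "w \<in> cl' ` {..<n}" using w cl' by (intro image_eqI[of _ _ w]) auto
    moreover have "w \<notin> cl ` {..<n}" using wne cl by force
    ultimately show "cl ` {..<n} \<subset> cl' ` {..<n}" by blast
  qed simp
  ultimately show ?thesis unfolding refined_def by blast
qed

text \<open>\<open>c x\<close> labels the partition into \<open>{x}\<close> and the maximal umodules avoiding \<open>x\<close>.\<close>

definition separates :: "nat \<Rightarrow> (nat \<Rightarrow> nat \<Rightarrow> nat) \<Rightarrow> (nat \<Rightarrow> nat \<Rightarrow> nat) \<Rightarrow> bool" where
  "separates n lab c \<longleftrightarrow> (\<forall>x<n. (\<forall>v<n. c x v = c x x \<longleftrightarrow> v = x) \<and>
     (\<forall>v<n. um n lab {w. w < n \<and> c x w = c x v}) \<and>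
     (\<forall>U. um n lab U \<longrightarrow> x \<notin> U \<longrightarrow> (\<forall>u\<in>U. \<forall>u'\<in>U. c x u = c x u')))"

text \<open>Without dissenters each class is a umodule by the pivot criterion, and no umodule
  avoiding \<open>x\<close> was ever cut.\<close>

lemma refined_separates:
  assumes "\<And>x. x < n \<Longrightarrow> refined n lab x (c x)" "\<And>x v. x < n \<Longrightarrow> v < n \<Longrightarrow> \<not> dis n lab (c x) v"
  shows "separates n lab c"
  unfolding separates_def
proof (intro allI impI conjI)
  fix x v assume x: "x < n" and v: "v < n"
  show "c x v = c x x \<longleftrightarrow> v = x"
    using assms(1)[OF x] x v unfolding refined_def by metis
  have "agree n lab {w. w < n \<and> c x w = c x v} (c x v) u" if "u < n" "c x u = c x v" for u
    using assms(2)[OF x that(1)] that(2) unfolding dis_def agree_def by auto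
  then show "um n lab {w. w < n \<and> c x w = c x v}"
    by (intro um_pivot) auto
next
  fix x U assume "x < n" "um n lab U" "x \<notin> U"
  then show "\<forall>u\<in>U. \<forall>u'\<in>U. c x u = c x u'"
    using assms(1)[of x] unfolding refined_def by blast
qed

section \<open>Closed sets: relation to strong umodules, and laminarity\<close>

definition edge :: "nat \<Rightarrow> (nat \<Rightarrow> nat \<Rightarrow> nat) \<Rightarrow> nat \<Rightarrow> nat \<Rightarrow> nat \<Rightarrow> bool" where
  "edge n c y a m \<longleftrightarrow>
     (\<exists>x<n. c x a \<noteq> c x y \<and> (x = m \<or> c x m = c x y \<or> c x m = c x a))"

definition sep_closed :: "nat \<Rightarrow> (nat \<Rightarrow> nat \<Rightarrow> nat) \<Rightarrow> nat set \<Rightarrow> bool" where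
  "sep_closed n c A \<longleftrightarrow> A \<subseteq> {..<n} \<and> (\<forall>y\<in>A. \<forall>a\<in>A. \<forall>m<n. edge n c y a m \<longrightarrow> m \<in> A)"

lemma sep_closed_subset: "sep_closed n c A \<Longrightarrow> A \<subseteq> {..<n}"
  by (simp add: sep_closed_def)

text \<open>Let \<open>x\<close> separate \<open>a\<close> and \<open>y\<close> in a strong
  \<open>U\<close>. If \<open>x\<close> were outside, \<open>U\<close> would lie in a single class
  for \<open>x\<close>; so \<open>x\<close> is in \<open>U\<close>. The class of \<open>a\<close> is
  a umodule that meets \<open>U\<close> and misses \<open>y\<close>, hence lies in \<open>U\<close>,
  and likewise for \<open>y\<close>. Conversely, let a umodule \<open>V\<close> overlap a closed
  \<open>U\<close>, with \<open>w\<close> in both, \<open>x\<close> in \<open>U\<close> only and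
  \<open>b\<close> in \<open>V\<close> only. As \<open>V\<close> avoids \<open>x\<close>,
  \<open>w\<close> and \<open>b\<close> share a class for \<open>x\<close>; but \<open>x\<close>
  separates \<open>w\<close> from \<open>x\<close> itself, so closedness forces \<open>b\<close>
  into \<open>U\<close>.\<close>

lemma strong_iff_sep_closed:
  assumes c: "separates n lab c"
  shows "strong n lab U \<longleftrightarrow> sep_closed n c U \<and> um n lab U"
proof
  assume U: "strong n lab U"
  then have um: "um n lab U" and Un: "U \<subseteq> {..<n}" by (auto simp: strong_def um_def)
  have "m \<in> U" if yam: "y \<in> U" "a \<in> U" "m < n" "edge n c y a m" for y a m
  proof -
    from yam(4) obtain x where x: "x < n" "c x a \<noteq> c x y"
      and m: "x = m \<or> c x m = c x y \<or> c x m = c x a" unfolding edge_def by blast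
    have "x \<in> U" using c um x yam unfolding separates_def by blast
    have cls: "w \<in> U" if v: "v \<in> U" "v' \<in> U" "c x v \<noteq> c x v'" "w < n" "c x w = c x v" for v v' w
    proof -
      let ?M = "{w. w < n \<and> c x w = c x v}"
      have "um n lab ?M" using c x v Un unfolding separates_def by blast
      then have "\<not> overlap U ?M" using U by (simp add: strong_def)
      moreover have "v \<in> U \<inter> ?M" "v' \<in> U - ?M" using v Un by auto
      ultimately show ?thesis using v unfolding overlap_def by blast
    qed
    show ?thesis using m cls[of a y m] cls[of y a m] x yam \<open>x \<in> U\<close> by metis
  qed
  then show "sep_closed n c U \<and> um n lab U" using um Un unfolding sep_closed_def by blast
next
  assume *: "sep_closed n c U \<and> um n lab U"
  have "\<not> overlap U V" if V: "um n lab V" for V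
  proof
    assume "overlap U V"
    then obtain w x b where e: "w \<in> U" "w \<in> V" "x \<in> U" "x \<notin> V" "b \<in> V" "b \<notin> U"
      unfolding overlap_def by blast
    have n: "w < n" "x < n" "b < n" using e V * by (auto simp: um_def)
    have "c x w = c x b" using c n V e unfolding separates_def by blast
    moreover have "c x w \<noteq> c x x" using c n e unfolding separates_def by metis
    ultimately have "edge n c x w b" using n unfolding edge_def by metis
    then show False using * e n unfolding sep_closed_def by blast
  qed
  then show "strong n lab U" using * by (simp add: strong_def)
qed

text \<open>Let \<open>w\<close> be common, \<open>a\<close> in \<open>A\<close> only and
  \<open>b\<close> in \<open>B\<close> only. If \<open>b\<close> separates \<open>a\<close> from
  \<open>w\<close>, then \<open>A\<close> must contain \<open>b\<close>. Otherwise \<open>a\<close>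
  lies in the class of \<open>w\<close> for \<open>b\<close>; since \<open>b\<close> separates
  \<open>w\<close> from itself, \<open>B\<close> contains that class and hence
  \<open>a\<close>.\<close>

lemma sep_closed_laminar:
  assumes c: "separates n lab c" and A: "sep_closed n c A" and B: "sep_closed n c B"
  shows "\<not> overlap A B"
proof
  assume "overlap A B"
  then obtain w a b where e: "w \<in> A" "w \<in> B" "a \<in> A" "a \<notin> B" "b \<in> B" "b \<notin> A"
    unfolding overlap_def by blast
  have n: "w < n" "a < n" "b < n" using e A B sep_closed_subset by blast+
  show False
  proof (cases "c b a = c b w")
    case True
    moreover have "c b w \<noteq> c b b" using c n e unfolding separates_def by metis
    ultimately have "edge n c b w a" using n unfolding edge_def by metis
    then show False using B e n unfolding sep_closed_def by blast
  next
    case False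
    then have "edge n c w a b" using n unfolding edge_def by metis
    then show False using A e n unfolding sep_closed_def by blast
  qed
qed

section \<open>Closures of pairs as reachability\<close>

definition graph :: "nat \<Rightarrow> (nat \<Rightarrow> nat \<Rightarrow> nat) \<Rightarrow> nat \<Rightarrow> (nat \<times> nat) set" where
  "graph n c y = {(a, m). a < n \<and> m < n \<and> edge n c y a m}"

definition clo :: "nat \<Rightarrow> (nat \<Rightarrow> nat \<Rightarrow> nat) \<Rightarrow> nat \<Rightarrow> nat \<Rightarrow> nat set" where
  "clo n c y z = insert y {m. (z, m) \<in> (graph n c y)\<^sup>*}"

lemma graph_reach_less: "(z, m) \<in> (graph n c y)\<^sup>* \<Longrightarrow> z < n \<Longrightarrow> m < n"
  by (induction rule: rtrancl_induct) (auto simp: graph_def)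

text \<open>No edge leaves \<open>y\<close>, since nothing separates \<open>y\<close> from
  itself.\<close>

lemma graph_from_root: "(y, m) \<in> (graph n c y)\<^sup>* \<Longrightarrow> m = y"
  by (erule converse_rtranclE) (auto simp: graph_def edge_def)

lemma clo_root: "clo n c y y = {y}"
  by (auto simp: clo_def dest: graph_from_root)

lemma clo_memb [simp]: "y \<in> clo n c y z" "z \<in> clo n c y z"
  by (auto simp: clo_def)

text \<open>Closedness has two premises \<open>a'\<close> and \<open>a\<close>, while an edge of the
  digraph always pairs its source with \<open>y\<close>. This suffices: if \<open>x\<close>
  separates \<open>a'\<close> from \<open>a\<close>, it separates at least one of them from
  \<open>y\<close>, and whatever the pair \<open>a'\<close>, \<open>a\<close> forces through
  \<open>x\<close> is already forced by \<open>y\<close> with \<open>a'\<close> or by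
  \<open>y\<close> with \<open>a\<close>.\<close>

lemma clo_closed:
  assumes "y < n" "z < n"
  shows "sep_closed n c (clo n c y z)"
proof -
  have n: "a < n" if "a \<in> clo n c y z" for a
    using that assms by (auto simp: clo_def dest: graph_reach_less)
  have ext: "m \<in> clo n c y z" if "a \<in> clo n c y z" "m < n" "edge n c y a m" for a m
  proof (cases "a = y")
    case True
    then show ?thesis using that by (auto simp: edge_def)
  next
    case False
    then have "(z, a) \<in> (graph n c y)\<^sup>*" using that by (auto simp: clo_def)
    moreover have "(a, m) \<in> graph n c y" using that n by (auto simp: graph_def)
    ultimately have "(z, m) \<in> (graph n c y)\<^sup>*" by (rule rtrancl_into_rtrancl)
    then show ?thesis by (simp add: clo_def)
  qed
  have "m \<in> clo n c y z"
    if am: "a' \<in> clo n c y z" "a \<in> clo n c y z" "m < n" "edge n c a' a m" for a' a m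
  proof -
    from am(4) obtain x where x: "x < n" "c x a \<noteq> c x a'"
      "x = m \<or> c x m = c x a' \<or> c x m = c x a" unfolding edge_def by blast
    then have "edge n c y a m \<or> edge n c y a' m" unfolding edge_def by metis
    then show ?thesis using ext am by blast
  qed
  then show ?thesis using n unfolding sep_closed_def by blast
qed

lemma clo_least:
  assumes "sep_closed n c A" "y \<in> A" "z \<in> A"
  shows "clo n c y z \<subseteq> A"
proof -
  have "m \<in> A" if "(z, m) \<in> (graph n c y)\<^sup>*" for m
    using that
  proof (induction rule: rtrancl_induct)
    case (step a m)
    then show ?case using assms(1,2) unfolding sep_closed_def graph_def by blast
  qed (rule assms(3))
  then show ?thesis using assms by (auto simp: clo_def)
qed

text \<open>Choose \<open>z\<close> in \<open>A\<close> with the largest closure. The closure of any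
  other \<open>w\<close> in \<open>A\<close> shares \<open>y\<close> with it, hence is comparable to
  it, and by maximality is contained in it.\<close>

lemma sep_closed_is_clo:
  assumes c: "separates n lab c" and A: "sep_closed n c A" "y \<in> A"
  shows "\<exists>z\<in>A. A = clo n c y z"
proof -
  have An: "A \<subseteq> {..<n}" by (rule sep_closed_subset[OF A(1)])
  then have fin: "finite A" by (rule finite_subset) simp
  define f where "f z = card (clo n c y z)" for z
  have "Max (f ` A) \<in> f ` A" using fin A(2) by (intro Max_in) auto
  then obtain z where "z \<in> A" "f z = Max (f ` A)" by auto
  then have z: "z \<in> A" "\<And>w. w \<in> A \<Longrightarrow> f w \<le> f z"
    using fin by (auto intro!: Max_ge)
  have "w \<in> clo n c y z" if w: "w \<in> A" for w
  proof -
    have "\<not> overlap (clo n c y w) (clo n c y z)"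
      using An A w z by (intro sep_closed_laminar[OF c] clo_closed) auto
    then have "clo n c y w \<subseteq> clo n c y z \<or> clo n c y z \<subseteq> clo n c y w"
      unfolding overlap_def using clo_memb by blast
    moreover have "clo n c y w = clo n c y z" if "clo n c y z \<subseteq> clo n c y w"
      using card_seteq[OF finite_subset[OF clo_least[OF A w] fin] that] z(2)[OF w]
      by (simp add: f_def)
    ultimately show ?thesis using clo_memb by blast
  qed
  then show ?thesis using clo_least[OF A z(1)] z(1) by blast
qed

text \<open>Both conditions besides agreement select one pair per set: \<open>y\<close> is least in
  the closure, and no smaller vertex is mutually reachable with \<open>z\<close>. Duplicates are
  thus avoided by lookups in the reachability matrix.\<close>

definition node_ok ::
  "nat \<Rightarrow> (nat \<Rightarrow> nat \<Rightarrow> nat) \<Rightarrow> (nat \<Rightarrow> nat \<Rightarrow> nat) \<Rightarrow> nat \<Rightarrow> nat \<Rightarrow> bool" where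
  "node_ok n lab c y z \<longleftrightarrow>
     (\<forall>u\<in>clo n c y z. y \<le> u \<and> agree n lab (clo n c y z) y u) \<and>
     \<not> (\<exists>u<z. (z, u) \<in> (graph n c y)\<^sup>* \<and> (u, z) \<in> (graph n c y)\<^sup>*)"

lemma node_ok_strong:
  assumes c: "separates n lab c" and n: "y < n" "z < n" and ok: "node_ok n lab c y z"
  shows "strong n lab (clo n c y z)"
proof -
  have "um n lab (clo n c y z)"
    using ok sep_closed_subset[OF clo_closed[OF n, of c]]
    by (intro um_pivot[of _ _ _ y]) (auto simp: node_ok_def)
  then show ?thesis using strong_iff_sep_closed[OF c] clo_closed[OF n] by blast
qed

text \<open>\<open>z\<close> is the least generator of \<open>U\<close> over \<open>Min U\<close>; a
  smaller vertex mutually reachable with it would have a closure containing \<open>z\<close>, and so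
  would be a smaller generator.\<close>

lemma strong_node_ok:
  assumes c: "separates n lab c" and U: "strong n lab U" "U \<noteq> {}"
  shows "\<exists>y<n. \<exists>z<n. node_ok n lab c y z \<and> U = clo n c y z"
proof -
  have cl: "sep_closed n c U" and um: "um n lab U"
    using U strong_iff_sep_closed[OF c] by auto
  have Un: "U \<subseteq> {..<n}" by (rule sep_closed_subset[OF cl])
  then have fin: "finite U" by (rule finite_subset) simp
  define y where "y = Min U"
  have y: "y \<in> U" "\<And>u. u \<in> U \<Longrightarrow> y \<le> u" using fin U by (auto simp: y_def)
  define P where "P z \<longleftrightarrow> z \<in> U \<and> U = clo n c y z" for z
  have "\<exists>z. P z" using sep_closed_is_clo[OF c cl y(1)] by (auto simp: P_def)
  define z where "z = (LEAST z. P z)"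
  have z: "z \<in> U" "U = clo n c y z"
    using LeastI_ex[OF \<open>\<exists>z. P z\<close>] by (auto simp: z_def P_def)
  have "\<not> (\<exists>u<z. (z, u) \<in> (graph n c y)\<^sup>* \<and> (u, z) \<in> (graph n c y)\<^sup>*)"
  proof
    assume "\<exists>u<z. (z, u) \<in> (graph n c y)\<^sup>* \<and> (u, z) \<in> (graph n c y)\<^sup>*"
    then obtain u where u: "u < z" "(z, u) \<in> (graph n c y)\<^sup>*" "(u, z) \<in> (graph n c y)\<^sup>*" by blast
    have uU: "u \<in> U" using u z by (auto simp: clo_def)
    have "sep_closed n c (clo n c y u)" using uU y Un by (intro clo_closed) auto
    moreover have "z \<in> clo n c y u" using u by (auto simp: clo_def)
    ultimately have "U \<subseteq> clo n c y u" using clo_least[of n c _ y z] z(2) by auto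
    then have "P u" using clo_least[OF cl y(1) uU] uU by (auto simp: P_def)
    then show False using u(1) not_less_Least unfolding z_def by blast
  qed
  then have "node_ok n lab c y z"
    using y um z unfolding node_ok_def um_def by blast
  then show ?thesis using z y Un by blast
qed

text \<open>For generators other than \<open>y\<close>, equal closures mean mutual reachability. The
  root needs care because it belongs to every closure without having to be reachable;
  \<open>clo_root\<close> settles it, since its closure is a singleton.\<close>

lemma node_ok_inj:
  assumes ok: "node_ok n lab c y z" "node_ok n lab c y' z'" and eq: "clo n c y z = clo n c y' z'"
  shows "y = y' \<and> z = z'"
proof -
  have "y \<le> y'" using ok(1) eq clo_memb(1)[of y' n c z'] unfolding node_ok_def by blast
  moreover have "y' \<le> y" using ok(2) eq clo_memb(1)[of y n c z] unfolding node_ok_def by blast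
  ultimately have y: "y' = y" by simp
  have *: False if "w < w'" "node_ok n lab c y w'" "clo n c y w = clo n c y w'" for w w'
  proof -
    have "w \<noteq> y" using that clo_root[of n c y] clo_memb(2)[of w' n c y] by auto
    moreover have "w' \<noteq> y" using that clo_root[of n c y] clo_memb(2)[of w n c y] by auto
    moreover have "w \<in> clo n c y w'" "w' \<in> clo n c y w" using that(3) clo_memb(2) by metis+
    ultimately have "(w', w) \<in> (graph n c y)\<^sup>*" "(w, w') \<in> (graph n c y)\<^sup>*"
      by (auto simp: clo_def)
    then show False using that unfolding node_ok_def by blast
  qed
  have "z = z'" using *[of z z'] *[of z' z] ok eq y by (metis linorder_neqE_nat)
  then show ?thesis using y by simp
qed

text \<open>A new point \<open>x\<close> adds at most two sets. Deleting \<open>x\<close> is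
  injective on \<open>F1\<close> and keeps it laminar; what remains is \<open>{x}\<close> and the
  sets of \<open>F2\<close>, of which there is at most one. This bound is the origin of
  \<open>B = 2 * n\<close>.\<close>

lemma laminar_card:
  assumes "finite X" "\<And>A. A \<in> F \<Longrightarrow> A \<subseteq> X \<and> A \<noteq> {}"
    and "\<And>A B. A \<in> F \<Longrightarrow> B \<in> F \<Longrightarrow> \<not> overlap A B"
  shows "card F \<le> 2 * card X"
  using assms
proof (induction X arbitrary: F)
  case empty
  then have "F = {}" by blast
  then show ?case by simp
next
  case (insert x X)
  define F1 where "F1 = {A \<in> F. A \<noteq> {x} \<and> (x \<in> A \<longrightarrow> A - {x} \<notin> F)}"
  define F2 where "F2 = {A \<in> F. x \<in> A \<and> A - {x} \<in> F}"
  have fin: "finite F"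
    using insert by (intro finite_subset[of F "Pow (insert x X)"]) auto
  have inj: "inj_on (\<lambda>A. A - {x}) F1"
  proof (rule inj_onI)
    fix A B assume AB: "A \<in> F1" "B \<in> F1" "A - {x} = B - {x}"
    then show "A = B"
      by (cases "x \<in> A"; cases "x \<in> B") (auto simp: F1_def)
  qed
  have "card ((\<lambda>A. A - {x}) ` F1) \<le> 2 * card X"
  proof (rule insert.IH)
    show "A \<subseteq> X \<and> A \<noteq> {}" if "A \<in> (\<lambda>A. A - {x}) ` F1" for A
      using that insert.prems(1) by (auto simp: F1_def)
    show "\<not> overlap A B" if "A \<in> (\<lambda>A. A - {x}) ` F1" "B \<in> (\<lambda>A. A - {x}) ` F1" for A B
    proof -
      from that obtain A' B' where AB: "A' \<in> F" "B' \<in> F" "A = A' - {x}" "B = B' - {x}"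
        by (auto simp: F1_def)
      then show ?thesis using insert.prems(2)[OF AB(1,2)] unfolding overlap_def by blast
    qed
  qed
  then have c1: "card F1 \<le> 2 * card X" using card_image[OF inj] by simp
  \<comment> \<open>Say \<open>A\<close> is contained in \<open>B\<close>. Then \<open>A\<close> and
    \<open>B - {x}\<close> share the nonempty set \<open>A - {x}\<close>, and \<open>x\<close> lies
    only in \<open>A\<close>; as they do not overlap, \<open>B - {x}\<close> is contained in
    \<open>A\<close>.\<close>
  have "A = B" if "A \<in> F2" "B \<in> F2" for A B
  proof -
    have nn: "A - {x} \<noteq> {}" "B - {x} \<noteq> {}" using that insert.prems(1) by (auto simp: F2_def)
    have *: "\<not> overlap A (B - {x})" "\<not> overlap B (A - {x})" "\<not> overlap A B"
      using that insert.prems(2) by (auto simp: F2_def)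
    have x: "x \<in> A" "x \<in> B" using that by (auto simp: F2_def)
    then have "A \<subseteq> B \<or> B \<subseteq> A" using *(3) by (auto simp: overlap_def)
    then show ?thesis using * x nn unfolding overlap_def by blast
  qed
  then have c2: "card F2 \<le> 1"
    using fin by (auto simp: card_le_Suc0_iff_eq F2_def)
  have "F \<subseteq> insert {x} (F1 \<union> F2)" by (auto simp: F1_def F2_def)
  then have "card F \<le> card (insert {x} (F1 \<union> F2))"
    using fin by (intro card_mono) (auto simp: F1_def F2_def)
  also have "\<dots> \<le> Suc (card (F1 \<union> F2))" by (rule card_insert_le_m1[THEN order_trans]) auto
  also have "\<dots> \<le> Suc (card F1 + card F2)" by (simp add: card_Un_le)
  finally show ?case using c1 c2 insert.hyps by simp
qed

section \<open>Computing the maximal umodules avoiding a point\<close>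

abbreviation (input) "rN \<equiv> 0 :: nat"
abbreviation (input) "rP \<equiv> 2 :: nat"
abbreviation (input) "rX \<equiv> 3 :: nat"
abbreviation (input) "rI \<equiv> 4 :: nat"
abbreviation (input) "rU \<equiv> 5 :: nat"
abbreviation (input) "rV \<equiv> 6 :: nat"
abbreviation (input) "rZ \<equiv> 7 :: nat"
abbreviation (input) "rQ \<equiv> 8 :: nat"
abbreviation (input) "rW \<equiv> 9 :: nat"
abbreviation (input) "rOk \<equiv> 10 :: nat"
abbreviation (input) "rF \<equiv> 11 :: nat"
abbreviation (input) "rK \<equiv> 12 :: nat"
abbreviation (input) "rY \<equiv> 13 :: nat"
abbreviation (input) "rA \<equiv> 14 :: nat"
abbreviation (input) "rM \<equiv> 15 :: nat"
abbreviation (input) "rL \<equiv> 16 :: nat"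

abbreviation (input) "aL \<equiv> 0 :: nat"
abbreviation (input) "aFA \<equiv> 2 :: nat"
abbreviation (input) "aFB \<equiv> 3 :: nat"
abbreviation (input) "aI \<equiv> 4 :: nat"
abbreviation (input) "aC \<equiv> 5 :: nat"
abbreviation (input) "aD \<equiv> 6 :: nat"
abbreviation (input) "aR \<equiv> 7 :: nat"
abbreviation (input) "aS \<equiv> 8 :: nat"
abbreviation (input) "aZ \<equiv> 9 :: nat"

text \<open>The arrays hold: \<open>aL\<close> the class labels of the input, \<open>aFA\<close> and \<open>aFB\<close> scratch space of
  the agreement test, \<open>aI\<close> the indicator of the current set, \<open>aC\<close> the partition for each \<open>x\<close>,
  \<open>aD\<close> whether an element agrees with its representative, \<open>aR\<close> the reachability matrix for the
  current \<open>y\<close>, \<open>aS\<close> and \<open>aZ\<close> the indicators and sizes of the nodes found.\<close>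

abbreviation mat :: "store \<Rightarrow> nat \<Rightarrow> nat \<Rightarrow> nat \<Rightarrow> nat" where
  "mat s a i j \<equiv> s (M a i j)"

text \<open>Agreement of the pivot \<open>rQ\<close> and \<open>rW\<close> outside the set \<open>aI\<close> is tested in linear time:
  for each class of one partition remember its last element outside the set, and check that the
  other partition does not separate any element from the one remembered for its class.\<close>

definition agree_mark :: cmd where
  "agree_mark = loop rZ rN (Cond (Eq (At aI (V rZ) (N 0)) (N 0))
     (Put aFA (At aL (V rQ) (V rZ)) (N 0) (V rZ) ;;
      Put aFB (At aL (V rW) (V rZ)) (N 0) (V rZ)) Nop)"

definition agree_test :: cmd where
  "agree_test = loop rZ rN (Cond (Eq (At aI (V rZ) (N 0)) (N 0))
     (Cond (Conj
        (Eq (At aL (V rW) (At aFA (At aL (V rQ) (V rZ)) (N 0))) (At aL (V rW) (V rZ)))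
        (Eq (At aL (V rQ) (At aFB (At aL (V rW) (V rZ)) (N 0))) (At aL (V rQ) (V rZ))))
       Nop (Set rOk (N 0))) Nop)"

definition agree_prog :: cmd where
  "agree_prog = agree_mark ;; Set rOk (N 1) ;; agree_test"

lemma agree_prog_simps [simp]:
  "wr agree_prog l \<longleftrightarrow> l = G rZ \<or> l = G rOk \<or> (\<exists>x y. l = M aFA x y) \<or> (\<exists>x y. l = M aFB x y)"
  "wfc agree_prog" "depth agree_prog = 1"
  by (auto simp: agree_prog_def agree_mark_def agree_test_def)

text \<open>The scratch arrays are never cleared. Stale entries are harmless: the test looks up only
  labels of elements outside the set, and this loop has just overwritten the marks of those
  labels.\<close>

lemma run_agree_mark:
  assumes "s (G rN) = n" "n \<le> B"
  defines "s' \<equiv> run B agree_mark s"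
  shows "\<forall>z<n. s (M aI z 0) = 0 \<longrightarrow>
    (let w = s' (M aFA (s (M aL (s (G rQ)) z)) 0)
     in w < n \<and> s (M aI w 0) = 0 \<and> s (M aL (s (G rQ)) w) = s (M aL (s (G rQ)) z)) \<and>
    (let w = s' (M aFB (s (M aL (s (G rW)) z)) 0)
     in w < n \<and> s (M aI w 0) = 0 \<and> s (M aL (s (G rW)) w) = s (M aL (s (G rW)) z))"
proof -
  let ?I = "\<lambda>i s'. \<forall>z<i. s (M aI z 0) = 0 \<longrightarrow>
    (let w = s' (M aFA (s (M aL (s (G rQ)) z)) 0)
     in w < n \<and> s (M aI w 0) = 0 \<and> s (M aL (s (G rQ)) w) = s (M aL (s (G rQ)) z)) \<and>
    (let w = s' (M aFB (s (M aL (s (G rW)) z)) 0)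
     in w < n \<and> s (M aI w 0) = 0 \<and> s (M aL (s (G rW)) w) = s (M aL (s (G rW)) z))"
  have "?I n s'"
    unfolding s'_def agree_mark_def
  proof (rule loop_rule[where I = ?I])
    fix i t assume "i < n" "t (G rZ) = i" and I: "?I i t"
      and fr: "\<And>l. \<not> wr (Cond (Eq (At aI (V rZ) (N 0)) (N 0))
     (Put aFA (At aL (V rQ) (V rZ)) (N 0) (V rZ) ;;
      Put aFB (At aL (V rW) (V rZ)) (N 0) (V rZ)) Nop) l \<Longrightarrow> l \<noteq> G rZ \<Longrightarrow> t l = s l"
    then show "?I (Suc i) (run B (Cond (Eq (At aI (V rZ) (N 0)) (N 0))
     (Put aFA (At aL (V rQ) (V rZ)) (N 0) (V rZ) ;;
      Put aFB (At aL (V rW) (V rZ)) (N 0) (V rZ)) Nop) t)"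
      by (auto simp: less_Suc_eq Let_def)
  qed (use assms in auto)
  then show ?thesis by simp
qed

lemma run_agree_prog:
  assumes n: "s (G rN) = n" "n \<le> B"
  shows "run B agree_prog s (G rOk) =
    (if agree n (mat s aL) {v. s (M aI v 0) \<noteq> 0} (s (G rQ)) (s (G rW)) then 1 else 0)"
proof -
  define s1 where "s1 = (run B agree_mark s)(G rOk := 1)"
  have fr: "s1 l = s l" if "\<not> wr agree_prog l" for l
    using that by (auto simp: s1_def agree_mark_def)
  define q where "q z = s (M aL (s (G rQ)) z)" for z
  define w where "w z = s (M aL (s (G rW)) z)" for z
  define fa where "fa k = s1 (M aFA k 0)" for k
  define fb where "fb k = s1 (M aFB k 0)" for k
  let ?ok = "\<lambda>z. s (M aI z 0) = 0 \<longrightarrow> w (fa (q z)) = w z \<and> q (fb (w z)) = q z"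
  let ?I = "\<lambda>i t. t (G rOk) = (if \<forall>z<i. ?ok z then 1 else 0)"
  have "?I n (run B agree_test s1)"
    unfolding agree_test_def
  proof (rule loop_rule[where I = ?I], goal_cases)
    case (8 i t)
    have "t (G rQ) = s (G rQ)" "t (G rW) = s (G rW)" "\<And>i j. t (M aL i j) = s (M aL i j)"
      "\<And>i j. t (M aI i j) = s (M aI i j)" "\<And>k. t (M aFA k 0) = fa k" "\<And>k. t (M aFB k 0) = fb k"
      using 8(3) fr by (auto simp: fa_def fb_def)
    then show ?case using 8(1,2,4) by (auto simp: less_Suc_eq q_def w_def)
  qed (use n fr in \<open>auto simp: s1_def\<close>)
  then have r: "run B agree_prog s (G rOk) = (if \<forall>z<n. ?ok z then 1 else 0)"
    by (simp add: agree_prog_def s1_def)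
  have m: "\<forall>z<n. s (M aI z 0) = 0 \<longrightarrow>
    fa (q z) < n \<and> s (M aI (fa (q z)) 0) = 0 \<and> q (fa (q z)) = q z \<and>
    fb (w z) < n \<and> s (M aI (fb (w z)) 0) = 0 \<and> w (fb (w z)) = w z"
    using run_agree_mark[of s n B, OF n] by (auto simp: Let_def fa_def fb_def q_def w_def s1_def)
  have "(\<forall>z<n. ?ok z) \<longleftrightarrow> agree n (mat s aL) {v. s (M aI v 0) \<noteq> 0} (s (G rQ)) (s (G rW))"
    (is "?l \<longleftrightarrow> ?r")
  proof
    \<comment> \<open>Elements with the same \<open>q\<close>-label have the same mark, so the test
      compares their \<open>w\<close>-labels with one and the same element; the other array gives
      the converse.\<close>
    assume l: ?l
    have "(q z = q z') = (w z = w z')"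
      if "z < n" "z' < n" "s (M aI z 0) = 0" "s (M aI z' 0) = 0" for z z'
      using l that by metis
    then show ?r by (simp add: agree_def q_def w_def)
  next
    assume r: ?r
    then have "(q z = q z') = (w z = w z')"
      if "z < n" "z' < n" "s (M aI z 0) = 0" "s (M aI z' 0) = 0" for z z'
      using that by (simp add: agree_def q_def w_def)
    then show ?l using m by metis
  qed
  then show ?thesis using r by simp
qed

lemma agree_cong:
  assumes "\<And>v. v < n \<Longrightarrow> v \<in> A \<longleftrightarrow> v \<in> A'"
  shows "agree n lab A q w = agree n lab A' q w"
  using assms by (simp add: agree_def)

section \<open>Partition refinement for one excluded point\<close>

definition fill_class :: cmd where
  "fill_class = loop rV rN (Cond (Eq (At aC (V rX) (V rV)) (V rQ))
     (Put aI (V rV) (N 0) (N 1)) (Put aI (V rV) (N 0) (N 0)))"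

definition mark_dis :: cmd where
  "mark_dis = loop rU rN (Set rQ (At aC (V rX) (V rU)) ;; Set rW (V rU) ;;
     fill_class ;; agree_prog ;; Put aD (V rU) (N 0) (V rOk))"

definition pick_dis :: cmd where
  "pick_dis = loop rU rN (Cond (Eq (At aD (V rU) (N 0)) (N 0))
     (Set rF (N 1) ;; Set rW (V rU) ;; Set rQ (At aC (V rX) (V rU))) Nop)"

definition split_class :: cmd where
  "split_class = loop rV rN (Cond (Conj (Eq (At aD (V rV) (N 0)) (N 0))
       (Eq (At aC (V rX) (V rV)) (V rQ)))
     (Put aC (V rX) (V rV) (V rW)) Nop)"

definition refine_prog :: cmd where
  "refine_prog = mark_dis ;; Set rF (N 0) ;; pick_dis ;; Cond (Eq (V rF) (N 1)) split_class Nop"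

lemma fill_class_simps [simp]:
  "wr fill_class l \<longleftrightarrow> l = G rV \<or> (\<exists>x y. l = M aI x y)" "wfc fill_class" "depth fill_class = 1"
  by (auto simp: fill_class_def)

lemma mark_dis_simps [simp]:
  "wr mark_dis l \<longleftrightarrow> l \<in> {G rU, G rQ, G rW, G rV, G rZ, G rOk} \<or>
     (\<exists>x y. l = M aI x y) \<or> (\<exists>x y. l = M aFA x y) \<or> (\<exists>x y. l = M aFB x y) \<or> (\<exists>x y. l = M aD x y)" "wfc mark_dis" "depth mark_dis = 2"
  by (auto simp: mark_dis_def)

lemma pick_dis_simps [simp]:
  "wr pick_dis l \<longleftrightarrow> l \<in> {G rU, G rQ, G rW, G rF}" "wfc pick_dis" "depth pick_dis = 1"
  by (auto simp: pick_dis_def)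

lemma split_class_simps [simp]:
  "wr split_class l \<longleftrightarrow> l = G rV \<or> (\<exists>x y. l = M aC x y)" "wfc split_class" "depth split_class = 1"
  by (auto simp: split_class_def)

lemma refine_prog_simps [simp]:
  "wr refine_prog l \<longleftrightarrow> l \<in> {G rU, G rQ, G rW, G rV, G rZ, G rOk, G rF} \<or>
     (\<exists>x y. l = M aI x y) \<or> (\<exists>x y. l = M aFA x y) \<or> (\<exists>x y. l = M aFB x y) \<or> (\<exists>x y. l = M aD x y) \<or> (\<exists>x y. l = M aC x y)" "wfc refine_prog" "depth refine_prog = 2"
  by (auto simp: refine_prog_def)

lemma run_fill_class:
  assumes "s (G rN) = n" "n \<le> B"
  shows "\<forall>v<n. run B fill_class s (M aI v 0) = (if s (M aC (s (G rX)) v) = s (G rQ) then 1 else 0)"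
proof -
  let ?I = "\<lambda>i t. \<forall>v<i. t (M aI v 0) = (if s (M aC (s (G rX)) v) = s (G rQ) then 1 else 0)"
  have "?I n (run B fill_class s)"
    unfolding fill_class_def
  proof (rule loop_rule[where I = ?I], goal_cases)
    case (8 i t)
    then show ?case by (auto simp: less_Suc_eq)
  qed (use assms in auto)
  then show ?thesis by simp
qed

lemma run_mark_dis:
  assumes "s (G rN) = n" "n \<le> B"
  shows "\<forall>v<n. run B mark_dis s (M aD v 0) =
    (if dis n (mat s aL) (mat s aC (s (G rX))) v then 0 else 1)"
proof -
  let ?I = "\<lambda>i t. \<forall>v<i. t (M aD v 0) =
    (if dis n (mat s aL) (mat s aC (s (G rX))) v then 0 else 1)"
  have "?I n (run B mark_dis s)"
    unfolding mark_dis_def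
  proof (rule loop_rule[where I = ?I], goal_cases)
    case (8 i t)
    define t1 where "t1 = t(G rQ := s (M aC (s (G rX)) i), G rW := i)"
    have fr: "t (G rX) = s (G rX)" "t (G rN) = n" "\<And>i j. t (M aC i j) = s (M aC i j)"
      "\<And>i j. t (M aL i j) = s (M aL i j)"
      using 8(3) assms by auto
    define t2 where "t2 = run B fill_class t1"
    let ?q = "s (M aC (s (G rX)) i)"
    have t2: "t2 (G rN) = n" "t2 (G rQ) = ?q" "t2 (G rW) = i" "mat t2 aL = mat s aL"
      using fr by (auto simp: t2_def t1_def intro!: ext)
    have "agree n (mat s aL) {v. t2 (M aI v 0) \<noteq> 0} ?q i =
      agree n (mat s aL) {v. s (M aC (s (G rX)) v) = ?q} ?q i"
      using run_fill_class[of t1 n B] fr assms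
      by (intro agree_cong) (auto simp: t2_def t1_def)
    then have "run B agree_prog t2 (G rOk) =
      (if dis n (mat s aL) (mat s aC (s (G rX))) i then 0 else 1)"
      using run_agree_prog[of t2 n B, OF t2(1) assms(2)] t2 by (simp add: dis_def)
    then show ?case using 8(1,2,4) fr by (auto simp: less_Suc_eq t1_def t2_def)
  qed (use assms in auto)
  then show ?thesis by simp
qed

lemma run_pick_dis:
  assumes "s (G rN) = n" "n \<le> B" "s (G rF) = 0"
  defines "t \<equiv> run B pick_dis s"
  shows "(t (G rF) = 1 \<and> t (G rW) < n \<and> s (M aD (t (G rW)) 0) = 0 \<and>
      t (G rQ) = s (M aC (s (G rX)) (t (G rW)))) \<or>
    t (G rF) = 0 \<and> (\<forall>u<n. s (M aD u 0) \<noteq> 0)"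
proof -
  let ?I = "\<lambda>i t. (t (G rF) = 1 \<and> t (G rW) < n \<and> s (M aD (t (G rW)) 0) = 0 \<and>
      t (G rQ) = s (M aC (s (G rX)) (t (G rW)))) \<or>
    t (G rF) = 0 \<and> (\<forall>u<i. s (M aD u 0) \<noteq> 0)"
  have "?I n t"
    unfolding t_def pick_dis_def
  proof (rule loop_rule[where I = ?I], goal_cases)
    case (8 i t)
    then show ?case by (auto simp: less_Suc_eq)
  qed (use assms in auto)
  then show ?thesis by simp
qed

lemma run_split_class:
  assumes "s (G rN) = n" "n \<le> B"
  defines "t \<equiv> run B split_class s" and "x \<equiv> s (G rX)"
  shows "(\<forall>v<n. t (M aC x v) = (if s (M aD v 0) = 0 \<and> s (M aC x v) = s (G rQ)
       then s (G rW) else s (M aC x v))) \<and> (\<forall>x' v. x' \<noteq> x \<longrightarrow> t (M aC x' v) = s (M aC x' v))"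
proof -
  let ?I = "\<lambda>i t. (\<forall>v. t (M aC x v) = (if v < i \<and> s (M aD v 0) = 0 \<and> s (M aC x v) = s (G rQ)
       then s (G rW) else s (M aC x v))) \<and> (\<forall>x' v. x' \<noteq> x \<longrightarrow> t (M aC x' v) = s (M aC x' v))"
  have "?I n t"
    unfolding t_def split_class_def
  proof (rule loop_rule[where I = ?I], goal_cases)
    case (8 i t)
    have fr: "t (G rX) = x" "t (G rQ) = s (G rQ)" "t (G rW) = s (G rW)" "\<And>v. t (M aD v 0) = s (M aD v 0)"
      using 8(3) by (auto simp: x_def)
    then show ?case using 8(1,2,4) by (auto simp: less_Suc_eq)
  qed (use assms in auto)
  then show ?thesis by simp
qed

lemma run_refine_prog:
  assumes n: "s (G rN) = n" "n \<le> B"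
  defines "t \<equiv> run B refine_prog s" and "x \<equiv> s (G rX)"
  shows "refine_step n (mat s aL) (mat s aC x) (mat t aC x) \<and>
    (\<forall>x' v. x' \<noteq> x \<longrightarrow> t (M aC x' v) = s (M aC x' v))"
proof -
  define s1 where "s1 = (run B mark_dis s)(G rF := 0)"
  have d: "s1 (M aD v 0) = (if dis n (mat s aL) (mat s aC x) v then 0 else 1)" if "v < n" for v
    using run_mark_dis[of s n B, OF n] that by (simp add: s1_def x_def)
  have fr1: "s1 (G rN) = n" "s1 (G rX) = x" "s1 (G rF) = 0" "\<And>i j. s1 (M aC i j) = s (M aC i j)"
    using n by (auto simp: s1_def x_def)
  define s2 where "s2 = run B pick_dis s1"
  have fr2: "s2 (G rN) = n" "s2 (G rX) = x" "\<And>i j. s2 (M aC i j) = s (M aC i j)"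
    "\<And>i j. s2 (M aD i j) = s1 (M aD i j)"
    using fr1 by (auto simp: s2_def)
  have t: "t = (if s2 (G rF) = 1 then run B split_class s2 else s2)"
    by (simp add: t_def refine_prog_def s1_def s2_def)
  have p: "(s2 (G rF) = 1 \<and> s2 (G rW) < n \<and> dis n (mat s aL) (mat s aC x) (s2 (G rW)) \<and>
      s2 (G rQ) = s (M aC x (s2 (G rW)))) \<or>
    s2 (G rF) = 0 \<and> (\<forall>u<n. \<not> dis n (mat s aL) (mat s aC x) u)"
    using run_pick_dis[of s1 n B, OF fr1(1) n(2) fr1(3)] fr1 d unfolding s2_def[symmetric]
    by (metis zero_neq_one)
  show ?thesis
  proof (cases "s2 (G rF) = 1")
    case True
    then show ?thesis
      using p t fr2 d run_split_class[of s2 n B, OF fr2(1) n(2)]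
      by (auto simp: refine_step_def intro!: exI[of _ "s2 (G rW)"])
  next
    case False
    then show ?thesis using p t fr2 by (auto simp: refine_step_def)
  qed
qed

text \<open>The rest class is named by its least member: 0, or 1 if the excluded point is 0
  itself.\<close>

definition init_row :: cmd where
  "init_row = loop rV rN (Cond (Eq (V rV) (V rX)) (Put aC (V rX) (V rV) (V rX))
     (Cond (Eq (V rX) (N 0)) (Put aC (V rX) (V rV) (N 1)) (Put aC (V rX) (V rV) (N 0))))"

definition partition_prog :: cmd where
  "partition_prog = loop rX rN (init_row ;; loop rI rN refine_prog)"

lemma init_row_simps [simp]:
  "wr init_row l \<longleftrightarrow> l = G rV \<or> (\<exists>x y. l = M aC x y)" "wfc init_row" "depth init_row = 1"
  by (auto simp: init_row_def)

lemma partition_prog_simps [simp]: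
  "wr partition_prog l \<longleftrightarrow> l \<in> {G rU, G rQ, G rW, G rV, G rZ, G rOk, G rF, G rX, G rI} \<or>
     (\<exists>x y. l = M aI x y) \<or> (\<exists>x y. l = M aFA x y) \<or> (\<exists>x y. l = M aFB x y) \<or> (\<exists>x y. l = M aD x y) \<or> (\<exists>x y. l = M aC x y)" "wfc partition_prog"
  "depth partition_prog = 4"
  by (auto simp: partition_prog_def)

lemma run_init_row:
  assumes "s (G rN) = n" "n \<le> B" "s (G rX) = x" "x < n"
  defines "t \<equiv> run B init_row s"
  shows "refined n lab x (mat t aC x) \<and> (\<forall>x' v. x' \<noteq> x \<longrightarrow> t (M aC x' v) = s (M aC x' v))"
proof -
  let ?r = "\<lambda>v. if v = x then x else if x = 0 then 1 else 0 :: nat"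
  let ?I = "\<lambda>i t. (\<forall>v<i. t (M aC x v) = ?r v) \<and> (\<forall>x' v. x' \<noteq> x \<longrightarrow> t (M aC x' v) = s (M aC x' v))"
  have I: "?I n t"
    unfolding t_def init_row_def
  proof (rule loop_rule[where I = ?I], goal_cases)
    case (8 i t)
    have "t (G rX) = x" using 8(3) assms by simp
    then show ?case using 8(1,2,4) by (auto simp: less_Suc_eq)
  qed (use assms in auto)
  have r: "refined n lab x ?r"
    using \<open>x < n\<close> by (auto simp: refined_def um_def intro!: gr0I)
  have "mat t aC x v = ?r v" if "v < n" for v using I that by blast
  then have "refined n lab x (mat t aC x)" using r by (rule refined_cong)
  then show ?thesis using I by blast
qed

text \<open>Stability is not tested for; the step is simply repeated \<open>n\<close> times, being
  the identity once stable. By the invariant, either the partition is stable or it has more than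
  \<open>i\<close> classes after \<open>i\<close> rounds, and more than \<open>n\<close> classes are
  impossible.\<close>

lemma run_partition_row:
  assumes "s (G rN) = n" "n \<le> B" "s (G rX) = x" "x < n"
  defines "t \<equiv> run B (init_row ;; loop rI rN refine_prog) s"
  shows "refined n (mat s aL) x (mat t aC x) \<and> (\<forall>v<n. \<not> dis n (mat s aL) (mat t aC x) v) \<and>
    (\<forall>x' v. x' \<noteq> x \<longrightarrow> t (M aC x' v) = s (M aC x' v))"
proof -
  define s1 where "s1 = run B init_row s"
  have fr1: "s1 (G rN) = n" using assms by (simp add: s1_def)
  let ?I = "\<lambda>i t. refined n (mat s aL) x (mat t aC x) \<and>
    ((\<forall>v<n. \<not> dis n (mat s aL) (mat t aC x) v) \<or> i < card (mat t aC x ` {..<n})) \<and>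
    (\<forall>x' v. x' \<noteq> x \<longrightarrow> t (M aC x' v) = s (M aC x' v))"
  have I: "?I n (run B (loop rI rN refine_prog) s1)"
  proof (rule loop_rule[where I = ?I], goal_cases)
    case (8 i t)
    have fr: "t (G rN) = n" "t (G rX) = x" "mat t aL = mat s aL"
      using 8(3) assms by (auto simp: s1_def intro!: ext)
    define t' where "t' = run B refine_prog t"
    have r: "refine_step n (mat s aL) (mat t aC x) (mat t' aC x)"
      "\<And>x' v. x' \<noteq> x \<Longrightarrow> t' (M aC x' v) = t (M aC x' v)"
      using run_refine_prog[of t n B, OF fr(1) assms(2)] fr unfolding t'_def by auto
    show ?case
    proof (cases "\<exists>u<n. dis n (mat s aL) (mat t aC x) u")
      case True
      have "refined n (mat s aL) x (mat t aC x)" using 8(4) by blast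
      from refine_step_refined[OF this r(1) True]
      have "refined n (mat s aL) x (mat t' aC x)"
        "card (mat t aC x ` {..<n}) < card (mat t' aC x ` {..<n})" by auto
      moreover have "i < card (mat t aC x ` {..<n})" using 8(4) True by blast
      ultimately show ?thesis using r(2) 8(4) unfolding t'_def[symmetric] by auto
    next
      case False
      then have eq: "mat t' aC x v = mat t aC x v" if "v < n" for v
        using r(1) that by (auto simp: refine_step_def)
      have "refined n (mat s aL) x (mat t' aC x)"
        using 8(4) by (intro refined_cong[OF eq]) auto
      moreover have "\<not> dis n (mat s aL) (mat t' aC x) v" if "v < n" for v
        using dis_cong[OF eq that] False that by simp
      ultimately show ?thesis using r(2) 8(4) unfolding t'_def[symmetric] by simp
    qed
  next
    case 6
    have "mat s1 aC x ` {..<n} \<noteq> {}" using assms(4) by auto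
    then have "0 < card (mat s1 aC x ` {..<n})" by (simp add: card_gt_0_iff)
    then show ?case using run_init_row[of s n B x, OF assms(1-4)] by (simp add: s1_def)
  qed (use assms fr1 in auto)
  moreover have "card (mat t aC x ` {..<n}) \<le> n" for t :: store
    using card_image_le[of "{..<n}" "mat t aC x"] by simp
  ultimately show ?thesis by (auto simp: t_def s1_def not_less[symmetric])
qed

lemma run_partition_prog:
  assumes "s (G rN) = n" "n \<le> B"
  shows "separates n (mat s aL) (mat (run B partition_prog s) aC)"
proof -
  let ?I = "\<lambda>i t. \<forall>x<i. refined n (mat s aL) x (mat t aC x) \<and>
    (\<forall>v<n. \<not> dis n (mat s aL) (mat t aC x) v)"
  have "?I n (run B partition_prog s)"
    unfolding partition_prog_def
  proof (rule loop_rule[where I = ?I], goal_cases)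
    case (8 i t)
    have fr: "t (G rN) = n" "mat t aL = mat s aL" using 8(3) assms by (auto intro!: ext)
    have "mat (run B (init_row ;; loop rI rN refine_prog) t) aC x = mat t aC x" if "x < i" for x
      using run_partition_row[of t n B i, OF fr(1) assms(2) 8(2,1)] that by auto
    then show ?case
      using run_partition_row[of t n B i, OF fr(1) assms(2) 8(2,1)] 8(4) fr(2)
      by (auto simp: less_Suc_eq simp del: run.simps)
  qed (use assms in auto)
  then show ?thesis by (intro refined_separates) auto
qed

section \<open>Enumerating the strong umodules\<close>

text \<open>The disjunction in \<open>edge\<close> is written with \<open>Neg\<close> and
  \<open>Conj\<close>, the only connectives of \<open>bx\<close>.\<close>

definition edge_scan :: cmd where
  "edge_scan = loop rX rN (Cond
     (Conj (Neg (Eq (At aC (V rX) (V rA)) (At aC (V rX) (V rY))))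
       (Neg (Conj (Neg (Eq (V rX) (V rM)))
         (Conj (Neg (Eq (At aC (V rX) (V rM)) (At aC (V rX) (V rY))))
           (Neg (Eq (At aC (V rX) (V rM)) (At aC (V rX) (V rA))))))))
     (Set rF (N 1)) Nop)"

definition edge_row :: cmd where
  "edge_row = loop rM rN (Set rF (N 0) ;; Cond (Eq (V rA) (V rM)) (Set rF (N 1)) Nop ;;
     edge_scan ;; Put aR (V rA) (V rM) (V rF))"

definition edge_prog :: cmd where
  "edge_prog = loop rA rN edge_row"

lemma edge_scan_simps [simp]:
  "wr edge_scan l \<longleftrightarrow> l = G rX \<or> l = G rF" "wfc edge_scan" "depth edge_scan = 1"
  by (auto simp: edge_scan_def)

lemma edge_row_simps [simp]:
  "wr edge_row l \<longleftrightarrow> l \<in> {G rX, G rF, G rM} \<or> (\<exists>x y. l = M aR x y)"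
  "wfc edge_row" "depth edge_row = 2"
  by (auto simp: edge_row_def)

lemma edge_prog_simps [simp]:
  "wr edge_prog l \<longleftrightarrow> l \<in> {G rX, G rF, G rM, G rA} \<or> (\<exists>x y. l = M aR x y)"
  "wfc edge_prog" "depth edge_prog = 3"
  by (auto simp: edge_prog_def)

lemma run_edge_scan:
  assumes "s (G rN) = n" "n \<le> B"
  shows "run B edge_scan s (G rF) =
    (if edge n (mat s aC) (s (G rY)) (s (G rA)) (s (G rM)) then 1 else s (G rF))"
proof -
  let ?e = "\<lambda>x. s (M aC x (s (G rA))) \<noteq> s (M aC x (s (G rY))) \<and> (x = s (G rM) \<or>
    s (M aC x (s (G rM))) = s (M aC x (s (G rY))) \<or> s (M aC x (s (G rM))) = s (M aC x (s (G rA))))"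
  let ?I = "\<lambda>i t. t (G rF) = (if \<exists>x<i. ?e x then 1 else s (G rF))"
  have "?I n (run B edge_scan s)"
    unfolding edge_scan_def
  proof (rule loop_rule[where I = ?I], goal_cases)
    case (8 i t)
    then show ?case by (auto simp: less_Suc_eq)
  qed (use assms in auto)
  then show ?thesis by (simp add: edge_def)
qed

lemma run_edge_row:
  assumes "s (G rN) = n" "n \<le> B" "s (G rA) = a" "s (G rY) = y"
  defines "t \<equiv> run B edge_row s"
  shows "(\<forall>m<n. t (M aR a m) = (if a = m \<or> edge n (mat s aC) y a m then 1 else 0)) \<and>
    (\<forall>a' m. a' \<noteq> a \<longrightarrow> t (M aR a' m) = s (M aR a' m))"
proof -
  let ?I = "\<lambda>i t. (\<forall>m<i. t (M aR a m) = (if a = m \<or> edge n (mat s aC) y a m then 1 else 0)) \<and>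
    (\<forall>a' m. a' \<noteq> a \<longrightarrow> t (M aR a' m) = s (M aR a' m))"
  have "?I n t"
    unfolding t_def edge_row_def
  proof (rule loop_rule[where I = ?I], goal_cases)
    case (8 i t)
    have fr: "t (G rN) = n" "t (G rA) = a" "t (G rY) = y" "mat t aC = mat s aC"
      using 8(3) assms by (auto intro!: ext)
    define t1 where "t1 = t(G rF := if a = i then 1 else 0)"
    have "run B edge_scan t1 (G rF) = (if a = i \<or> edge n (mat s aC) y a i then 1 else 0)"
      using run_edge_scan[of t1 n B] fr 8(2) assms(2) by (simp add: t1_def)
    moreover have "run B (Cond (Eq (V rA) (V rM)) (Set rF (N 1)) Nop) (run B (Set rF (N 0)) t) = t1"
      using fr 8(2) by (auto simp: t1_def)
    ultimately show ?case using 8(1,2,4) fr by (auto simp: less_Suc_eq t1_def)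
  qed (use assms in auto)
  then show ?thesis by simp
qed

lemma run_edge_prog:
  assumes "s (G rN) = n" "n \<le> B" "s (G rY) = y"
  shows "\<forall>a<n. \<forall>m<n. run B edge_prog s (M aR a m) =
    (if a = m \<or> edge n (mat s aC) y a m then 1 else 0)"
proof -
  let ?I = "\<lambda>i t. \<forall>a<i. \<forall>m<n. t (M aR a m) = (if a = m \<or> edge n (mat s aC) y a m then 1 else 0)"
  have "?I n (run B edge_prog s)"
    unfolding edge_prog_def
  proof (rule loop_rule[where I = ?I], goal_cases)
    case (8 i t)
    have fr: "t (G rN) = n" "t (G rY) = y" "mat t aC = mat s aC"
      using 8(3) assms by (auto intro!: ext)
    show ?case
      using run_edge_row[of t n B i y, OF fr(1) assms(2) 8(2) fr(2)] 8(4) fr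
      by (simp add: less_Suc_eq)
  qed (use assms in auto)
  then show ?thesis by simp
qed

section \<open>Transitive closure in place\<close>

definition warshall_row :: cmd where
  "warshall_row = loop rM rN
     (Cond (Conj (Eq (At aR (V rA) (V rI)) (N 1)) (Eq (At aR (V rI) (V rM)) (N 1)))
        (Put aR (V rA) (V rM) (N 1)) Nop)"

definition warshall_stage :: cmd where
  "warshall_stage = loop rA rN warshall_row"

definition warshall_prog :: cmd where
  "warshall_prog = loop rI rN warshall_stage"

lemma warshall_row_simps [simp]:
  "wr warshall_row l \<longleftrightarrow> l = G rM \<or> (\<exists>x y. l = M aR x y)" "wfc warshall_row" "depth warshall_row = 1"
  by (auto simp: warshall_row_def)

lemma warshall_stage_simps [simp]:
  "wr warshall_stage l \<longleftrightarrow> l = G rM \<or> l = G rA \<or> (\<exists>x y. l = M aR x y)"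
  "wfc warshall_stage" "depth warshall_stage = 2"
  by (auto simp: warshall_stage_def)

lemma warshall_prog_simps [simp]:
  "wr warshall_prog l \<longleftrightarrow> l \<in> {G rM, G rA, G rI} \<or> (\<exists>x y. l = M aR x y)"
  "wfc warshall_prog" "depth warshall_prog = 3"
  by (auto simp: warshall_prog_def)

text \<open>Overwriting the matrix in place is safe: an entry of row \<open>k\<close> or column
  \<open>k\<close> is set to 1 only if it is 1 already, so the entries consulted at stage
  \<open>k\<close> are constant.\<close>

lemma run_warshall_row:
  assumes "s (G rN) = n" "n \<le> B" "s (G rA) = a" "s (G rI) = k"
  shows "run B warshall_row s (M aR a' m) =
    (if a' = a \<and> m < n \<and> s (M aR a k) = 1 \<and> s (M aR k m) = 1 then 1 else s (M aR a' m))"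
proof -
  let ?I = "\<lambda>i t. \<forall>a' m. t (M aR a' m) =
    (if a' = a \<and> m < i \<and> s (M aR a k) = 1 \<and> s (M aR k m) = 1 then 1 else s (M aR a' m))"
  have "?I n (run B warshall_row s)"
    unfolding warshall_row_def
  proof (rule loop_rule[where I = ?I], goal_cases)
    case (8 i t)
    have fr: "t (G rA) = a" "t (G rI) = k" using 8(3) assms by auto
    have "t (M aR a k) = s (M aR a k)" "t (M aR k i) = s (M aR k i)"
      using 8(4) by auto
    then show ?case using 8(1,2,4) fr by (auto simp: less_Suc_eq)
  qed (use assms in auto)
  then show ?thesis by simp
qed

lemma run_warshall_stage:
  assumes "s (G rN) = n" "n \<le> B" "s (G rI) = k"
  shows "run B warshall_stage s (M aR a m) =
    (if a < n \<and> m < n \<and> s (M aR a k) = 1 \<and> s (M aR k m) = 1 then 1 else s (M aR a m))"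
proof -
  let ?I = "\<lambda>i t. \<forall>a m. t (M aR a m) =
    (if a < i \<and> m < n \<and> s (M aR a k) = 1 \<and> s (M aR k m) = 1 then 1 else s (M aR a m))"
  have "?I n (run B warshall_stage s)"
    unfolding warshall_stage_def
  proof (rule loop_rule[where I = ?I], goal_cases)
    case (8 i t)
    have fr: "t (G rN) = n" "t (G rI) = k" using 8(3) assms by auto
    have "t (M aR i k) = s (M aR i k)" "\<And>m. t (M aR k m) = s (M aR k m)"
      using 8(4) by auto
    then show ?case using 8(4) run_warshall_row[of t n B i k, OF fr(1) assms(2) 8(2) fr(2)]
      by (auto simp: less_Suc_eq)
  qed (use assms in auto)
  then show ?thesis by simp
qed

text \<open>The invariant avoids paths with restricted inner vertices. It asks that the matrix lie
  between the reflexive closure of \<open>E\<close> and \<open>E\<^sup>*\<close> and be transitive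
  through every middle vertex below \<open>i\<close>; at \<open>i = n\<close> it is transitive
  outright and thus equals \<open>E\<^sup>*\<close>.\<close>

lemma run_warshall_prog:
  assumes n: "s (G rN) = n" "n \<le> B"
    and E: "E \<subseteq> {..<n} \<times> {..<n}"
    and s: "\<And>a m. a < n \<Longrightarrow> m < n \<Longrightarrow> s (M aR a m) = 1 \<longleftrightarrow> a = m \<or> (a, m) \<in> E"
    and am: "a < n" "m < n"
  shows "run B warshall_prog s (M aR a m) = 1 \<longleftrightarrow> (a, m) \<in> E\<^sup>*"
proof -
  let ?I = "\<lambda>i t. (\<forall>a<n. \<forall>m<n. (a = m \<or> (a, m) \<in> E \<longrightarrow> t (M aR a m) = 1) \<and>
      (t (M aR a m) = 1 \<longrightarrow> (a, m) \<in> E\<^sup>*)) \<and>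
    (\<forall>k<i. \<forall>a<n. \<forall>m<n. t (M aR a k) = 1 \<longrightarrow> t (M aR k m) = 1 \<longrightarrow> t (M aR a m) = 1)"
  define t where "t = run B warshall_prog s"
  have I: "?I n t"
    unfolding t_def warshall_prog_def
  proof (rule loop_rule[where I = ?I], goal_cases)
    case (8 i t)
    have fr: "t (G rN) = n" using 8(3) assms by auto
    define t' where "t' = run B warshall_stage t"
    have t': "t' (M aR a m) = 1 \<longleftrightarrow> t (M aR a m) = 1 \<or> t (M aR a i) = 1 \<and> t (M aR i m) = 1"
      if "a < n" "m < n" for a m
      using run_warshall_stage[of t n B i, OF fr n(2) 8(2)] that unfolding t'_def by auto
    have "\<forall>a<n. \<forall>m<n. (a = m \<or> (a, m) \<in> E \<longrightarrow> t' (M aR a m) = 1) \<and>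
      (t' (M aR a m) = 1 \<longrightarrow> (a, m) \<in> E\<^sup>*)"
    proof (intro allI impI conjI)
      fix a m assume "a < n" "m < n"
      note t'' = t'[OF this]
      {
        assume "a = m \<or> (a, m) \<in> E"
        then show "t' (M aR a m) = 1" using 8(4) \<open>a < n\<close> \<open>m < n\<close> t'' by blast
      }
      assume "t' (M aR a m) = 1"
      then consider "t (M aR a m) = 1" | "t (M aR a i) = 1" "t (M aR i m) = 1" using t'' by blast
      then show "(a, m) \<in> E\<^sup>*"
      proof cases
        case 1
        then show ?thesis using 8(4) \<open>a < n\<close> \<open>m < n\<close> by blast
      next
        case 2
        then have "(a, i) \<in> E\<^sup>*" "(i, m) \<in> E\<^sup>*" using 8(1,4) \<open>a < n\<close> \<open>m < n\<close> by blast+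
        then show ?thesis by (rule rtrancl_trans)
      qed
    qed
    moreover have "t' (M aR a m) = 1"
      if "k < Suc i" "a < n" "m < n" "t' (M aR a k) = 1" "t' (M aR k m) = 1" for k a m
    proof -
      have "k < n" using that 8(1) by simp
      note t's = t'[OF \<open>a < n\<close> \<open>m < n\<close>] t'[OF \<open>a < n\<close> \<open>k < n\<close>] t'[OF \<open>k < n\<close> \<open>m < n\<close>]
      show ?thesis
      proof (cases "k = i")
        case True
        then show ?thesis using t's that by auto
      next
        case False
        then have "k < i" using that by simp
        then have tr: "t (M aR b k) = 1 \<Longrightarrow> t (M aR k c) = 1 \<Longrightarrow> t (M aR b c) = 1"
          if "b < n" "c < n" for b c using 8(4) that by blast
        show ?thesis
          using t's that tr[of a m] tr[of a i] tr[of i m] 8(1) by auto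
      qed
    qed
    ultimately show ?case unfolding t'_def[symmetric] by blast
  qed (use assms in auto)
  have "t (M aR a b) = 1" if "(a, b) \<in> E\<^sup>*" "b < n" for b
    using that
  proof (induction rule: rtrancl_induct)
    case base
    then show ?case using I by blast
  next
    case (step b c)
    then have bc: "b < n" "c < n" using E by auto
    then have "t (M aR a b) = 1" "t (M aR b c) = 1" using step I by blast+
    then show ?case using I am bc by blast
  qed
  then show ?thesis using I am unfolding t_def[symmetric] by blast
qed

section \<open>Selection of one pair for each strong umodule\<close>

definition fill_clo :: cmd where
  "fill_clo = loop rV rN (Cond (Eq (V rV) (V rY)) (Put aI (V rV) (N 0) (N 1))
     (Cond (Eq (At aR (V rL) (V rV)) (N 1)) (Put aI (V rV) (N 0) (N 1))
        (Put aI (V rV) (N 0) (N 0))))"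

definition test_clo :: cmd where
  "test_clo = loop rU rN (Cond (Eq (At aI (V rU) (N 0)) (N 1))
     (Cond (Lt (V rU) (V rY)) (Set rF (N 0)) Nop ;; Set rW (V rU) ;; agree_prog ;;
      Cond (Eq (V rOk) (N 0)) (Set rF (N 0)) Nop) Nop)"

definition test_first :: cmd where
  "test_first = loop rU rN (Cond (Conj (Lt (V rU) (V rL))
     (Conj (Eq (At aR (V rL) (V rU)) (N 1)) (Eq (At aR (V rU) (V rL)) (N 1))))
     (Set rF (N 0)) Nop)"

definition store_node :: cmd where
  "store_node = loop rV rN (Put aS (V rK) (V rV) (At aI (V rV) (N 0)))"

definition select_prog :: cmd where
  "select_prog = fill_clo ;; Set rF (N 1) ;; Set rQ (V rY) ;; test_clo ;; test_first ;;
     Cond (Eq (V rF) (N 1)) (store_node ;; Inc rK) Nop"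

definition nodes_prog :: cmd where
  "nodes_prog = Set rK (N 0) ;; loop rY rN (edge_prog ;; warshall_prog ;; loop rL rN select_prog)"

lemma fill_clo_simps [simp]:
  "wr fill_clo l \<longleftrightarrow> l = G rV \<or> (\<exists>x y. l = M aI x y)" "wfc fill_clo" "depth fill_clo = 1"
  by (auto simp: fill_clo_def)

lemma test_clo_simps [simp]:
  "wr test_clo l \<longleftrightarrow> l \<in> {G rU, G rF, G rW, G rZ, G rOk} \<or>
     (\<exists>x y. l = M aFA x y) \<or> (\<exists>x y. l = M aFB x y)" "wfc test_clo" "depth test_clo = 2"
  by (auto simp: test_clo_def)

lemma test_first_simps [simp]:
  "wr test_first l \<longleftrightarrow> l = G rU \<or> l = G rF" "wfc test_first" "depth test_first = 1"
  by (auto simp: test_first_def)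

lemma store_node_simps [simp]:
  "wr store_node l \<longleftrightarrow> l = G rV \<or> (\<exists>x y. l = M aS x y)" "wfc store_node" "depth store_node = 1"
  by (auto simp: store_node_def)

lemma select_prog_simps [simp]:
  "wr select_prog l \<longleftrightarrow> l \<in> {G rV, G rF, G rQ, G rU, G rW, G rZ, G rOk, G rK} \<or>
     (\<exists>x y. l = M aI x y) \<or> (\<exists>x y. l = M aFA x y) \<or> (\<exists>x y. l = M aFB x y) \<or> (\<exists>x y. l = M aS x y)"
  "wfc select_prog" "depth select_prog = 2"
  by (auto simp: select_prog_def)

lemma nodes_prog_simps [simp]:
  "wfc nodes_prog" "depth nodes_prog = 4"
  "wr nodes_prog l \<longleftrightarrow> l \<in> {G rV, G rF, G rQ, G rU, G rW, G rZ, G rOk, G rK, G rX, G rM, G rA, G rI, G rL, G rY} \<or>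
     (\<exists>x y. l = M aI x y) \<or> (\<exists>x y. l = M aFA x y) \<or> (\<exists>x y. l = M aFB x y) \<or> (\<exists>x y. l = M aS x y) \<or>
     (\<exists>x y. l = M aR x y)"
  by (auto simp: nodes_prog_def)

lemma run_fill_clo:
  assumes "s (G rN) = n" "n \<le> B"
  shows "\<forall>v<n. run B fill_clo s (M aI v 0) =
    (if v = s (G rY) \<or> s (M aR (s (G rL)) v) = 1 then 1 else 0)"
proof -
  let ?I = "\<lambda>i t. \<forall>v<i. t (M aI v 0) = (if v = s (G rY) \<or> s (M aR (s (G rL)) v) = 1 then 1 else 0)"
  have "?I n (run B fill_clo s)"
    unfolding fill_clo_def
  proof (rule loop_rule[where I = ?I], goal_cases)
    case (8 i t)
    then show ?case by (auto simp: less_Suc_eq)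
  qed (use assms in auto)
  then show ?thesis by simp
qed

lemma run_test_clo:
  assumes "s (G rN) = n" "n \<le> B" "s (G rY) = y" "s (G rQ) = y" "s (G rF) = 1"
    and A: "\<And>v. v < n \<Longrightarrow> s (M aI v 0) = (if v \<in> A then 1 else 0)"
  shows "run B test_clo s (G rF) =
    (if \<forall>u<n. u \<in> A \<longrightarrow> y \<le> u \<and> agree n (mat s aL) A y u then 1 else 0)"
proof -
  let ?I = "\<lambda>i t. t (G rF) =
    (if \<forall>u<i. u \<in> A \<longrightarrow> y \<le> u \<and> agree n (mat s aL) A y u then 1 else 0)"
  have "?I n (run B test_clo s)"
    unfolding test_clo_def
  proof (rule loop_rule[where I = ?I], goal_cases)
    case (8 i t)
    have fr: "t (G rN) = n" "t (G rY) = y" "t (G rQ) = y" "mat t aL = mat s aL"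
      "\<And>v. v < n \<Longrightarrow> t (M aI v 0) = (if v \<in> A then 1 else 0)"
      using 8(3) assms by (auto intro!: ext)
    define t1 where "t1 = (if i < y then t(G rF := 0) else t)(G rW := i)"
    have t1: "t1 (G rN) = n" using fr by (simp add: t1_def)
    have "run B agree_prog t1 (G rOk) = (if agree n (mat s aL) A y i then 1 else 0)"
    proof -
      have "agree n (mat s aL) {v. t1 (M aI v 0) \<noteq> 0} y i = agree n (mat s aL) A y i"
        using fr by (intro agree_cong) (auto simp: t1_def)
      moreover have "mat t1 aL = mat s aL" "t1 (G rQ) = y" "t1 (G rW) = i"
        using fr by (auto simp: t1_def)
      ultimately show ?thesis using run_agree_prog[of t1 n B, OF t1 assms(2)] by simp
    qed
    moreover have "run B (Set rW (V rU)) (run B (Cond (Lt (V rU) (V rY)) (Set rF (N 0)) Nop) t) = t1"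
      using fr 8(2) by (auto simp: t1_def)
    moreover have "run B agree_prog t1 (G rF) = (if i < y then 0 else t (G rF))"
      by (simp add: t1_def)
    ultimately show ?case using 8(1,2,4) fr by (auto simp: less_Suc_eq)
  qed (use assms in auto)
  then show ?thesis by simp
qed

lemma run_test_first:
  assumes "s (G rN) = n" "n \<le> B" "s (G rL) = z" "z < n"
  shows "run B test_first s (G rF) =
    (if \<exists>u<z. s (M aR z u) = 1 \<and> s (M aR u z) = 1 then 0 else s (G rF))"
proof -
  let ?I = "\<lambda>i t. t (G rF) =
    (if \<exists>u<i. u < z \<and> s (M aR z u) = 1 \<and> s (M aR u z) = 1 then 0 else s (G rF))"
  have "?I n (run B test_first s)"
    unfolding test_first_def
  proof (rule loop_rule[where I = ?I], goal_cases)
    case (8 i t)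
    have "t (G rL) = z" using 8(3) assms by simp
    then show ?case using 8 by (auto simp: less_Suc_eq)
  qed (use assms in auto)
  then show ?thesis using assms(4) by (auto dest: less_trans)
qed

lemma run_store_node:
  assumes "s (G rN) = n" "n \<le> B" "s (G rK) = k"
  defines "t \<equiv> run B store_node s"
  shows "(\<forall>v<n. t (M aS k v) = s (M aI v 0)) \<and> (\<forall>i v. i \<noteq> k \<longrightarrow> t (M aS i v) = s (M aS i v))"
proof -
  let ?I = "\<lambda>i t. (\<forall>v<i. t (M aS k v) = s (M aI v 0)) \<and>
    (\<forall>i v. i \<noteq> k \<longrightarrow> t (M aS i v) = s (M aS i v))"
  have "?I n t"
    unfolding t_def store_node_def
  proof (rule loop_rule[where I = ?I], goal_cases)
    case (8 i t)
    have "t (G rK) = k" using 8(3) assms by simp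
    then show ?case using 8 by (auto simp: less_Suc_eq)
  qed (use assms in auto)
  then show ?thesis by simp
qed

definition stored :: "nat \<Rightarrow> store \<Rightarrow> nat set list \<Rightarrow> bool" where
  "stored n s L \<longleftrightarrow> s (G rK) = length L \<and>
     (\<forall>i<length L. \<forall>v<n. s (M aS i v) = (if v \<in> L ! i then 1 else 0))"

lemma run_select_prog:
  assumes n: "s (G rN) = n" "n \<le> B" and y: "s (G rY) = y" "y < n" and z: "s (G rL) = z" "z < n"
    and R: "\<And>a m. a < n \<Longrightarrow> m < n \<Longrightarrow> s (M aR a m) = 1 \<longleftrightarrow> (a, m) \<in> (graph n c y)\<^sup>*"
    and L: "stored n s L"
  shows "stored n (run B select_prog s)
    (if node_ok n (mat s aL) c y z then L @ [clo n c y z] else L)"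
proof -
  let ?A = "clo n c y z"
  define s1 where "s1 = (run B fill_clo s)(G rF := 1, G rQ := y)"
  have A: "s1 (M aI v 0) = (if v \<in> ?A then 1 else 0)" if "v < n" for v
    using run_fill_clo[of s n B, OF n] that R y z by (simp add: s1_def clo_def)
  have fr1: "s1 (G rN) = n" "s1 (G rY) = y" "s1 (G rQ) = y" "s1 (G rF) = 1"
    using n y by (auto simp: s1_def)
  have fr1': "mat s1 aL = mat s aL" by (auto simp: s1_def intro!: ext)
  define s2 where "s2 = run B test_clo s1"
  have F2: "s2 (G rF) = (if \<forall>u<n. u \<in> ?A \<longrightarrow> y \<le> u \<and> agree n (mat s aL) ?A y u then 1 else 0)"
    using run_test_clo[of s1 n B y ?A, OF fr1(1) n(2) fr1(2-4) A] fr1' by (simp add: s2_def)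
  define s3 where "s3 = run B test_first s2"
  have fr2: "s2 (G rN) = n" "s2 (G rL) = z" using n z by (auto simp: s2_def s1_def)
  have R2: "s2 (M aR a m) = s (M aR a m)" for a m by (auto simp: s2_def s1_def)
  have "?A \<subseteq> {..<n}" using clo_closed[OF y(2) z(2)] by (rule sep_closed_subset)
  then have F2': "s2 (G rF) = (if \<forall>u\<in>?A. y \<le> u \<and> agree n (mat s aL) ?A y u then 1 else 0)"
    using F2 by auto
  have F3: "s3 (G rF) = (if node_ok n (mat s aL) c y z then 1 else 0)"
  proof -
    have "s2 (M aR z u) = 1 \<and> s2 (M aR u z) = 1 \<longleftrightarrow>
      (z, u) \<in> (graph n c y)\<^sup>* \<and> (u, z) \<in> (graph n c y)\<^sup>*" if "u < z" for u
      using R[of z u] R[of u z] R2 z(2) that by simp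
    then have "(\<exists>u<z. s2 (M aR z u) = 1 \<and> s2 (M aR u z) = 1) \<longleftrightarrow>
      (\<exists>u<z. (z, u) \<in> (graph n c y)\<^sup>* \<and> (u, z) \<in> (graph n c y)\<^sup>*)" by blast
    then show ?thesis
      using run_test_first[of s2 n B z, OF fr2(1) n(2) fr2(2) z(2)] F2'
      by (auto simp: s3_def node_ok_def)
  qed
  have fr3: "s3 (G rN) = n" "s3 (G rK) = length L" "\<And>v. s3 (M aI v 0) = s1 (M aI v 0)"
    "\<And>i v. s3 (M aS i v) = s (M aS i v)"
    using n L by (auto simp: s3_def s2_def s1_def stored_def)
  have r: "run B select_prog s =
    (if s3 (G rF) = 1 then run B (Inc rK) (run B store_node s3) else s3)"
    using y by (simp add: select_prog_def s3_def s2_def s1_def)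
  show ?thesis
  proof (cases "node_ok n (mat s aL) c y z")
    case True
    have "stored n (run B (Inc rK) (run B store_node s3)) (L @ [?A])"
      using run_store_node[of s3 n B "length L", OF fr3(1) n(2) fr3(2)] L fr3 A
      by (auto simp: stored_def less_Suc_eq nth_append)
    then show ?thesis using True F3 r by simp
  next
    case False
    then show ?thesis using F3 r L fr3 by (simp add: stored_def)
  qed
qed

definition row_nodes ::
  "nat \<Rightarrow> (nat \<Rightarrow> nat \<Rightarrow> nat) \<Rightarrow> (nat \<Rightarrow> nat \<Rightarrow> nat) \<Rightarrow> nat \<Rightarrow> nat \<Rightarrow> nat set list" where
  "row_nodes n lab c y m = map (clo n c y) (filter (node_ok n lab c y) [0..<m])"

definition all_nodes ::
  "nat \<Rightarrow> (nat \<Rightarrow> nat \<Rightarrow> nat) \<Rightarrow> (nat \<Rightarrow> nat \<Rightarrow> nat) \<Rightarrow> nat \<Rightarrow> nat set list" where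
  "all_nodes n lab c m = concat (map (\<lambda>y. row_nodes n lab c y n) [0..<m])"

lemma set_all_nodes:
  "set (all_nodes n lab c m) = {clo n c y z |y z. y < m \<and> z < n \<and> node_ok n lab c y z}"
  by (auto simp: all_nodes_def row_nodes_def) blast

lemma distinct_all_nodes: "distinct (all_nodes n lab c m)"
proof (induction m)
  case (Suc m)
  have "distinct (row_nodes n lab c m n)"
    unfolding row_nodes_def distinct_map by (auto intro!: inj_onI dest: node_ok_inj)
  moreover have "set (row_nodes n lab c m n) \<inter> set (all_nodes n lab c m) = {}"
    by (auto simp: set_all_nodes row_nodes_def) (metis node_ok_inj less_irrefl)
  ultimately show ?case using Suc by (auto simp: all_nodes_def)
qed (simp add: all_nodes_def)

lemma run_nodes_prog:
  assumes n: "s (G rN) = n" "n \<le> B"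
  shows "stored n (run B nodes_prog s) (all_nodes n (mat s aL) (mat s aC) n)"
proof -
  let ?lab = "mat s aL" and ?c = "mat s aC"
  define s0 where "s0 = s(G rK := 0)"
  let ?I = "\<lambda>i t. stored n t (all_nodes n ?lab ?c i)"
  have "?I n (run B (loop rY rN (edge_prog ;; warshall_prog ;; loop rL rN select_prog)) s0)"
  proof (rule loop_rule[where I = ?I], goal_cases)
    case (8 y t)
    have fr: "t (G rN) = n" "mat t aL = ?lab" "mat t aC = ?c"
      using 8(3) n by (auto simp: s0_def intro!: ext)
    define t1 where "t1 = run B edge_prog t"
    have t1: "t1 (M aR a m) = 1 \<longleftrightarrow> a = m \<or> (a, m) \<in> graph n ?c y" if "a < n" "m < n" for a m
      using run_edge_prog[of t n B y, OF fr(1) n(2) 8(2)] that fr by (auto simp: t1_def graph_def)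
    have fr1: "t1 (G rN) = n" using fr by (simp add: t1_def)
    define t2 where "t2 = run B warshall_prog t1"
    have g: "graph n ?c y \<subseteq> {..<n} \<times> {..<n}" by (auto simp: graph_def)
    have t2: "t2 (M aR a m) = 1 \<longleftrightarrow> (a, m) \<in> (graph n ?c y)\<^sup>*" if "a < n" "m < n" for a m
      using run_warshall_prog[of t1 n B, OF fr1 n(2) g t1 that] by (simp add: t2_def)
    have fr2: "t2 (G rN) = n" "t2 (G rY) = y" "mat t2 aL = ?lab"
      using fr 8(2) by (auto simp: t2_def t1_def intro!: ext)
    have st: "stored n t2 (all_nodes n ?lab ?c y)"
      using 8(4) by (simp add: stored_def t2_def t1_def)
    let ?J = "\<lambda>i t. stored n t (all_nodes n ?lab ?c y @ row_nodes n ?lab ?c y i)"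
    have "?J n (run B (loop rL rN select_prog) t2)"
    proof (rule loop_rule[where I = ?J], goal_cases)
      case (8 z t')
      have fr3: "t' (G rN) = n" "t' (G rY) = y" "mat t' aL = ?lab"
        using 8(3) fr2 by (auto intro!: ext)
      have R3: "t' (M aR a m) = 1 \<longleftrightarrow> (a, m) \<in> (graph n ?c y)\<^sup>*" if "a < n" "m < n" for a m
        using t2[OF that] 8(3) by simp
      show ?case
        using run_select_prog[of t' n B y z ?c, OF fr3(1) n(2) fr3(2) \<open>y < n\<close> 8(2,1) R3 8(4)] fr3(3)
        by (simp add: row_nodes_def split: if_splits)
    qed (use fr2 n st in \<open>auto simp: stored_def row_nodes_def\<close>)
    then show ?case by (simp add: t1_def t2_def all_nodes_def)
  qed (use n in \<open>auto simp: s0_def stored_def all_nodes_def\<close>)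
  then show ?thesis by (simp add: nodes_prog_def s0_def)
qed

section \<open>Reading the input and writing the tree\<close>

definition tape_at :: "store \<Rightarrow> nat \<Rightarrow> nat list \<Rightarrow> bool" where
  "tape_at s p ws \<longleftrightarrow> (\<forall>i<length ws. s (Tp (p + i)) = ws ! i)"

lemma tape_at_Nil [simp]: "tape_at s p []"
  by (simp add: tape_at_def)

lemma tape_at_Cons [simp]: "tape_at s p (w # ws) \<longleftrightarrow> s (Tp p) = w \<and> tape_at s (Suc p) ws"
  unfolding tape_at_def by (auto simp: less_Suc_eq_0_disj)

lemma tape_at_append [simp]:
  "tape_at s p (us @ ws) \<longleftrightarrow> tape_at s p us \<and> tape_at s (p + length us) ws"
  by (induction us arbitrary: p) auto

lemma tape_at_upd [simp]: "tape_at (s(G r := v)) p ws = tape_at s p ws"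
  by (simp add: tape_at_def)

lemma tape_at_cong:
  assumes "\<And>i. i < length ws \<Longrightarrow> t (Tp (p + i)) = s (Tp (p + i))"
  shows "tape_at t p ws = tape_at s p ws"
  using assms by (simp add: tape_at_def)

lemma tape_at_concat:
  assumes "tape_at s p (concat xs)" "j < length xs"
  shows "tape_at s (p + length (concat (take j xs))) (xs ! j)"
proof -
  have "concat xs = concat (take j xs) @ xs ! j @ concat (drop (Suc j) xs)"
    using arg_cong[OF id_take_nth_drop[OF assms(2)], of concat] by simp
  then show ?thesis using assms(1) by simp
qed

lemma concat_take_Suc: "j < length xs \<Longrightarrow> concat (take (Suc j) xs) = concat (take j xs) @ xs ! j"
  by (simp add: take_Suc_conv_app_nth)

section \<open>From the listed partitions to class labels\<close>

definition parse_class :: cmd where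
  "parse_class = loop rL rF (Set rV (Tape (V rP)) ;; Inc rP ;; Put aL (V rI) (V rV) (V rA))"

definition parse_family :: cmd where
  "parse_family = Set rM (Tape (V rP)) ;; Inc rP ;;
     loop rA rM (Set rF (Tape (V rP)) ;; Inc rP ;; parse_class)"

definition parse_prog :: cmd where
  "parse_prog = Set rN (Tape (N 0)) ;; Set rP (N 1) ;; loop rI rN parse_family"

lemma parse_class_simps [simp]:
  "wr parse_class l \<longleftrightarrow> l \<in> {G rL, G rV, G rP} \<or> (\<exists>x y. l = M aL x y)"
  "wfc parse_class" "depth parse_class = 1"
  by (auto simp: parse_class_def)

lemma parse_family_simps [simp]:
  "wr parse_family l \<longleftrightarrow> l \<in> {G rL, G rV, G rP, G rM, G rA, G rF} \<or> (\<exists>x y. l = M aL x y)"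
  "wfc parse_family" "depth parse_family = 2"
  by (auto simp: parse_family_def)

lemma parse_prog_simps [simp]:
  "wr parse_prog l \<longleftrightarrow> l \<in> {G rL, G rV, G rP, G rM, G rA, G rF, G rI, G rN} \<or> (\<exists>x y. l = M aL x y)"
  "wfc parse_prog" "depth parse_prog = 3"
  by (auto simp: parse_prog_def)

lemma run_parse_class:
  assumes "s (G rF) = length c" "length c \<le> B" "tape_at s (s (G rP)) c"
  defines "t \<equiv> run B parse_class s"
  shows "t (G rP) = s (G rP) + length c \<and> (\<forall>i v. t (M aL i v) =
    (if i = s (G rI) \<and> v \<in> set c then s (G rA) else s (M aL i v)))"
proof -
  let ?I = "\<lambda>l t. t (G rP) = s (G rP) + l \<and> (\<forall>i v. t (M aL i v) =
    (if i = s (G rI) \<and> v \<in> set (take l c) then s (G rA) else s (M aL i v)))"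
  have "?I (length c) t"
    unfolding t_def parse_class_def
  proof (rule loop_rule[where I = ?I], goal_cases)
    case (8 l t)
    have fr: "t (G rI) = s (G rI)" "t (G rA) = s (G rA)" "\<And>a. t (Tp a) = s (Tp a)"
      using 8(3) by auto
    have "s (Tp (s (G rP) + l)) = c ! l" using assms(3) 8(1) by (simp add: tape_at_def)
    then show ?case using 8(1,4) fr by (auto simp: take_Suc_conv_app_nth)
  qed (use assms in auto)
  then show ?thesis by simp
qed

definition disjoint_classes :: "nat list list \<Rightarrow> bool" where
  "disjoint_classes fam \<longleftrightarrow>
     (\<forall>j<length fam. \<forall>j'<length fam. j \<noteq> j' \<longrightarrow> set (fam ! j) \<inter> set (fam ! j') = {})"

lemma run_parse_family:
  assumes fam: "length fam \<le> B" "\<And>c. c \<in> set fam \<Longrightarrow> length c \<le> B" "disjoint_classes fam"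
    and s: "tape_at s (s (G rP)) (encode_family fam)" "s (G rI) = i"
  defines "t \<equiv> run B parse_family s"
  shows "t (G rP) = s (G rP) + length (encode_family fam) \<and>
    (\<forall>j<length fam. \<forall>v\<in>set (fam ! j). t (M aL i v) = j) \<and>
    (\<forall>i' v. i' \<noteq> i \<longrightarrow> t (M aL i' v) = s (M aL i' v))"
proof -
  define f where "f = (\<lambda>c :: nat list. length c # c)"
  define p where "p = Suc (s (G rP))"
  define s1 where "s1 = s(G rM := length fam, G rP := p)"
  have tp: "tape_at s p (concat (map f fam))" and M: "s (Tp (s (G rP))) = length fam"
    using s(1) by (simp_all add: encode_family_def f_def p_def)
  let ?I = "\<lambda>j t. t (G rP) = p + length (concat (take j (map f fam))) \<and>
    (\<forall>j'<j. \<forall>v\<in>set (fam ! j'). t (M aL i v) = j') \<and>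
    (\<forall>i' v. i' \<noteq> i \<longrightarrow> t (M aL i' v) = s (M aL i' v))"
  have "?I (length fam) (run B (loop rA rM (Set rF (Tape (V rP)) ;; Inc rP ;; parse_class)) s1)"
  proof (rule loop_rule[where I = ?I], goal_cases)
    case (8 j t)
    let ?q = "p + length (concat (take j (map f fam)))"
    have fr: "t (G rI) = i" "\<And>a. t (Tp a) = s (Tp a)"
      using 8(3) s by (auto simp: s1_def)
    have "tape_at s ?q (f (fam ! j))"
      using tape_at_concat[OF tp, of j] 8(1) by simp
    then have tq: "s (Tp ?q) = length (fam ! j)" "tape_at s (Suc ?q) (fam ! j)"
      by (simp_all add: f_def)
    define t1 where "t1 = t(G rF := length (fam ! j), G rP := Suc ?q)"
    have t1: "run B (Inc rP) (run B (Set rF (Tape (V rP))) t) = t1"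
      using tq 8(4) fr by (simp add: t1_def fun_upd_twist)
    have tt: "tape_at t1 (t1 (G rP)) (fam ! j)"
      using tq(2) fr by (simp add: t1_def tape_at_def)
    have lc: "length (fam ! j) \<le> B" using fam(2) 8(1) by simp
    have r: "run B parse_class t1 (G rP) = Suc ?q + length (fam ! j)"
      "\<And>i' v. run B parse_class t1 (M aL i' v) =
        (if i' = i \<and> v \<in> set (fam ! j) then j else t (M aL i' v))"
      using run_parse_class[of t1 "fam ! j" B, OF _ lc tt] fr 8(2) by (simp_all add: t1_def)
    \<comment> \<open>The label of an element is the position of its class; disjointness keeps later
      classes from overwriting labels already assigned.\<close>
    have dj: "v \<notin> set (fam ! j)" if "j' < j" "v \<in> set (fam ! j')" for j' v
    proof -
      have "j' < length fam" "j' \<noteq> j" using that 8(1) by auto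
      then show ?thesis using fam(3) that 8(1) unfolding disjoint_classes_def by blast
    qed
    have len: "?q + Suc (length (fam ! j)) = p + length (concat (take (Suc j) (map f fam)))"
      using 8(1) by (subst concat_take_Suc) (auto simp: f_def)
    have "?I (Suc j) (run B parse_class t1)"
    proof (intro conjI allI impI ballI)
      show "run B parse_class t1 (G rP) = p + length (concat (take (Suc j) (map f fam)))"
        using r(1) len by simp
      show "run B parse_class t1 (M aL i v) = j'" if "j' < Suc j" "v \<in> set (fam ! j')" for j' v
        using that r(2) 8(4) dj by (auto simp: less_Suc_eq)
      show "run B parse_class t1 (M aL i' v) = s (M aL i' v)" if "i' \<noteq> i" for i' v
        using that r(2) 8(4) by simp
    qed
    then show ?case unfolding run.simps(6) t1 .
  qed (use fam s in \<open>auto simp: s1_def\<close>)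
  moreover have "t = run B (loop rA rM (Set rF (Tape (V rP)) ;; Inc rP ;; parse_class)) s1"
    by (simp add: t_def parse_family_def s1_def M p_def fun_upd_twist)
  moreover have "length (encode_family fam) = Suc (length (concat (map f fam)))"
    by (simp add: encode_family_def f_def)
  ultimately show ?thesis by (simp add: p_def)
qed

lemma run_parse_prog:
  assumes ps: "length ps \<le> B" "\<And>fam. fam \<in> set ps \<Longrightarrow> length fam \<le> B \<and> disjoint_classes fam"
    "\<And>fam c. fam \<in> set ps \<Longrightarrow> c \<in> set fam \<Longrightarrow> length c \<le> B"
    and s: "tape_at s 0 (encode_relation ps)"
  defines "t \<equiv> run B parse_prog s"
  shows "t (G rN) = length ps \<and>
    (\<forall>i<length ps. \<forall>j<length (ps ! i). \<forall>v\<in>set (ps ! i ! j). t (M aL i v) = j)"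
proof -
  define s1 where "s1 = s(G rN := length ps, G rP := 1)"
  have N: "s (Tp 0) = length ps" and tp: "tape_at s 1 (concat (map encode_family ps))"
    using s by (simp_all add: encode_relation_def)
  let ?I = "\<lambda>i t. t (G rP) = 1 + length (concat (take i (map encode_family ps))) \<and>
    (\<forall>i'<i. \<forall>j<length (ps ! i'). \<forall>v\<in>set (ps ! i' ! j). t (M aL i' v) = j)"
  have "?I (length ps) (run B (loop rI rN parse_family) s1)"
  proof (rule loop_rule[where I = ?I], goal_cases)
    case (8 i t)
    let ?q = "1 + length (concat (take i (map encode_family ps)))"
    have fr: "\<And>a. t (Tp a) = s (Tp a)" using 8(3) by (simp add: s1_def)
    have q: "t (G rP) = ?q" using 8(4) by simp
    have "tape_at s ?q (encode_family (ps ! i))"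
      using tape_at_concat[OF tp, of i] 8(1) by simp
    then have tq: "tape_at t (t (G rP)) (encode_family (ps ! i))"
      using fr q by (simp add: tape_at_def)
    have fam: "ps ! i \<in> set ps" using 8(1) by simp
    have r: "run B parse_family t (G rP) = ?q + length (encode_family (ps ! i))"
      "\<forall>j<length (ps ! i). \<forall>v\<in>set (ps ! i ! j). run B parse_family t (M aL i v) = j"
      "\<forall>i' v. i' \<noteq> i \<longrightarrow> run B parse_family t (M aL i' v) = t (M aL i' v)"
      using run_parse_family[of "ps ! i" B t i, OF _ _ _ tq 8(2)] ps(2,3)[OF fam] q by auto
    have "?q + length (encode_family (ps ! i)) = 1 + length (concat (take (Suc i) (map encode_family ps)))"
      using 8(1) by (subst concat_take_Suc) auto
    then show ?case using r 8(4) by (auto simp: less_Suc_eq)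
  qed (use ps in \<open>auto simp: s1_def\<close>)
  moreover have "t = run B (loop rI rN parse_family) s1"
    by (simp add: t_def parse_prog_def s1_def N)
  ultimately show ?thesis by (simp add: s1_def)
qed

text \<open>The length precedes the elements on the tape but is known only after them, so its cell
  is skipped and filled in at the end.\<close>

definition out_set :: cmd where
  "out_set = Set rQ (V rP) ;; Inc rP ;; Set rW (N 0) ;;
     loop rV rN (Cond (Eq (At aS (V rI) (V rV)) (N 1))
       (Write (V rP) (V rV) ;; Inc rP ;; Inc rW) Nop) ;;
     Write (V rQ) (V rW) ;; Put aZ (V rI) (N 0) (V rW)"

definition out_sets :: cmd where
  "out_sets = Write (N 0) (V rK) ;; Set rP (N 1) ;; loop rI rK out_set"

lemma out_set_simps [simp]:
  "wr out_set l \<longleftrightarrow> l \<in> {G rQ, G rP, G rW, G rV} \<or> (\<exists>x. l = Tp x) \<or> (\<exists>x y. l = M aZ x y)"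
  "wfc out_set" "depth out_set = 1"
  by (auto simp: out_set_def)

lemma out_sets_simps [simp]:
  "wr out_sets l \<longleftrightarrow> l \<in> {G rQ, G rP, G rW, G rV, G rI} \<or> (\<exists>x. l = Tp x) \<or> (\<exists>x y. l = M aZ x y)"
  "wfc out_sets" "depth out_sets = 2"
  by (auto simp: out_sets_def)

definition elements :: "nat \<Rightarrow> nat set \<Rightarrow> nat list" where
  "elements n A = filter (\<lambda>v. v \<in> A) [0..<n]"

lemma run_out_set:
  assumes "s (G rN) = n" "n \<le> B" "s (G rI) = i"
    and A: "\<And>v. v < n \<Longrightarrow> s (M aS i v) = (if v \<in> A then 1 else 0)"
  defines "t \<equiv> run B out_set s" and "p \<equiv> s (G rP)" and "c \<equiv> elements n A"
  shows "t (G rP) = p + Suc (length c) \<and> tape_at t p (length c # c) \<and>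
    (\<forall>a<p. t (Tp a) = s (Tp a)) \<and> t (M aZ i 0) = length c \<and>
    (\<forall>i' v. i' \<noteq> i \<longrightarrow> t (M aZ i' v) = s (M aZ i' v))"
proof -
  define s1 where "s1 = s(G rQ := p, G rP := Suc p, G rW := 0)"
  let ?I = "\<lambda>k t. t (G rP) = Suc p + length (elements k A) \<and> t (G rW) = length (elements k A) \<and>
    tape_at t (Suc p) (elements k A) \<and> (\<forall>a\<le>p. t (Tp a) = s (Tp a))"
  let ?loop = "loop rV rN (Cond (Eq (At aS (V rI) (V rV)) (N 1))
       (Write (V rP) (V rV) ;; Inc rP ;; Inc rW) Nop)"
  have I: "?I n (run B ?loop s1)"
  proof (rule loop_rule[where I = ?I], goal_cases)
    case (8 k t)
    have fr: "t (G rI) = i" "t (M aS i k) = (if k \<in> A then 1 else 0)"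
      using 8(1,3) assms(3) A by (auto simp: s1_def)
    show ?case using 8(2,4) fr
      by (auto simp: elements_def tape_at_def nth_append)
  qed (use assms(1-3) in \<open>auto simp: s1_def elements_def tape_at_def\<close>)
  define s2 where "s2 = run B ?loop s1"
  have fr2: "s2 (G rQ) = p" "s2 (G rI) = i" "\<And>i v. s2 (M aZ i v) = s (M aZ i v)"
    using assms(3) by (auto simp: s2_def s1_def)
  have t: "t = s2(Tp p := length c, M aZ i 0 := length c)"
    using I fr2 by (simp add: t_def out_set_def s1_def s2_def p_def c_def)
  have "tape_at t (Suc p) c" using I by (simp add: t tape_at_def s2_def c_def)
  then show ?thesis using I[folded s2_def] fr2 by (simp add: t c_def)
qed

lemma run_out_sets:
  assumes n: "s (G rN) = n" "n \<le> B" and L: "stored n s L" "length L \<le> B"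
  defines "t \<equiv> run B out_sets s" and "ws \<equiv> encode_family (map (elements n) L)"
  shows "t (G rP) = length ws \<and> tape_at t 0 ws \<and>
    (\<forall>i<length L. t (M aZ i 0) = length (elements n (L ! i)))"
proof -
  define f where "f = (\<lambda>A. length (elements n A) # elements n A)"
  define s1 where "s1 = s(Tp 0 := length L, G rP := 1)"
  have K: "s (G rK) = length L" using L by (simp add: stored_def)
  let ?ws = "\<lambda>i. length L # concat (take i (map f L))"
  let ?I = "\<lambda>i t. t (G rP) = length (?ws i) \<and> tape_at t 0 (?ws i) \<and>
    (\<forall>i'<i. t (M aZ i' 0) = length (elements n (L ! i')))"
  have I: "?I (length L) (run B (loop rI rK out_set) s1)"
  proof (rule loop_rule[where I = ?I], goal_cases)
    case (8 i t)
    have fr: "t (G rN) = n" "\<And>v. v < n \<Longrightarrow> t (M aS i v) = (if v \<in> L ! i then 1 else 0)"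
      using 8(1,3) n L by (auto simp: s1_def stored_def)
    define t' where "t' = run B out_set t"
    have p: "t (G rP) = length (?ws i)" using 8(4) by blast
    have r: "t' (G rP) = length (?ws i) + length (f (L ! i))"
      "tape_at t' (length (?ws i)) (f (L ! i))"
      "\<And>a. a < length (?ws i) \<Longrightarrow> t' (Tp a) = t (Tp a)"
      "t' (M aZ i 0) = length (elements n (L ! i))"
      "\<And>i'. i' \<noteq> i \<Longrightarrow> t' (M aZ i' 0) = t (M aZ i' 0)"
      using run_out_set[of t n B i "L ! i", OF fr(1) n(2) 8(2) fr(2)] unfolding t'_def[symmetric] p f_def
      by auto
    have ws: "?ws (Suc i) = ?ws i @ f (L ! i)"
      using 8(1) by (subst concat_take_Suc) auto
    have "tape_at t' 0 (?ws i)"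
      using 8(4) r(3) by (subst tape_at_cong[of _ _ _ t]) auto
    then have "tape_at t' 0 (?ws (Suc i))" unfolding ws tape_at_append using r(2) by simp
    moreover have "t' (G rP) = length (?ws (Suc i))" unfolding ws using r(1) by simp
    ultimately show ?case using r(4,5) 8(4) unfolding t'_def[symmetric]
      by (auto simp only: less_Suc_eq)
  qed (use K L in \<open>auto simp: s1_def\<close>)
  have "t = run B (loop rI rK out_set) s1"
    by (simp add: t_def out_sets_def s1_def K)
  moreover have "ws = ?ws (length L)"
    by (simp add: ws_def encode_family_def f_def comp_def)
  ultimately show ?thesis using I by simp
qed

section \<open>Parent pointers\<close>

definition subset_test :: cmd where
  "subset_test = Set rOk (N 1) ;; loop rV rN
     (Cond (Conj (Eq (At aS (V rI) (V rV)) (N 1)) (Neg (Eq (At aS (V rA) (V rV)) (N 1))))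
       (Set rOk (N 0)) Nop)"

text \<open>\<open>rQ\<close> holds the size of the best superset so far, with \<open>n + 1\<close>
  as infinity; \<open>rF\<close> starts as the node itself, the answer for a root. Comparing sizes
  first turns the inclusion test into one for strict inclusion.\<close>

definition find_parent :: cmd where
  "find_parent = Set rF (V rI) ;; Set rQ (V rN) ;; Inc rQ ;; loop rA rK
     (Cond (Conj (Lt (At aZ (V rI) (N 0)) (At aZ (V rA) (N 0))) (Lt (At aZ (V rA) (N 0)) (V rQ)))
       (subset_test ;;
        Cond (Eq (V rOk) (N 1)) (Set rF (V rA) ;; Set rQ (At aZ (V rA) (N 0))) Nop) Nop)"

definition out_parents :: cmd where
  "out_parents = loop rI rK (find_parent ;; Write (V rP) (V rF) ;; Inc rP)"

lemma subset_test_simps [simp]: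
  "wr subset_test l \<longleftrightarrow> l = G rOk \<or> l = G rV" "wfc subset_test" "depth subset_test = 1"
  by (auto simp: subset_test_def)

lemma find_parent_simps [simp]:
  "wr find_parent l \<longleftrightarrow> l \<in> {G rOk, G rV, G rF, G rQ, G rA}" "wfc find_parent" "depth find_parent = 2"
  by (auto simp: find_parent_def)

lemma out_parents_simps [simp]:
  "wr out_parents l \<longleftrightarrow> l \<in> {G rOk, G rV, G rF, G rQ, G rA, G rI, G rP} \<or> (\<exists>x. l = Tp x)"
  "wfc out_parents" "depth out_parents = 3"
  by (auto simp: out_parents_def)

lemma run_subset_test:
  assumes "s (G rN) = n" "n \<le> B" "s (G rI) = i" "s (G rA) = j"
    and A: "\<And>v. v < n \<Longrightarrow> s (M aS i v) = (if v \<in> A then 1 else 0)" "A \<subseteq> {..<n}"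
    and A': "\<And>v. v < n \<Longrightarrow> s (M aS j v) = (if v \<in> A' then 1 else 0)"
  shows "run B subset_test s (G rOk) = (if A \<subseteq> A' then 1 else 0)"
proof -
  let ?I = "\<lambda>k t. t (G rOk) = (if \<forall>v<k. v \<in> A \<longrightarrow> v \<in> A' then 1 else 0)"
  define s1 where "s1 = s(G rOk := 1)"
  have "?I n (run B (loop rV rN
     (Cond (Conj (Eq (At aS (V rI) (V rV)) (N 1)) (Neg (Eq (At aS (V rA) (V rV)) (N 1))))
       (Set rOk (N 0)) Nop)) s1)"
  proof (rule loop_rule[where I = ?I], goal_cases)
    case (8 k t)
    have fr: "t (G rI) = i" "t (G rA) = j" "t (M aS i k) = (if k \<in> A then 1 else 0)"
      "t (M aS j k) = (if k \<in> A' then 1 else 0)"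
      using 8(1,3) assms by (auto simp: s1_def)
    then show ?case using 8(2,4) by (auto simp: less_Suc_eq)
  qed (use assms in \<open>auto simp: s1_def\<close>)
  moreover have "(\<forall>v<n. v \<in> A \<longrightarrow> v \<in> A') \<longleftrightarrow> A \<subseteq> A'" using A(2) by auto
  ultimately show ?thesis by (simp add: subset_test_def s1_def)
qed

text \<open>Covering is replaced by least cardinality: a node strictly between a set and a smallest
  strict superset would itself be a smaller strict superset.\<close>

definition parent_ok :: "nat set list \<Rightarrow> nat \<Rightarrow> nat \<Rightarrow> bool" where
  "parent_ok L i r \<longleftrightarrow> (if \<exists>j<length L. L ! i \<subset> L ! j
     then r < length L \<and> L ! i \<subset> L ! r \<and>
       (\<forall>j<length L. L ! i \<subset> L ! j \<longrightarrow> card (L ! r) \<le> card (L ! j))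
     else r = i)"

lemma length_elements: "A \<subseteq> {..<n} \<Longrightarrow> length (elements n A) = card A"
proof -
  assume "A \<subseteq> {..<n}"
  then have "set (elements n A) = A" by (auto simp: elements_def)
  moreover have "distinct (elements n A)" by (simp add: elements_def)
  ultimately show ?thesis by (metis distinct_card)
qed

lemma run_find_parent:
  assumes n: "s (G rN) = n" "n \<le> B" and L: "stored n s L" "length L \<le> B"
    and sub: "\<And>A. A \<in> set L \<Longrightarrow> A \<subseteq> {..<n}"
    and Z: "\<And>j. j < length L \<Longrightarrow> s (M aZ j 0) = card (L ! j)"
    and i: "s (G rI) = i" "i < length L"
  shows "parent_ok L i (run B find_parent s (G rF))"
proof -
  define s1 where "s1 = s(G rF := i, G rQ := Suc n)"
  let ?I = "\<lambda>j t. if \<exists>j'<j. L ! i \<subset> L ! j'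
    then t (G rF) < j \<and> L ! i \<subset> L ! (t (G rF)) \<and> t (G rQ) = card (L ! (t (G rF))) \<and>
       (\<forall>j'<j. L ! i \<subset> L ! j' \<longrightarrow> card (L ! (t (G rF))) \<le> card (L ! j'))
    else t (G rF) = i \<and> t (G rQ) = Suc n"
  let ?c = "Cond (Conj (Lt (At aZ (V rI) (N 0)) (At aZ (V rA) (N 0))) (Lt (At aZ (V rA) (N 0)) (V rQ)))
       (subset_test ;;
        Cond (Eq (V rOk) (N 1)) (Set rF (V rA) ;; Set rQ (At aZ (V rA) (N 0))) Nop) Nop"
  have cd: "finite (L ! j)" "card (L ! j) \<le> n" if "j < length L" for j
  proof -
    have s: "L ! j \<subseteq> {..<n}" using sub that by simp
    then show "finite (L ! j)" by (rule finite_subset) simp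
    show "card (L ! j) \<le> n" using card_mono[OF _ s] by simp
  qed
  have K: "s (G rK) = length L" using L by (simp add: stored_def)
  have "?I (length L) (run B (loop rA rK ?c) s1)"
  proof (rule loop_rule[where I = ?I], goal_cases)
    case (8 j t)
    have fr: "t (G rN) = n" "t (G rI) = i" "t (M aZ i 0) = card (L ! i)" "t (M aZ j 0) = card (L ! j)"
      "\<And>v. v < n \<Longrightarrow> t (M aS i v) = (if v \<in> L ! i then 1 else 0)"
      "\<And>v. v < n \<Longrightarrow> t (M aS j v) = (if v \<in> L ! j then 1 else 0)"
      using 8(1,3) n L i Z by (auto simp: s1_def stored_def)
    have ok: "run B subset_test t (G rOk) = (if L ! i \<subseteq> L ! j then 1 else 0)"
      using run_subset_test[of t n B i j, OF fr(1) n(2) fr(2) 8(2) fr(5) _ fr(6)] sub i by simp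
    have ps: "L ! i \<subset> L ! j \<longleftrightarrow> L ! i \<subseteq> L ! j \<and> card (L ! i) < card (L ! j)"
      using psubset_card_mono[OF cd(1)[OF 8(1)], of "L ! i"] by (auto simp: psubset_eq)
    have step: "run B ?c t = (if L ! i \<subset> L ! j \<and> card (L ! j) < t (G rQ)
      then (run B subset_test t)(G rF := j, G rQ := card (L ! j))
      else if card (L ! i) < card (L ! j) \<and> card (L ! j) < t (G rQ) then run B subset_test t else t)"
      using fr ok ps 8(2) by auto
    show ?case
    proof (cases "L ! i \<subset> L ! j \<and> card (L ! j) < t (G rQ)")
      case True
      then have "\<forall>j'<j. L ! i \<subset> L ! j' \<longrightarrow> card (L ! j) \<le> card (L ! j')"
        using 8(4) by (auto split: if_splits)
      then show ?thesis using True by (subst (1 2 3 4 5 6 7) step) (auto simp: less_Suc_eq)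
    next
      case False
      have "run B ?c t (G rF) = t (G rF)" "run B ?c t (G rQ) = t (G rQ)"
        using False by (auto simp only: step if_False split: if_splits) auto
      moreover have "t (G rQ) \<le> card (L ! j)" if "L ! i \<subset> L ! j"
        using that False by simp
      ultimately show ?thesis using 8(4) cd(2)[OF 8(1)]
        by (auto simp: less_Suc_eq simp del: run.simps split: if_splits)
    qed
  qed (use K L i in \<open>auto simp: s1_def\<close>)
  moreover have "run B find_parent s = run B (loop rA rK ?c) s1"
    using n i by (simp add: find_parent_def s1_def)
  ultimately show ?thesis by (auto simp: parent_ok_def split: if_splits)
qed

lemma run_out_parents:
  assumes n: "s (G rN) = n" "n \<le> B" and L: "stored n s L" "length L \<le> B"
    and sub: "\<And>A. A \<in> set L \<Longrightarrow> A \<subseteq> {..<n}"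
    and Z: "\<And>j. j < length L \<Longrightarrow> s (M aZ j 0) = card (L ! j)"
    and ws: "tape_at s 0 ws" "s (G rP) = length ws"
  shows "\<exists>par. length par = length L \<and> (\<forall>i<length L. parent_ok L i (par ! i)) \<and>
    tape_at (run B out_parents s) 0 (ws @ par) \<and>
    run B out_parents s (G rP) = length (ws @ par)"
proof -
  let ?I = "\<lambda>i t. \<exists>par. length par = i \<and> (\<forall>i'<i. parent_ok L i' (par ! i')) \<and>
    tape_at t 0 (ws @ par) \<and> t (G rP) = length (ws @ par)"
  have K: "s (G rK) = length L" using L by (simp add: stored_def)
  have "?I (length L) (run B out_parents s)"
    unfolding out_parents_def
  proof (rule loop_rule[where I = ?I], goal_cases)
    case (8 i t)
    obtain par where par: "length par = i" "\<forall>i'<i. parent_ok L i' (par ! i')"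
      "tape_at t 0 (ws @ par)" "t (G rP) = length (ws @ par)" using 8(4) by blast
    have fr: "t (G rN) = n" "stored n t L" "\<And>j. j < length L \<Longrightarrow> t (M aZ j 0) = card (L ! j)"
      using 8(3) n L Z by (auto simp: stored_def)
    define r where "r = run B find_parent t (G rF)"
    have r: "parent_ok L i r"
      using run_find_parent[of t n B L i, OF fr(1) n(2) fr(2) L(2) sub fr(3) 8(2,1)]
      by (simp add: r_def)
    define t' where "t' = run B (find_parent ;; Write (V rP) (V rF) ;; Inc rP) t"
    have P: "t' (G rP) = length (ws @ par @ [r])" "t' (Tp (length (ws @ par))) = r"
      "\<And>a. a < length (ws @ par) \<Longrightarrow> t' (Tp a) = t (Tp a)"
      using par(4) by (simp_all add: t'_def r_def)
    have "tape_at t' 0 (ws @ par)"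
      using par(3) P(3) by (subst tape_at_cong[of _ _ _ t]) auto
    then have "tape_at t' 0 (ws @ par @ [r])" using P(2) by simp
    then have "length (par @ [r]) = Suc i \<and> (\<forall>i'<Suc i. parent_ok L i' ((par @ [r]) ! i')) \<and>
      tape_at t' 0 (ws @ par @ [r]) \<and> t' (G rP) = length (ws @ par @ [r])"
      using par(1,2) P(1) r by (auto simp: nth_append less_Suc_eq)
    then show ?case unfolding t'_def by blast
  qed (use K L ws in \<open>auto simp: tape_at_def\<close>)
  then show ?thesis by blast
qed

section \<open>Correctness of the whole program\<close>

definition main_prog :: cmd where
  "main_prog = parse_prog ;; partition_prog ;; nodes_prog ;; out_sets ;; out_parents"

lemma main_prog_simps [simp]: "wfc main_prog" "depth main_prog = 4"
  by (auto simp: main_prog_def)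

text \<open>\<open>lab\<close> is existential because the labels are class positions and depend on
  the listing \<open>ps\<close>. The bound on \<open>B\<close> enters through
  \<open>laminar_card\<close>: loops over the nodes need as many rounds as there are nodes.\<close>

lemma run_main_prog:
  assumes B: "2 * n \<le> B" and ps: "length ps = n"
    and fam: "\<And>fam. fam \<in> set ps \<Longrightarrow> length fam \<le> n \<and> disjoint_classes fam"
      "\<And>fam c. fam \<in> set ps \<Longrightarrow> c \<in> set fam \<Longrightarrow> length c \<le> n"
    and s: "tape_at s 0 (encode_relation ps)"
  defines "t \<equiv> run B main_prog s"
  shows "\<exists>lab L par.
    (\<forall>i<n. \<forall>j<length (ps ! i). \<forall>v\<in>set (ps ! i ! j). lab i v = j) \<and>
    distinct L \<and> set L = {U. strong n lab U \<and> U \<noteq> {}} \<and>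
    length par = length L \<and> (\<forall>i<length L. parent_ok L i (par ! i)) \<and>
    tape_at t 0 (encode_tree (map (elements n) L) par) \<and>
    t (G rP) = length (encode_tree (map (elements n) L) par)"
proof -
  have nB: "n \<le> B" using B by simp
  define s1 where "s1 = run B parse_prog s"
  define lab where "lab = mat s1 aL"
  have s1: "s1 (G rN) = n" "\<forall>i<n. \<forall>j<length (ps ! i). \<forall>v\<in>set (ps ! i ! j). lab i v = j"
    using run_parse_prog[of ps B s] ps fam nB s le_trans unfolding s1_def lab_def by blast+
  define s2 where "s2 = run B partition_prog s1"
  define c where "c = mat s2 aC"
  have c: "separates n lab c"
    using run_partition_prog[of s1 n B, OF s1(1) nB] by (simp add: c_def s2_def lab_def)
  have s2: "s2 (G rN) = n" "mat s2 aL = lab"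
    using s1(1) by (auto simp: s2_def lab_def intro!: ext)
  define s3 where "s3 = run B nodes_prog s2"
  define L where "L = all_nodes n lab c n"
  have L: "stored n s3 L"
    using run_nodes_prog[of s2 n B, OF s2(1) nB] s2(2) by (simp add: s3_def L_def c_def)
  have s3: "s3 (G rN) = n" using s2 by (simp add: s3_def)
  have setL: "set L = {U. strong n lab U \<and> U \<noteq> {}}"
  proof (intro equalityI subsetI)
    fix U assume "U \<in> set L"
    then show "U \<in> {U. strong n lab U \<and> U \<noteq> {}}"
      using node_ok_strong[OF c] clo_memb(1) unfolding L_def set_all_nodes by blast
  next
    fix U assume "U \<in> {U. strong n lab U \<and> U \<noteq> {}}"
    then show "U \<in> set L"
      using strong_node_ok[OF c, of U] unfolding L_def set_all_nodes by blast
  qed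
  have sub: "A \<subseteq> {..<n}" if "A \<in> set L" for A
    using that setL by (auto simp: strong_def um_def)
  have dL: "distinct L" by (simp add: L_def distinct_all_nodes)
  have "card (set L) \<le> 2 * card {..<n}"
    by (rule laminar_card) (use setL sub in \<open>auto simp: strong_def\<close>)
  then have lenL: "length L \<le> B" using B distinct_card[OF dL] by simp
  define s4 where "s4 = run B out_sets s3"
  define ws where "ws = encode_family (map (elements n) L)"
  have s4: "s4 (G rP) = length ws" "tape_at s4 0 ws"
    "\<And>i. i < length L \<Longrightarrow> s4 (M aZ i 0) = card (L ! i)"
    using run_out_sets[of s3 n B L, OF s3 nB L lenL] sub length_elements
    by (auto simp: s4_def ws_def)
  have st4: "s4 (G rN) = n" "stored n s4 L"
    using s3 L by (auto simp: s4_def stored_def)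
  have t: "t = run B out_parents s4"
    by (simp add: t_def main_prog_def s4_def s3_def s2_def s1_def)
  show ?thesis
    using run_out_parents[of s4 n B L ws, OF st4(1) nB st4(2) lenL sub s4(3,2,1)] s1(2) dL setL
    unfolding t[symmetric] encode_tree_def ws_def by blast
qed

text \<open>Sets the base address \<open>D = K * (n + 2) ^ 4\<close> and the loop bound
  \<open>2 * n\<close>, reading \<open>n\<close> from cell 0, where the input begins. It is written
  directly for the machine, as the loop language cannot multiply and does not see these two
  registers.\<close>

definition prelude :: "nat \<Rightarrow> com" where
  "prelude K = (let m = Plus (Load (Const 0)) (Const 2) in
     Seq (Assign 1 (Times (Const K) (Times (Times m m) (Times m m))))
       (Assign 2 (Plus (Load (Const 0)) (Load (Const 0)))))"

lemma exec_prelude: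
  assumes "snd s 0 = n" "fst s = (\<lambda>_. 0)" "K * (n + 2) ^ 4 < W" "0 < K"
  shows "exec W (prelude K) s 28 ((\<lambda>_. 0)(1 := K * (n + 2) ^ 4, 2 := 2 * n), snd s)"
proof -
  let ?m = "Plus (Load (Const 0)) (Const 2)"
  let ?e = "Times (Const K) (Times (Times ?m ?m) (Times ?m ?m))"
  let ?D = "K * (n + 2) ^ 4"
  have m: "(n + 2) ^ 4 = (n + 2) * (n + 2) * ((n + 2) * (n + 2))"
    by (simp only: power4_eq_xxxx mult.assoc)
  have p: "(n + 2) ^ 4 \<le> ?D" using assms(4) by simp
  have "(n + 2) ^ 2 \<le> (n + 2) ^ 4" by (intro power_increasing) auto
  then have q: "(n + 2) * (n + 2) \<le> (n + 2) ^ 4" by (simp add: power2_eq_square)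
  have "(n + 2) * 2 \<le> (n + 2) * (n + 2)" by (rule mult_le_mono2) simp
  then have r: "2 * n + 4 \<le> (n + 2) * (n + 2)" by simp
  have k: "K \<le> ?D" using one_le_power[of "n + 2" 4] by simp
  \<comment> \<open>\<open>M\<close> hides \<open>n + 2\<close> from the simplifier, so that the
    products remain atoms for linear arithmetic.\<close>
  obtain M where M: "n + 2 = M" by blast
  have less: "M < W" "2 < W" "n < W" "2 * n < W" "K < W" "M * M < W" "M * M * (M * M) < W"
    using p[unfolded M] q[unfolded M] r[unfolded M] k[unfolded M] assms(3)[unfolded M] m[unfolded M] M
    by linarith+
  have less': "K * (M * M * (M * M)) < W" using assms(3)[unfolded M] by (simp only: m[unfolded M])
  have M': "Suc (Suc n) = M" using M by simp
  have e: "aval ?e s = ?D" "afits W ?e s" "acost ?e + 1 = 22"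
    using less less' assms(1) m[unfolded M] M' by (simp_all add: M)
  have s1: "exec W (Assign 1 ?e) s 22 ((\<lambda>_. 0)(1 := ?D), snd s)"
    using exec.Assign[OF e(2), of 1] by (simp only: e assms(2))
  let ?f = "Plus (Load (Const 0)) (Load (Const 0))" and ?s = "((\<lambda>_. 0)(1 := ?D), snd s)"
  have f: "aval ?f ?s = 2 * n" "afits W ?f ?s" "acost ?f + 1 = 6"
    using assms(1) less by simp_all
  have s2: "exec W (Assign 2 ?f) ?s 6 ((\<lambda>_. 0)(1 := ?D, 2 := 2 * n), snd s)"
    using exec.Assign[OF f(2), of 2] by (simp only: f fst_conv snd_conv)
  show ?thesis using exec.Seq[OF s1 s2] by (simp add: prelude_def Let_def)
qed

section \<open>Transfer along the naming of the elements\<close>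

locale named_relation =
  fixes X :: "'a set" and H e n ps
  assumes fin: "finite X" and hom: "homogeneous X H" and n: "n = card X"
    and e: "bij_betw e {..<n} X" and rel: "lists_relation e X H ps"
begin

lemma inj: "i < n \<Longrightarrow> j < n \<Longrightarrow> e i = e j \<longleftrightarrow> i = j"
  using e by (auto simp: bij_betw_def inj_on_def)

lemma e_in: "i < n \<Longrightarrow> e i \<in> X"
  using e by (auto simp: bij_betw_def)

lemma e_surj: "x \<in> X \<Longrightarrow> \<exists>i<n. x = e i"
  using e by (auto simp: bij_betw_def)

lemma family: "i < n \<Longrightarrow> lists_family e n (ps ! i) ((X - {e i}) // slice H (e i))"
  using rel n by (simp add: lists_relation_def)

lemma equiv: "i < n \<Longrightarrow> equiv (X - {e i}) (slice H (e i))"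
  using hom e_in by (simp add: homogeneous_def)

lemma class_names: "i < n \<Longrightarrow> c \<in> set (ps ! i) \<Longrightarrow> distinct c \<and> set c \<subseteq> {..<n}"
  using family[of i] by (simp add: lists_family_def)

lemma class_in_quotient:
  "i < n \<Longrightarrow> j < length (ps ! i) \<Longrightarrow> e ` set (ps ! i ! j) \<in> (X - {e i}) // slice H (e i)"
  using family[of i] unfolding lists_family_def by auto

lemma class_inj:
  assumes "i < n" "j < length (ps ! i)" "j' < length (ps ! i)"
    "e ` set (ps ! i ! j) = e ` set (ps ! i ! j')"
  shows "j = j'"
proof -
  have "distinct (map (\<lambda>c. e ` set c) (ps ! i))"
    using family[OF assms(1)] by (simp add: lists_family_def)
  from nth_eq_iff_index_eq[OF this, of j j'] show ?thesis using assms by simp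
qed

lemma disjoint: "i < n \<Longrightarrow> disjoint_classes (ps ! i)"
  unfolding disjoint_classes_def
proof (intro allI impI)
  fix j j' assume i: "i < n" and j: "j < length (ps ! i)" "j' < length (ps ! i)" "j \<noteq> j'"
  have "e ` set (ps ! i ! j) \<inter> e ` set (ps ! i ! j') = {}"
    using quotient_disj[OF equiv[OF i] class_in_quotient[OF i j(1)] class_in_quotient[OF i j(2)]]
      class_inj[OF i j(1,2)] j(3) by blast
  then show "set (ps ! i ! j) \<inter> set (ps ! i ! j') = {}" by blast
qed

lemma length_family:
  assumes "i < n"
  shows "length (ps ! i) \<le> n"
proof -
  let ?Q = "(X - {e i}) // slice H (e i)"
  have "distinct (map (\<lambda>c. e ` set c) (ps ! i))" "set (map (\<lambda>c. e ` set c) (ps ! i)) = ?Q"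
    using family[OF assms] by (simp_all add: lists_family_def)
  then have "length (ps ! i) = card ?Q" by (metis distinct_card length_map)
  also have "?Q = (\<lambda>x. slice H (e i) `` {x}) ` (X - {e i})" by (auto simp: quotient_def)
  also have "card \<dots> \<le> card (X - {e i})" using fin by (intro card_image_le) auto
  also have "\<dots> \<le> n" unfolding n using fin by (intro card_mono) auto
  finally show ?thesis .
qed

lemma length_class:
  assumes "i < n" "c \<in> set (ps ! i)"
  shows "length c \<le> n"
proof -
  have "length c = card (set c)" using class_names[OF assms] by (simp add: distinct_card)
  also have "\<dots> \<le> card {..<n}" using class_names[OF assms] by (intro card_mono) auto
  finally show ?thesis by simp
qed

end

locale labelled_relation = named_relation X H e n ps
  for X :: "'a set" and H e n ps +
  fixes lab
  assumes lab: "\<And>i j v. i < n \<Longrightarrow> j < length (ps ! i) \<Longrightarrow> v \<in> set (ps ! i ! j) \<Longrightarrow> lab i v = j"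
begin

lemma lab_eq:
  assumes i: "i < n" and v: "v < n" "v \<noteq> i" and w: "w < n" "w \<noteq> i"
  shows "(e i, e v, e w) \<in> H \<longleftrightarrow> lab i v = lab i w"
proof -
  let ?r = "slice H (e i)" and ?A = "X - {e i}"
  have mem: "e v \<in> ?A" "e w \<in> ?A" using i v w e_in inj by auto
  have cls: "\<exists>j<length (ps ! i). u \<in> set (ps ! i ! j) \<and> ?r `` {e u} = e ` set (ps ! i ! j)"
    if u: "u < n" "e u \<in> ?A" for u
  proof -
    have "?r `` {e u} \<in> ?A // ?r" using u by (intro quotientI)
    then have "?r `` {e u} \<in> set (map (\<lambda>c. e ` set c) (ps ! i))"
      using family[OF i] unfolding lists_family_def by blast
    then obtain c where c: "c \<in> set (ps ! i)" "?r `` {e u} = e ` set c" by auto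
    then obtain j where j: "j < length (ps ! i)" "c = ps ! i ! j" by (auto simp: in_set_conv_nth)
    have "e u \<in> e ` set c" using c(2) equiv_class_self[OF equiv[OF i] u(2)] by simp
    then have "u \<in> set c" using class_names[OF i c(1)] inj u(1) by auto
    then show ?thesis using c j by blast
  qed
  obtain j where j: "j < length (ps ! i)" "v \<in> set (ps ! i ! j)" "?r `` {e v} = e ` set (ps ! i ! j)"
    using cls[OF v(1) mem(1)] by blast
  obtain k where k: "k < length (ps ! i)" "w \<in> set (ps ! i ! k)" "?r `` {e w} = e ` set (ps ! i ! k)"
    using cls[OF w(1) mem(2)] by blast
  have "(e i, e v, e w) \<in> H \<longleftrightarrow> (e v, e w) \<in> ?r" by (simp add: slice_def)
  also have "\<dots> \<longleftrightarrow> ?r `` {e v} = ?r `` {e w}"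
    using eq_equiv_class_iff[OF equiv[OF i] mem] by simp
  also have "\<dots> \<longleftrightarrow> j = k" using class_inj[OF i j(1) k(1)] j(3) k(3) by auto
  also have "\<dots> \<longleftrightarrow> lab i v = lab i w" using lab[OF i j(1,2)] lab[OF i k(1,2)] by simp
  finally show ?thesis .
qed

lemma umodule_iff:
  assumes "U \<subseteq> {..<n}"
  shows "umodule X H (e ` U) \<longleftrightarrow> um n lab U"
proof -
  have X: "X - e ` U = e ` ({..<n} - U)"
  proof (intro equalityI subsetI)
    fix x assume "x \<in> X - e ` U"
    then show "x \<in> e ` ({..<n} - U)" using e_surj[of x] by blast
  next
    fix x assume "x \<in> e ` ({..<n} - U)"
    then obtain i where i: "i < n" "i \<notin> U" "x = e i" by blast
    moreover have "e i \<noteq> e u" if "u \<in> U" for u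
    proof -
      have "u < n" "u \<noteq> i" using that assms i(2) by auto
      then show ?thesis using inj[OF i(1)] by blast
    qed
    ultimately show "x \<in> X - e ` U" using e_in[OF i(1)] by auto
  qed
  let ?V = "{..<n} - U"
  \<comment> \<open>Membership in \<open>U\<close> and in its complement makes the elements
    distinct, which is what \<open>lab_eq\<close> demands.\<close>
  have H: "(e u, e z, e z') \<in> H \<longleftrightarrow> lab u z = lab u z'"
    if "u \<in> U" "z \<in> ?V" "z' \<in> ?V" for u z z'
    using that assms by (intro lab_eq) auto
  have "e ` U \<subseteq> X" using assms e_in by auto
  then have "umodule X H (e ` U) \<longleftrightarrow> (\<forall>u\<in>U. \<forall>u'\<in>U. \<forall>z\<in>?V. \<forall>z'\<in>?V.
      ((e u, e z, e z') \<in> H) = ((e u', e z, e z') \<in> H))"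
    unfolding umodule_def X by simp
  also have "\<dots> \<longleftrightarrow> (\<forall>u\<in>U. \<forall>u'\<in>U. \<forall>z\<in>?V. \<forall>z'\<in>?V.
      (lab u z = lab u z') = (lab u' z = lab u' z'))"
    by (intro ball_cong refl) (simp only: H)
  also have "\<dots> \<longleftrightarrow> um n lab U"
    using assms unfolding um_def agree_def by blast
  finally show ?thesis .
qed

lemma overlap_iff:
  assumes "U \<subseteq> {..<n}" "U' \<subseteq> {..<n}"
  shows "overlap (e ` U) (e ` U') \<longleftrightarrow> overlap U U'"
proof -
  have i: "inj_on e {..<n}" using e by (simp add: bij_betw_def)
  have "e ` U \<inter> e ` U' = e ` (U \<inter> U')" using inj_on_image_Int[OF i assms] by simp
  moreover have "e ` U - e ` U' = e ` (U - U')"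
    using inj_on_image_set_diff[OF i _ assms(2), of U] assms(1) by blast
  moreover have "e ` U' - e ` U = e ` (U' - U)"
    using inj_on_image_set_diff[OF i _ assms(1), of U'] assms(2) by blast
  ultimately show ?thesis by (simp add: overlap_def)
qed

lemma subset_image:
  assumes "U' \<subseteq> X"
  shows "\<exists>U\<subseteq>{..<n}. U' = e ` U"
proof -
  have "U' \<subseteq> e ` {..<n}" using assms e by (simp add: bij_betw_def)
  then show ?thesis by (auto simp: subset_image_iff)
qed

lemma strong_iff:
  assumes "U \<subseteq> {..<n}"
  shows "strong_umodule X H (e ` U) \<longleftrightarrow> strong n lab U"
proof -
  have "(\<forall>V. umodule X H V \<longrightarrow> \<not> overlap (e ` U) V) \<longleftrightarrow> (\<forall>V. um n lab V \<longrightarrow> \<not> overlap U V)"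
  proof (intro iffI allI impI)
    fix V assume "\<forall>V. umodule X H V \<longrightarrow> \<not> overlap (e ` U) V" "um n lab V"
    moreover then have "V \<subseteq> {..<n}" by (simp add: um_def)
    ultimately show "\<not> overlap U V" using umodule_iff overlap_iff[OF assms] by blast
  next
    fix V assume *: "\<forall>V. um n lab V \<longrightarrow> \<not> overlap U V" "umodule X H V"
    then have "V \<subseteq> X" by (simp add: umodule_def)
    then obtain V' where "V' \<subseteq> {..<n}" "V = e ` V'" using subset_image by blast
    then show "\<not> overlap (e ` U) V" using * umodule_iff overlap_iff[OF assms] by blast
  qed
  then show ?thesis unfolding strong_umodule_def strong_def using umodule_iff[OF assms] by simp
qed

lemma tree_nodes_image: "tree_nodes X H = image e ` {U. strong n lab U \<and> U \<noteq> {}}"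
proof (intro equalityI subsetI)
  fix V assume V: "V \<in> tree_nodes X H"
  then have "V \<subseteq> X" by (simp add: tree_nodes_def strong_umodule_def umodule_def)
  then obtain U where "U \<subseteq> {..<n}" "V = e ` U" using subset_image by blast
  then show "V \<in> image e ` {U. strong n lab U \<and> U \<noteq> {}}"
    using V strong_iff by (auto simp: tree_nodes_def)
next
  fix V assume "V \<in> image e ` {U. strong n lab U \<and> U \<noteq> {}}"
  then obtain U where U: "strong n lab U" "U \<noteq> {}" "V = e ` U" by blast
  then have "U \<subseteq> {..<n}" by (simp add: strong_def um_def)
  then show "V \<in> tree_nodes X H" using U strong_iff by (simp add: tree_nodes_def)
qed

lemma lists_tree_elements:
  assumes L: "distinct L" "set L = {U. strong n lab U \<and> U \<noteq> {}}"
    and par: "length par = length L" "\<And>i. i < length L \<Longrightarrow> parent_ok L i (par ! i)"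
  shows "lists_tree e n (tree_nodes X H) (map (elements n) L) par"
proof -
  have i: "inj_on e {..<n}" using e by (simp add: bij_betw_def)
  have sub: "A \<subseteq> {..<n}" if "A \<in> set L" for A
    using that L by (auto simp: strong_def um_def)
  have el: "set (elements n A) = A" if "A \<in> set L" for A
    using sub[OF that] by (auto simp: elements_def)
  have map: "map (\<lambda>c. e ` set c) (map (elements n) L) = map (image e) L"
    using el by simp
  have injL: "inj_on (image e) (set L)"
    using inj_on_image_Pow[OF i] sub by (rule_tac inj_on_subset) auto
  have N: "tree_nodes X H = image e ` set L" using tree_nodes_image L(2) by simp
  have fam: "lists_family e n (map (elements n) L) (tree_nodes X H)"
    unfolding lists_family_def map using L(1) injL N
    by (auto simp: distinct_map elements_def)
  have img: "e ` A \<subseteq> e ` A' \<longleftrightarrow> A \<subseteq> A'" if "A \<in> set L" "A' \<in> set L" for A A'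
  proof
    assume "e ` A \<subseteq> e ` A'"
    then show "A \<subseteq> A'" using inj_on_image_mem_iff[OF i _ sub[OF that(2)]] sub[OF that(1)] by blast
  qed blast
  have psub: "e ` A \<subset> e ` A' \<longleftrightarrow> A \<subset> A'" if "A \<in> set L" "A' \<in> set L" for A A'
    using img[OF that] img[OF that(2,1)] by (simp only: less_le_not_le)
  have "par ! i < length L \<and>
        (if \<exists>B\<in>tree_nodes X H. e ` (L ! i) \<subset> B
         then covered_by (tree_nodes X H) (e ` (L ! i)) (e ` (L ! (par ! i)))
         else par ! i = i)" if i: "i < length L" for i
  proof -
    have up: "(\<exists>B\<in>tree_nodes X H. e ` (L ! i) \<subset> B) \<longleftrightarrow> (\<exists>j<length L. L ! i \<subset> L ! j)"
    proof -
      have "(\<exists>B\<in>tree_nodes X H. e ` (L ! i) \<subset> B) \<longleftrightarrow> (\<exists>A\<in>set L. e ` (L ! i) \<subset> e ` A)"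
        unfolding N by blast
      also have "\<dots> \<longleftrightarrow> (\<exists>A\<in>set L. L ! i \<subset> A)"
        using psub[OF nth_mem[OF i]] by (intro bex_cong refl)
      also have "\<dots> \<longleftrightarrow> (\<exists>j<length L. L ! i \<subset> L ! j)"
        by (metis in_set_conv_nth)
      finally show ?thesis .
    qed
    show ?thesis
    proof (cases "\<exists>j<length L. L ! i \<subset> L ! j")
      case True
      then have p: "par ! i < length L" "L ! i \<subset> L ! (par ! i)"
        "\<And>j. j < length L \<Longrightarrow> L ! i \<subset> L ! j \<Longrightarrow> card (L ! (par ! i)) \<le> card (L ! j)"
        using par(2)[OF i] by (auto simp: parent_ok_def split: if_splits)
      have "\<not> (\<exists>C\<in>tree_nodes X H. e ` (L ! i) \<subset> C \<and> C \<subset> e ` (L ! (par ! i)))"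
      proof
        assume "\<exists>C\<in>tree_nodes X H. e ` (L ! i) \<subset> C \<and> C \<subset> e ` (L ! (par ! i))"
        then obtain A where A: "A \<in> set L" "e ` (L ! i) \<subset> e ` A" "e ` A \<subset> e ` (L ! (par ! i))"
          unfolding N by blast
        then obtain j where j: "j < length L" "A = L ! j" by (metis in_set_conv_nth)
        have ij: "L ! i \<subset> L ! j" "L ! j \<subset> L ! (par ! i)"
          using A psub[OF nth_mem[OF i] A(1)] psub[OF A(1) nth_mem[OF p(1)]] j(2) by simp_all
        have "finite (L ! (par ! i))"
          using sub[OF nth_mem[OF p(1)]] by (rule finite_subset) simp
        then have "card (L ! j) < card (L ! (par ! i))" using ij(2) by (rule psubset_card_mono)
        then show False using p(3)[OF j(1) ij(1)] by simp
      qed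
      then have "covered_by (tree_nodes X H) (e ` (L ! i)) (e ` (L ! (par ! i)))"
        using N i p(1,2) psub[OF nth_mem[OF i] nth_mem[OF p(1)]] by (simp add: covered_by_def)
      then show ?thesis using True up p(1) by simp
    next
      case False
      then have "par ! i = i" using par(2)[OF i] by (auto simp: parent_ok_def split: if_splits)
      moreover have "\<not> (\<exists>B\<in>tree_nodes X H. e ` (L ! i) \<subset> B)" using False up by blast
      ultimately show ?thesis using i by simp
    qed
  qed
  then show ?thesis using fam par(1) el by (simp add: lists_tree_def)
qed

end

text \<open>The base is at least 2, so a constant factor is absorbed by a larger exponent; this
  yields the word size constant \<open>k\<close>.\<close>

lemma power_le_const:
  fixes C :: nat
  shows "\<exists>k. \<forall>n. C * (n + 2) ^ d < (n + 2) ^ k"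
proof -
  obtain q where q: "C < 2 ^ q" using less_exp by blast
  have "C * (n + 2) ^ d < (n + 2) ^ (q + d)" for n
  proof -
    have "(2 :: nat) ^ q \<le> (n + 2) ^ q" by (rule power_mono) auto
    then have "C < (n + 2) ^ q" using q by (rule order.strict_trans2[rotated])
    then show ?thesis by (simp add: power_add)
  qed
  then show ?thesis by blast
qed

lemma encode_relation_bound:
  assumes "length ps \<le> n" "\<And>fam. fam \<in> set ps \<Longrightarrow> length fam \<le> n"
    "\<And>fam c. fam \<in> set ps \<Longrightarrow> c \<in> set fam \<Longrightarrow> length c \<le> n \<and> set c \<subseteq> {..<n}"
    and "w \<in> set (encode_relation ps)"
  shows "w \<le> n"
  using assms(4) assms(1-3)
  by (fastforce simp: encode_relation_def encode_family_def)

theorem theorem2: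
  shows "\<exists>(prog :: com) (k :: nat) (T :: nat \<Rightarrow> nat).
    (\<lambda>n. real (T n)) \<in> O(\<lambda>n. real n ^ 4 * ln (real n)) \<and>
    computes_tree_in_time TYPE('a) prog k T"
proof -
  obtain K where K: "\<And>B. tm B main_prog \<le> K * (B + 1) ^ 4"
    using tm_poly[of main_prog] by auto
  \<comment> \<open>Makes \<open>D\<close> exceed initial values plus running time:
    \<open>(2 * n + 1) ^ 4\<close> is at most \<open>16 * (n + 2) ^ 4\<close>, and the summand 2
    pays for the initial bound \<open>2 * n + 1\<close>.\<close>
  define K0 where "K0 = 16 * K + 2"
  \<comment> \<open>\<open>word_bound D\<close> expands to
    \<open>64 * D\<^sup>2 + 17 * D + 16\<close>, which is at most \<open>97 * D\<^sup>2\<close>;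
    squaring \<open>D\<close> gives the exponent 8.\<close>
  obtain k where k: "\<And>n. 97 * K0 ^ 2 * (n + 2) ^ 8 < (n + 2) ^ k"
    using power_le_const by blast
  define T where "T n = 28 + K * (2 * n + 1) ^ 4" for n
  have "(\<lambda>n. real (T n)) \<in> O(\<lambda>n. real n ^ 4 * ln (real n))"
  proof (rule bigoI)
    show "\<forall>\<^sub>F n in sequentially.
      norm (real (T n)) \<le> real (28 + 81 * K) * norm (real n ^ 4 * ln (real n))"
    proof (rule eventually_sequentiallyI)
      \<comment> \<open>From 3 on, \<open>ln n\<close> is at least 1 and \<open>2 * n + 1\<close> is
        at most \<open>3 * n\<close>, whence the factor 81.\<close>
      fix n :: nat assume n: "3 \<le> n"
      have "1 \<le> ln (real n)" using n exp_le by (simp add: ln_ge_iff)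
      have "(2 * n + 1) ^ 4 \<le> (3 * n) ^ 4" using n by (intro power_mono) auto
      then have "K * (2 * n + 1) ^ 4 \<le> K * (81 * n ^ 4)" by (simp add: power_mult_distrib)
      moreover have "28 \<le> 28 * n ^ 4" using n by simp
      moreover have "(28 + 81 * K) * n ^ 4 = 28 * n ^ 4 + K * (81 * n ^ 4)"
        by (simp add: algebra_simps)
      ultimately have "T n \<le> (28 + 81 * K) * n ^ 4" unfolding T_def by linarith
      then have "real (T n) \<le> real ((28 + 81 * K) * n ^ 4)" by (rule of_nat_mono)
      also have "\<dots> \<le> real ((28 + 81 * K) * n ^ 4) * ln (real n)"
        using \<open>1 \<le> ln (real n)\<close> mult_left_mono[of 1 "ln (real n)" "real ((28 + 81 * K) * n ^ 4)"] by simp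
      finally show "norm (real (T n)) \<le> real (28 + 81 * K) * norm (real n ^ 4 * ln (real n))"
        using \<open>1 \<le> ln (real n)\<close> by (simp add: abs_mult mult.assoc)
    qed
  qed
  moreover have "computes_tree_in_time TYPE('a) (Seq (prelude K0) (compile main_prog)) k T"
    unfolding computes_tree_in_time_def
  proof (intro allI impI)
    fix X :: "'a set" and H e ps
    assume X: "finite X" "homogeneous X H" "bij_betw e {..<card X} X" "lists_relation e X H ps"
    define n where "n = card X"
    define B where "B = 2 * n"
    define D where "D = K0 * (n + 2) ^ 4"
    define W where "W = (n + 2) ^ k"
    let ?s = "initial_state (encode_relation ps)"
    have len: "length ps = n" using X(4) by (simp add: lists_relation_def n_def)
    interpret named_relation X H e n ps
      using X by unfold_locales (auto simp: n_def)
    have mem: "\<exists>i<n. fam = ps ! i" if "fam \<in> set ps" for fam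
      using that len by (auto simp: in_set_conv_nth)
    have fam: "length fam \<le> n \<and> disjoint_classes fam" if "fam \<in> set ps" for fam
      using mem[OF that] disjoint length_family by auto
    have cls: "length c \<le> n \<and> set c \<subseteq> {..<n}" if "fam \<in> set ps" "c \<in> set fam" for fam c
      using mem[OF that(1)] that(2) length_class class_names by blast
    define m where "m = snd ?s"
    have m: "m a \<le> n" for a
    proof (cases "a < length (encode_relation ps)")
      case True
      then have "encode_relation ps ! a \<le> n"
        using encode_relation_bound[of ps n] len fam cls by simp
      then show ?thesis using True by (simp add: m_def initial_state_def)
    qed (simp add: m_def initial_state_def)
    have m0: "m 0 = n" by (simp add: m_def initial_state_def encode_relation_def len)
    \<comment> \<open>The abstract store is read off the actual memory, so the arrays start with
      whatever lies at their addresses; only the bound \<open>n\<close> on these values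
      matters.\<close>
    define \<sigma> where "\<sigma> l = (case l of G r \<Rightarrow> 0 | Tp p \<Rightarrow> m p | M a i j \<Rightarrow> m (D + cell a i j))" for l
    define s1 :: state where "s1 = ((\<lambda>_. 0)(1 := D, 2 := B), m)"
    have p1: "1 \<le> (n + 2) ^ 4" by simp
    have D0: "1 \<le> D" using p1 by (simp add: D_def K0_def Suc_le_eq)
    have wb: "word_bound D < W"
    proof -
      have "D \<le> D * D" using D0 by simp
      moreover have "1 \<le> D * D" using D0 by (simp add: Suc_le_eq)
      moreover have "word_bound D = 17 * D + 16 + 64 * (D * D)"
        by (simp add: word_bound_def algebra_simps)
      ultimately have "word_bound D \<le> 97 * (D * D)" by linarith
      also have "97 * (D * D) = 97 * K0 ^ 2 * (n + 2) ^ 8"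
        by (simp add: D_def power2_eq_square power_add[symmetric, of _ 4 4])
      also have "\<dots> < W" using k by (simp add: W_def)
      finally show ?thesis .
    qed
    have pre: "exec W (prelude K0) ?s 28 s1"
    proof -
      have "D < W" using wb by (simp add: word_bound_def)
      then show ?thesis
        using exec_prelude[of ?s n K0 W] m0
        by (simp add: m_def s1_def D_def B_def K0_def initial_state_def)
    qed
    have rep: "represents D B \<sigma> s1"
      by (simp add: represents_def s1_def \<sigma>_def)
    \<comment> \<open>\<open>2 * n + 1\<close> instead of \<open>n\<close>, since the initial bound
      must also dominate 1 and \<open>B\<close>.\<close>
    have \<sigma>: "\<sigma> l \<le> 2 * n + 1" for l
    proof -
      have "m a \<le> 2 * n + 1" for a using m[of a] by simp
      then show ?thesis by (simp add: \<sigma>_def split: loc.split)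
    qed
    have tm: "tm B main_prog \<le> K * (2 * n + 1) ^ 4" using K[of B] by (simp add: B_def)
    have "2 * n + 1 + tm B main_prog < D"
    proof -
      have "(2 * n + 1) ^ 4 \<le> (2 * (n + 2)) ^ 4" by (intro power_mono) auto
      then have "(2 * n + 1) ^ 4 \<le> 16 * (n + 2) ^ 4" by (simp only: power_mult_distrib) simp
      then have "tm B main_prog \<le> K * (16 * (n + 2) ^ 4)"
        using tm mult_le_mono2[of _ _ K] le_trans by blast
      moreover have "n + 2 \<le> (n + 2) ^ 4" using power_increasing[of 1 4 "n + 2"] by simp
      ultimately show ?thesis unfolding D_def K0_def add_mult_distrib by linarith
    qed
    from compile_correct[OF main_prog_simps(1) rep \<sigma> _ _ this wb]
    obtain t s2 where s2: "exec W (compile main_prog) s1 t s2" "t \<le> tm B main_prog"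
      "represents D B (run B main_prog \<sigma>) s2"
      "\<And>l. run B main_prog \<sigma> l \<le> 2 * n + 1 + tm B main_prog"
      by (auto simp: B_def)
    have tape: "tape_at \<sigma> 0 (encode_relation ps)"
      by (simp add: tape_at_def \<sigma>_def m_def initial_state_def)
    obtain lab L par where lab: "\<forall>i<n. \<forall>j<length (ps ! i). \<forall>v\<in>set (ps ! i ! j). lab i v = j"
      and L: "distinct L" "set L = {U. strong n lab U \<and> U \<noteq> {}}"
      and par: "length par = length L" "\<forall>i<length L. parent_ok L i (par ! i)"
      and out: "tape_at (run B main_prog \<sigma>) 0 (encode_tree (map (elements n) L) par)"
        "run B main_prog \<sigma> (G rP) = length (encode_tree (map (elements n) L) par)"
      using run_main_prog[of n B ps \<sigma>, OF _ len fam _ tape] cls unfolding B_def by blast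
    interpret labelled_relation X H e n ps lab
      using lab by unfold_locales auto
    have tree: "lists_tree e n (tree_nodes X H) (map (elements n) L) par"
      using lists_tree_elements[OF L par(1)] par(2) by blast
    \<comment> \<open>The output length is the final value of a register and so obeys the general
      value bound; hence the output ends below the arrays, where memory and abstract tape
      coincide.\<close>
    have "length (encode_tree (map (elements n) L) par) < D"
      using s2(4)[of "G rP"] \<open>2 * n + 1 + tm B main_prog < D\<close> out(2) by simp
    then have "has_output s2 (encode_tree (map (elements n) L) par)"
      using s2(3) out(1) by (simp add: has_output_def represents_def tape_at_def)
    moreover have "exec ((card X + 2) ^ k) (Seq (prelude K0) (compile main_prog)) ?s (28 + t) s2"
      using exec.Seq[OF pre s2(1)] by (simp add: W_def n_def)
    moreover have "28 + t \<le> T (card X)"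
      using s2(2) tm by (simp add: T_def n_def)
    ultimately show "\<exists>t s cs par.
           exec ((card X + 2) ^ k) (Seq (prelude K0) (compile main_prog)) ?s t s \<and>
           t \<le> T (card X) \<and>
           lists_tree e (card X) (tree_nodes X H) cs par \<and>
           has_output s (encode_tree cs par)"
      using tree n_def by blast
  qed
  ultimately show ?thesis by blast
qed

end
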